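(* Let $q$ be real with $0<q<1$. Let $r,s\ge0$ be integers with $r>s+1$ and put $k=r-s-1$, $p=q^k$. Let $\bm{\alpha}=(\alpha_1,\ldots,\alpha_r)\in\mathbb{C}^r$ with $\alpha_i-\alpha_j\notin\mathbb{Z}$ for $i\neq j$, and let $\bm{\beta}=(\beta_1,\ldots,\beta_s)\in\mathbb{C}^s$ with $\beta_1,\ldots,\beta_s\notin\mathbb{Z}_{\le0}$. Let $\lambda\in\mathbb{C}^*\setminus(-1)^k\mathbb{R}_+$. Then for every $x\in\mathbb{C}^*\setminus(-1)^{k+1}\lambda\mathbb{R}_+$, $$\lim_{q\to1}{}_rf_s\left(q^{\bm{\alpha}};q^{\bm{\beta}};\lambda;q,\frac{(-1)^kx}{(1-q)^k}\right)=C_{\bm{\alpha\beta}}\sum_{j=1}^rC_{\bm{\alpha\beta}}(j)\,(-x)^{-\alpha_j}\,{}_{s+1}F_{r-1}\left(\begin{matrix}\alpha_j,\ 1+\alpha_j-\bm{\beta}\\ 1+\alpha_j-\widehat{\bm{\alpha}_j}\end{matrix};\frac{(-1)^k}{x}\right),$$ where $q^{\bm{\alpha}}=(q^{\alpha_1},\ldots,q^{\alpha_r})$, $q^{\bm{\beta}}=(q^{\beta_1},\ldots,q^{\beta_s})$, the branch of $(-x)^{-\alpha_j}$ is determined by $\big|\arg(-x)-\arg\big((-1)^{k-1}\lambda\big)\big|<\pi$ with $\arg\big((-1)^{k-1}\lambda\big)\in(-\pi,\pi)$, and $$C_{\bm{\alpha\beta}}=\frac{\prod_{l=1}^s\Gamma(\beta_l)}{\prod_{l=1}^r\Gamma(\alpha_l)},\qquad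 C_{\bm{\alpha\beta}}(j)=\frac{\Gamma(\alpha_j)\prod_{l\ne j}\Gamma(\alpha_l-\alpha_j)}{\prod_{l=1}^s\Gamma(\beta_l-\alpha_j)},$$ the factor $\Gamma(\alpha_j)$ being cancelled in the product $C_{\bm{\alpha\beta}}C_{\bm{\alpha\beta}}(j)$.
   Context: Notation. $\mathbb{R}_+=(0,\infty)$, $\mathbb{C}^*=\mathbb{C}\setminus\{0\}$. $\widehat{\bm{\alpha}_j}\in\mathbb{C}^{r-1}$ is $\bm{\alpha}$ with its $j$-th component omitted; $1+\alpha_j-\bm{\beta}$ stands for the list $1+\alpha_j-\beta_1,\ldots,1+\alpha_j-\beta_s$, and $1+\alpha_j-\widehat{\bm{\alpha}_j}$ for the list $1+\alpha_j-\alpha_l$, $l\ne j$. The generalized hypergeometric series is ${}_mF_n(\bm{\alpha};\bm{\beta};z)=\sum_{i\ge0}\frac{(\alpha_1)_i\cdots(\alpha_m)_i}{(\beta_1)_i\cdots(\beta_n)_i\,i!}z^i$ with $(\alpha)_i=\alpha(\alpha+1)\cdots(\alpha+i-1)$. For a base $q$ with $0<|q|<1$: $(a;q)_n=\prod_{j=0}^{n-1}(1-aq^j)$, $(a_1,\ldots,a_m;q)_n=\prod_{j}(a_j;q)_n$, and $${}_r\varphi_s(\bm{a};\bm{b};q,x)=\sum_{n\ge0}\frac{(a_1,\ldots,a_r;q)_n}{(b_1,\ldots,b_s;q)_n(q;q)_n}\Big\{(-1)^nq^{\frac{n(n-1)}2}\Big\}^{1+s-r}x^n,$$ a formal power series in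 $x$. $\theta_q(x)=\sum_{n\in\mathbb{Z}}q^{\frac{n(n-1)}2}x^n$ for $x\in\mathbb{C}^*$, and $\theta_p$ is the same with base $p$. $[\lambda;q]=\{\lambda q^n:n\in\mathbb{Z}\}$. Definition of ${}_rf_s$. Let $p=q^k$, $k=r-s-1\geq 1$, let $\bm{a}\in(\mathbb{C}^* )^r$, $\bm{b}\in(\mathbb{C}^* )^s$ with $b_l\notin\{q^{-n}:n\ge0\}$ and $a_i/a_j\notin q^{\mathbb{Z}}$ for $i\ne j$, and let $\lambda\in\mathbb{C}^*\setminus[(-1)^k;q]$. The function ${}_rf_s(\bm{a};\bm{b};\lambda;q,x)$ is the $[\lambda;p]$-sum of the formal series $\hat f(x)={}_r\varphi_s(\bm{a};\bm{b};q,x)$, i.e. $${}_rf_s(\bm{a};\bm{b};\lambda;q,x)=\big(\mathcal{L}_{p;1}^{[\lambda;p]}\circ\hat{\mathcal{B}}_{p;1}\hat f\big)(x),$$ analytically continued to $x\in\mathbb{C}^*\setminus[-\lambda;p]$. Here the $p$-Borel transform $\hat{\mathcal{B}}_{p;1}$ of $\sum_{n\ge0}c_nx^n$ is $\sum_{n\ge0}c_n\,p^{\frac{n(n-1)}2}\xi^n$. For $\hat f(x)={}_r\varphi_s(\bm{a};\bm{b};q,x)$ it equals $g(\xi)=\sum_{n\ge0}\frac{(a_1,\ldots,a_r;q)_n}{(b_1,\ldots,b_s;q)_n(q;q)_n}\big((-1)^{k}\xi\big)^n$, convergent for $|\xi|<1$ and continued analytically to $\mathbb{C}^*\setminus[(-1)^k;q]$.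 The $p$-Laplace transform is $\big(\mathcal{L}_{p;1}^{[\lambda;p]}g\big)(x)=\sum_{n\in\mathbb{Z}}g(\lambda p^n)/\theta_p\big(\frac{\lambda p^n}{x}\big)$. In the limit $q\to1$ (with $q\in(0,1)$), only $q$ sufficiently close to $1$ matter, for which the parameters $\bm{a}=q^{\bm{\alpha}}$, $\bm{b}=q^{\bm{\beta}}$ satisfy $q^{\beta_l}\notin\{q^{-n}:n\ge0\}$ for all $l$ and $q^{\alpha_i}/q^{\alpha_j}\notin q^{\mathbb{Z}}$ for $i\ne j$. *)

theory Defs
  imports "HOL-Complex_Analysis.Complex_Analysis"
begin

text \<open>Parameter tuples are lists of complex numbers, indexed from 0.\<close>

definition omit_nth :: "nat \<Rightarrow> 'a list \<Rightarrow> 'a list" where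
  "omit_nth j xs = take j xs @ drop (Suc j) xs"

definition hypergeom_F :: "complex list \<Rightarrow> complex list \<Rightarrow> complex \<Rightarrow> complex" where
  "hypergeom_F as bs z =
     (\<Sum>i. (\<Prod>a\<leftarrow>as. pochhammer a i) / ((\<Prod>b\<leftarrow>bs. pochhammer b i) * fact i) * z ^ i)"

definition qpoch :: "complex \<Rightarrow> complex \<Rightarrow> nat \<Rightarrow> complex" where
  "qpoch a q n = (\<Prod>j<n. 1 - a * q ^ j)"

definition qpochs :: "complex list \<Rightarrow> complex \<Rightarrow> nat \<Rightarrow> complex" where
  "qpochs as q n = (\<Prod>a\<leftarrow>as. qpoch a q n)"

text \<open>The exponent \<open>1 + s - r\<close> may be negative, hence the integer power.\<close>

definition qhyp_phi :: "complex list \<Rightarrow> complex list \<Rightarrow> complex \<Rightarrow> complex fps" where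
  "qhyp_phi as bs q = Abs_fps (\<lambda>n.
     qpochs as q n / (qpochs bs q n * qpoch q q n) *
     ((-1) ^ n * q ^ (n * (n - 1) div 2)) powi (1 + int (length bs) - int (length as)))"

definition qtheta :: "complex \<Rightarrow> complex \<Rightarrow> complex" where
  "qtheta q x = (\<Sum>\<^sub>\<infinity>n\<in>(UNIV :: int set). q powi (n * (n - 1) div 2) * x powi n)"

definition qspiral :: "complex \<Rightarrow> complex \<Rightarrow> complex set" where
  "qspiral l q = range (\<lambda>n::int. l * q powi n)"

definition qborel :: "complex \<Rightarrow> complex fps \<Rightarrow> complex fps" where
  "qborel p f = Abs_fps (\<lambda>n. fps_nth f n * p ^ (n * (n - 1) div 2))"

definition qlaplace :: "complex \<Rightarrow> complex \<Rightarrow> (complex \<Rightarrow> complex) \<Rightarrow> complex \<Rightarrow> complex" where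
  "qlaplace p l g x =
     (\<Sum>\<^sub>\<infinity>n\<in>(UNIV :: int set). g (l * p powi n) / qtheta p (l * p powi n / x))"

text \<open>
  Analytic continuation of \<open>g\<close> from the unit disc to \<open>S\<close>. When \<open>S\<close> is open, connected and meets
  the disc, the values on \<open>S\<close> do not depend on the choice; values outside \<open>S\<close> are unspecified.
\<close>

definition continue_from_disc ::
  "complex set \<Rightarrow> (complex \<Rightarrow> complex) \<Rightarrow> complex \<Rightarrow> complex" where
  "continue_from_disc S g =
     (SOME h. h holomorphic_on S \<and> (\<forall>\<xi>\<in>S. norm \<xi> < 1 \<longrightarrow> h \<xi> = g \<xi>))"

text \<open>
  The \<open>[l;p]\<close>-sum of \<open>qhyp_phi as bs q\<close> with \<open>p = q ^ k\<close>, meant for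
  \<open>k = length as - length bs - 1 \<ge> 1\<close> and \<open>l \<notin> qspiral ((-1) ^ k) q\<close>.
  Since \<open>qtheta p (l * p powi n / x) = (l / x) powi (- n) * p powi (- (n * (n - 1) div 2)) * qtheta p (l / x)\<close>,
  the Laplace series converges absolutely for every nonzero \<open>x \<notin> qspiral (- l) p\<close>, so it is
  itself the continuation to that set of the sum near the origin.
\<close>

definition rfs ::
  "complex list \<Rightarrow> complex list \<Rightarrow> complex \<Rightarrow> complex \<Rightarrow> complex \<Rightarrow> complex" where
  "rfs as bs l q x =
     (let k = length as - length bs - 1;
          p = q ^ k;
          g = continue_from_disc (- {0} - qspiral ((-1) ^ k) q)
                (eval_fps (qborel p (qhyp_phi as bs q)))
      in qlaplace p l g x)"

text \<open>The argument of \<open>z\<close> in the open interval of length \<open>2 * pi\<close> centred at \<open>c\<close>;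
  it exists and is unique iff \<open>z\<close> is nonzero and not on the ray of argument \<open>c + pi\<close>.\<close>

definition arg_near :: "real \<Rightarrow> complex \<Rightarrow> real" where
  "arg_near c z = (THE t. z = rcis (norm z) t \<and> \<bar>t - c\<bar> < pi)"

definition powr_near :: "real \<Rightarrow> complex \<Rightarrow> complex \<Rightarrow> complex" where
  "powr_near c z a = exp (a * (of_real (ln (norm z)) + \<i> * of_real (arg_near c z)))"

text \<open>
  The product of \<open>C\<close> and \<open>C(j)\<close> with the factor \<open>Gamma (\<alpha> ! j)\<close> cancelled, so that it makes
  sense also if \<open>\<alpha> ! j\<close> is a pole of \<open>Gamma\<close>. Other denominators are written with the entire
  function \<open>rGamma\<close>: they contribute 0 at the poles of \<open>Gamma\<close>.
\<close>

definition conn_coeff :: "complex list \<Rightarrow> complex list \<Rightarrow> nat \<Rightarrow> complex" where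
  "conn_coeff \<alpha> \<beta> j =
     (\<Prod>l<length \<beta>. Gamma (\<beta> ! l)) * (\<Prod>l\<in>{..<length \<alpha>} - {j}. rGamma (\<alpha> ! l)) *
     (\<Prod>l\<in>{..<length \<alpha>} - {j}. Gamma (\<alpha> ! l - \<alpha> ! j)) *
     (\<Prod>l<length \<beta>. rGamma (\<beta> ! l - \<alpha> ! j))"

end

theory Submission
  imports Defs
begin

text \<open>
  For fixed \<open>q\<close> the Borel transform has a connection formula expressing its continuation through
  theta quotients \<open>\<theta>(a\<^sub>j z) / \<theta>(z)\<close> times entire series in \<open>1 / z\<close>. It is obtained from Lagrange
  interpolation for products truncated at \<open>N\<close>, with nodes \<open>q\<^sup>-\<^sup>n\<close> and \<open>a\<^sub>j q\<^sup>m\<close>, by letting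
  \<open>N \<rightarrow> \<infinity>\<close>. On a spiral \<open>l p\<^sup>n\<close> the theta quotients are geometric in \<open>n\<close>, so the
  Laplace sum of each term is again a theta function: the sum is a finite combination of convergent
  series, with coefficients built from infinite products.

  As \<open>q \<rightarrow> 1\<close>, every quotient of infinite products is handled by the same device. With
  \<open>c = (1 - q\<^sup>a) / (1 - q)\<close>, the factor \<open>(1 - q\<^sup>a y) / (1 - y)\<close> is \<open>1 + c \<epsilon>\<close> where
  \<open>1 + \<epsilon> = (1 - q y) / (1 - y)\<close>; it differs from \<open>(1 + \<epsilon>)\<^sup>c\<close> by \<open>O(\<epsilon>\<^sup>2)\<close>, and the latter
  telescope. This gives the limits of the theta quotients and of the q-Gamma function.
\<close>

section \<open>Finite and infinite q-products\<close>

text \<open>Lagrange's identity is used with a kernel: besides the \<open>b l * q ^ m\<close>, its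
  numerator vanishes on the window \<open>q ^ j / (z * q ^ N)\<close>, \<open>j \<le> 2 * N\<close>,
  of the spiral through \<open>1 / z\<close>. This window produces \<open>z ^ n\<close> at the node
  \<open>1 / q ^ n\<close> and the theta quotient at the nodes \<open>a i * q ^ m\<close>; it fits
  into the degree because \<open>s < r\<close>. The series in \<open>1 / z\<close> are entire thanks
  to a Gaussian factor of base \<open>p = q ^ k\<close>. The Laplace sum completes the square and
  consumes this factor, so that the resulting series are controlled only for arguments of norm below
  1. That is enough, since at the rescaled point these arguments are of order
  \<open>(1 - q) ^ k\<close>. The coefficients have no separate limits: the quotients of infinite
  products grow like \<open>(1 - q)\<close> to the power \<open>- k * \<alpha> ! j\<close>, and the
  theta quotient in base \<open>p\<close>, taken at a point of size \<open>(1 - q) ^ k\<close>, has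
  the inverse order. Hence theta quotients are needed at arguments tending to 0, and replacing
  \<open>c\<close> by \<open>a\<close> must cost less than \<open>ln (1 - q)\<close> can
  amplify.\<close>

lemma qpoch_0 [simp]: "qpoch a q 0 = 1"
  by (simp add: qpoch_def)

lemma qpoch_Suc: "qpoch a q (Suc n) = qpoch a q n * (1 - a * q ^ n)"
  by (simp add: qpoch_def)

lemma qpoch_add: "qpoch a q (m + n) = qpoch a q m * qpoch (a * q ^ m) q n"
  by (induction n) (simp_all add: qpoch_Suc power_add mult_ac)

lemma qpoch_Suc_left: "qpoch a q (Suc n) = (1 - a) * qpoch (a * q) q n"
  using qpoch_add[of a q 1 n] by (simp add: qpoch_Suc)

lemma qpoch_shift_swap: "qpoch a q m * qpoch (a * q ^ m) q n = qpoch a q n * qpoch (a * q ^ n) q m"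
  by (metis qpoch_add add.commute)

lemma qpoch_eq_0_iff: "qpoch a q n = 0 \<longleftrightarrow> (\<exists>j<n. a * q ^ j = 1)"
  by (auto simp: qpoch_def)

lemma tri_Suc: "Suc m * Suc (Suc m) div 2 = m * Suc m div 2 + Suc m"
proof -
  have "Suc m * Suc (Suc m) = m * Suc m + 2 * Suc m" by (simp add: algebra_simps)
  then show ?thesis by simp
qed

text \<open>Factor by factor, \<open>1 - x / q ^ i = - (x / q ^ i) * (1 - q ^ i / x)\<close> for
  \<open>i = 1, ..., m\<close>; the powers of \<open>q\<close> add up to a triangular
  number.\<close>

lemma qpoch_reverse:
  assumes "q \<noteq> 0" "x \<noteq> 0"
  shows "qpoch (x / q ^ m) q m = (- x) ^ m / q ^ (m * Suc m div 2) * qpoch (q / x) q m"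
proof (induction m)
  case (Suc m)
  have e: "x / q ^ Suc m * q = x / q ^ m" using assms by (simp add: field_simps)
  have "qpoch (x / q ^ Suc m) q (Suc m) = (1 - x / q ^ Suc m) * qpoch (x / q ^ m) q m"
    unfolding qpoch_Suc_left e ..
  also have "1 - x / q ^ Suc m = (- x) / q ^ Suc m * (1 - q / x * q ^ m)"
    using assms by (simp add: field_simps)
  finally show ?case
    unfolding Suc.IH tri_Suc power_add qpoch_Suc[of "q/x"] by (simp only: power_Suc times_divide_times_eq times_divide_eq_right times_divide_eq_left divide_divide_eq_left mult_ac)
qed simp

definition qinf :: "complex \<Rightarrow> complex \<Rightarrow> complex" where
  "qinf a q = (\<Prod>j. 1 - a * q ^ j)"

lemma qpoch_convergent_prod:
  fixes a q :: complex
  assumes "norm q < 1"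
  shows "convergent_prod (\<lambda>j. 1 - a * q ^ j)"
proof (rule abs_convergent_prod_imp_convergent_prod)
  have "summable (\<lambda>j. norm a * norm q ^ j)"
    using assms by (intro summable_mult summable_geometric) auto
  then show "abs_convergent_prod (\<lambda>j. 1 - a * q ^ j)"
    by (simp add: abs_convergent_prod_conv_summable norm_mult norm_power)
qed

lemma qpoch_tendsto_qinf:
  assumes "norm q < 1"
  shows "(\<lambda>n. qpoch a q n) \<longlonglongrightarrow> qinf a q"
proof -
  have "(\<lambda>n. qpoch a q (Suc n)) \<longlonglongrightarrow> qinf a q"
    using convergent_prod_LIMSEQ[OF qpoch_convergent_prod[OF assms, of a]]
    by (simp add: qinf_def qpoch_def lessThan_Suc_atMost)
  then show ?thesis by (rule LIMSEQ_imp_Suc)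
qed

lemma qpoch_filterlim_qinf:
  assumes "norm q < 1" "filterlim f at_top F"
  shows "((\<lambda>n. qpoch a q (f n)) \<longlongrightarrow> qinf a q) F"
  using filterlim_compose[OF qpoch_tendsto_qinf[OF assms(1)] assms(2)] .

lemma qinf_split:
  assumes "norm q < 1"
  shows "qinf a q = qpoch a q n * qinf (a * q ^ n) q"
proof (rule LIMSEQ_unique)
  show "(\<lambda>m. qpoch a q (n + m)) \<longlonglongrightarrow> qinf a q"
    by (rule qpoch_filterlim_qinf[OF assms]) (simp add: filterlim_add_const_nat_at_top add.commute)
  show "(\<lambda>m. qpoch a q (n + m)) \<longlonglongrightarrow> qpoch a q n * qinf (a * q ^ n) q"
    unfolding qpoch_add by (intro tendsto_intros qpoch_tendsto_qinf assms)
qed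

lemma qinf_eq_0_iff:
  assumes "norm q < 1"
  shows "qinf a q = 0 \<longleftrightarrow> (\<exists>j. a * q ^ j = 1)"
proof
  assume "\<exists>j. a * q ^ j = 1"
  then obtain j where "a * q ^ j = 1" by blast
  then have "qpoch a q (Suc j) = 0" by (simp add: qpoch_Suc)
  then show "qinf a q = 0" using qinf_split[OF assms, of a "Suc j"] by simp
next
  assume "qinf a q = 0"
  then show "\<exists>j. a * q ^ j = 1"
    using prodinf_nonzero[OF qpoch_convergent_prod[OF assms, of a]] unfolding qinf_def by force
qed

text \<open>By \<open>1 + x \<le> exp x\<close> and a geometric series the bound does not see the
  number of factors. This uniformity is what dominated limits in \<open>N\<close> require.\<close>

lemma norm_qpoch_le:
  assumes "norm q < 1" "norm a \<le> B"
  shows "norm (qpoch a q n) \<le> exp (B / (1 - norm q))"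
proof -
  have "norm (qpoch a q n) \<le> (\<Prod>j<n. 1 + B * norm q ^ j)"
    unfolding qpoch_def prod_norm[symmetric]
  proof (rule prod_mono)
    fix j
    have "norm (1 - a * q ^ j) \<le> 1 + norm a * norm q ^ j"
      using norm_triangle_ineq4[of 1 "a * q^j"] by (simp add: norm_mult norm_power)
    also have "\<dots> \<le> 1 + B * norm q ^ j" using assms by (intro add_mono mult_right_mono) auto
    finally show "0 \<le> norm (1 - a * q ^ j) \<and> norm (1 - a * q ^ j) \<le> 1 + B * norm q ^ j" by simp
  qed
  also have "\<dots> \<le> exp (\<Sum>j<n. B * norm q ^ j)"
    using assms order_trans[OF norm_ge_zero assms(2)] by (intro prod_le_exp_sum) auto
  also have "(\<Sum>j<n. B * norm q ^ j) \<le> B / (1 - norm q)"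
  proof -
    have "(\<Sum>j<n. norm q ^ j) \<le> (\<Sum>j. norm q ^ j)"
      using assms by (intro sum_le_suminf summable_geometric) auto
    also have "\<dots> = 1 / (1 - norm q)" using assms by (intro suminf_geometric) auto
    finally have "B * (\<Sum>j<n. norm q ^ j) \<le> B * (1 / (1 - norm q))"
      using order_trans[OF norm_ge_zero assms(2)] by (intro mult_left_mono)
    then show ?thesis by (simp add: sum_distrib_left)
  qed
  finally show ?thesis by simp
qed

text \<open>No partial product vanishes and neither does the limit, so the reciprocals converge and
  are bounded.\<close>

lemma qpoch_bounded_below:
  assumes "norm q < 1" "\<And>j. a * q ^ j \<noteq> 1"
  obtains c where "c > 0" "\<And>n. norm (qpoch a q n) \<ge> c"
proof -
  have lim: "(\<lambda>n. inverse (qpoch a q n)) \<longlonglongrightarrow> inverse (qinf a q)"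
    using assms by (intro tendsto_inverse qpoch_tendsto_qinf) (auto simp: qinf_eq_0_iff)
  then have "Bseq (\<lambda>n. inverse (qpoch a q n))"
    using convergent_imp_Bseq convergentI by blast
  then obtain K where K: "K > 0" "\<And>n. norm (inverse (qpoch a q n)) \<le> K"
    by (auto simp: Bseq_def)
  have "norm (qpoch a q n) \<ge> inverse K" for n
  proof -
    have "qpoch a q n \<noteq> 0" using assms by (auto simp: qpoch_eq_0_iff)
    then have "inverse K \<le> inverse (norm (inverse (qpoch a q n)))"
      using K(2)[of n] by (intro le_imp_inverse_le) auto
    then show ?thesis by (simp add: norm_inverse)
  qed
  with K(1) show ?thesis using that[of "inverse K"] by simp
qed

text \<open>Each factor has norm at least \<open>1 - norm q ^ Suc j\<close>, so the product for
  \<open>norm q\<close> in place of both \<open>a\<close> and \<open>q\<close> is a common minorant.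
  It serves denominators like \<open>qpoch (a i * q ^ Suc N) q n\<close>, whose argument moves with
  \<open>N\<close>.\<close>

lemma qpoch_bounded_below_uniform:
  assumes "norm q < 1"
  obtains c where "c > 0" "\<And>a n. norm a \<le> norm q \<Longrightarrow> norm (qpoch a q n) \<ge> c"
proof -
  have ne: "complex_of_real (norm q) * complex_of_real (norm q) ^ j \<noteq> 1" for j
  proof -
    have "norm q ^ Suc j < 1" using assms by (simp add: power_Suc_less_one power_less_one_iff del: power_Suc)
    then show ?thesis by (metis power_Suc of_real_power of_real_eq_1_iff of_real_mult less_irrefl)
  qed
  obtain c where c: "c > 0" "\<And>n. norm (qpoch (of_real (norm q)) (of_real (norm q)) n) \<ge> c"
    using qpoch_bounded_below[of "of_real (norm q)" "of_real (norm q)"] assms ne by auto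
  have "norm (qpoch a q n) \<ge> c" if "norm a \<le> norm q" for a n
  proof -
    have "norm (qpoch (of_real (norm q)) (of_real (norm q)) n) \<le> norm (qpoch a q n)"
      unfolding qpoch_def prod_norm[symmetric]
    proof (rule prod_mono)
      fix j
      have "norm (1 - complex_of_real (norm q) * of_real (norm q) ^ j) = \<bar>1 - norm q ^ Suc j\<bar>"
        by (metis norm_of_real of_real_1 of_real_diff of_real_mult of_real_power power_Suc)
      also have "\<dots> = 1 - norm q ^ Suc j" using assms power_le_one[of "norm q" "Suc j"] by auto
      also have "\<dots> \<le> 1 - norm a * norm q ^ j" using that by (simp add: mult_right_mono)
      also have "\<dots> \<le> norm (1 - a * q ^ j)"
        using norm_triangle_ineq2[of 1 "a * q ^ j"] by (simp add: norm_mult norm_power)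
      finally show "0 \<le> norm (1 - complex_of_real (norm q) * of_real (norm q) ^ j) \<and> norm (1 - complex_of_real (norm q) * of_real (norm q) ^ j) \<le> norm (1 - a * q ^ j)" by simp
    qed
    with c(2)[of n] show ?thesis by linarith
  qed
  with c(1) show ?thesis using that by blast
qed

text \<open>The partial products converge uniformly on discs. Holomorphy in \<open>a\<close> is what
  allows the connection formula to act as the analytic continuation of the Borel transform.\<close>

lemma qinf_holomorphic:
  assumes "norm q < 1"
  shows "(\<lambda>a. qinf a q) holomorphic_on A"
proof -
  have ul: "uniform_limit (cball 0 R) (\<lambda>n a. qpoch a q n) (\<lambda>a. qinf a q) sequentially" for R
  proof -
    have "uniformly_convergent_on (cball 0 R) (\<lambda>N a. \<Prod>n<N. 1 - a * q ^ n)"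
    proof (rule uniformly_convergent_on_prod')
      show "uniformly_convergent_on (cball 0 R) (\<lambda>N a. \<Sum>n<N. norm (1 - a * q ^ n - 1))"
      proof (rule Weierstrass_m_test')
        show "summable (\<lambda>n. R * norm q ^ n)"
          using assms by (intro summable_mult summable_geometric) auto
      qed (auto simp: norm_mult norm_power intro!: mult_right_mono)
    qed (auto intro!: continuous_intros)
    then obtain g where g: "uniform_limit (cball 0 R) (\<lambda>n a. qpoch a q n) g sequentially"
      unfolding uniformly_convergent_on_def qpoch_def by blast
    have "g a = qinf a q" if "a \<in> cball 0 R" for a
      using tendsto_uniform_limitI[OF g that] qpoch_tendsto_qinf[OF assms] LIMSEQ_unique by blast
    then show ?thesis using g uniform_limit_cong'[of "cball 0 R" _ _ g] by (metis (no_types, lifting))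
  qed
  have "(\<lambda>a. qinf a q) holomorphic_on UNIV"
  proof (rule holomorphic_uniform_sequence[OF open_UNIV])
    show "(\<lambda>a. qpoch a q n) holomorphic_on UNIV" for n
      unfolding qpoch_def by (intro holomorphic_intros)
    fix x :: complex
    have "uniform_limit (cball x 1) (\<lambda>n a. qpoch a q n) (\<lambda>a. qinf a q) sequentially"
      by (rule uniform_limit_on_subset[OF ul[of "norm x + 1"]])
         (auto simp: dist_norm, metis add.commute diff_add_cancel norm_minus_commute norm_triangle_le add_le_cancel_left)
    then show "\<exists>d>0. cball x d \<subseteq> UNIV \<and> uniform_limit (cball x d) (\<lambda>n a. qpoch a q n) (\<lambda>a. qinf a q) sequentially"
      by (intro exI[of _ 1]) auto
  qed
  then show ?thesis by (rule holomorphic_on_subset) auto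
qed

lemma qinf_holomorphic' [holomorphic_intros]:
  assumes "norm q < 1" "f holomorphic_on A"
  shows "(\<lambda>x. qinf (f x) q) holomorphic_on A"
  using holomorphic_on_compose[OF assms(2) qinf_holomorphic[OF assms(1)]] by (simp add: o_def)

text \<open>The multiplicative theta function without its constant factor \<open>qinf q q\<close>,
  which would cancel in every quotient formed below.\<close>

definition jprod :: "complex \<Rightarrow> complex \<Rightarrow> complex" where
  "jprod q y = qinf y q * qinf (q / y) q"

text \<open>Passing from \<open>y\<close> to \<open>q * y\<close> drops the factor
  \<open>1 - y\<close> from the first product and adds \<open>1 - 1 / y\<close> to the second; their
  ratio is \<open>- 1 / y\<close>.\<close>

lemma jprod_mult:
  assumes "norm q < 1" "q \<noteq> 0" "y \<noteq> 0"
  shows "jprod q (q * y) = - jprod q y / y"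
proof -
  have a: "qinf y q = (1 - y) * qinf (q * y) q"
    using qinf_split[OF assms(1), of y 1] by (simp add: qpoch_Suc mult.commute)
  have b: "qinf (1 / y) q = (1 - 1 / y) * qinf (q / y) q"
    using qinf_split[OF assms(1), of "1/y" 1] by (simp add: qpoch_Suc)
  have "jprod q (q * y) = qinf (q * y) q * ((1 - 1 / y) * qinf (q / y) q)"
    unfolding jprod_def b[symmetric] using assms by simp
  then show ?thesis unfolding jprod_def a using assms by (simp add: field_simps)
qed

text \<open>The two products of \<open>jprod\<close> trade places under
  \<open>y \<rightarrow> q / y\<close>, so the value at \<open>1 / y\<close> is the value at
  \<open>q * y\<close>.\<close>

lemma jprod_inverse:
  assumes "norm q < 1" "q \<noteq> 0" "y \<noteq> 0"
  shows "jprod q (1 / y) = - jprod q y / y"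
  using jprod_mult[OF assms] assms unfolding jprod_def by (simp add: mult.commute)

lemma jprod_eq_0_iff:
  assumes "norm q < 1" "q \<noteq> 0" "y \<noteq> 0"
  shows "jprod q y = 0 \<longleftrightarrow> (\<exists>n::int. y = q powi n)"
proof
  assume "jprod q y = 0"
  then consider j where "y * q ^ j = 1" | j where "q / y * q ^ j = 1"
    unfolding jprod_def using qinf_eq_0_iff[OF assms(1)] by auto
  then show "\<exists>n::int. y = q powi n"
  proof cases
    case 1
    then have "y = q powi (- int j)" using assms by (simp add: power_int_minus field_simps)
    then show ?thesis by blast
  next
    case 2
    then have "y = q powi (int (Suc j))" using assms by (simp add: field_simps del: of_nat_Suc)
    then show ?thesis by blast
  qed
next
  assume "\<exists>n::int. y = q powi n"
  then obtain n :: int where n: "y = q powi n" by blast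
  show "jprod q y = 0"
  proof (cases "n \<le> 0")
    case True
    then have "y * q ^ nat (- n) = 1"
      using assms n by (simp add: power_int_def field_simps)
    then show ?thesis unfolding jprod_def using qinf_eq_0_iff[OF assms(1)] by auto
  next
    case False
    then have "nat n = Suc (nat (n - 1))" by auto
    then have "q / y * q ^ nat (n - 1) = 1"
      using assms n False by (simp add: power_int_def)
    then show ?thesis unfolding jprod_def using qinf_eq_0_iff[OF assms(1)] by auto
  qed
qed

lemma qpow_neq_1:
  fixes q :: complex
  assumes "q \<noteq> 0" "norm q < 1"
  shows "q * q ^ j \<noteq> 1"
proof
  assume "q * q ^ j = 1"
  then have "norm q ^ Suc j = 1" by (metis norm_one norm_power power_Suc)
  moreover have "norm q ^ Suc j < 1" using assms by (intro power_Suc_less_one) auto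
  ultimately show False by simp
qed

text \<open>These are the factors of \<open>jprod q (1 / z)\<close>, the form in which the theta
  function appears as a denominator of the truncated identity.\<close>

lemma not_qpow_shift:
  fixes q z :: complex
  assumes "q \<noteq> 0" "z \<noteq> 0" "\<And>n. z \<noteq> q powi n"
  shows "q * z * q ^ j \<noteq> 1" "1 / z * q ^ j \<noteq> 1"
proof -
  show "q * z * q ^ j \<noteq> 1"
  proof
    assume "q * z * q ^ j = 1"
    then have "q ^ Suc j * z = 1" by (simp add: mult_ac)
    then have "z = inverse (q ^ Suc j)" by (metis inverse_unique)
    then have "z = q powi (- int (Suc j))" by (simp only: power_int_minus power_int_of_nat)
    with assms show False by blast
  qed
  show "1 / z * q ^ j \<noteq> 1"
  proof
    assume "1 / z * q ^ j = 1"
    then have "z = q powi (int j)" using assms by (simp add: divide_simps)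
    with assms show False by blast
  qed
qed

text \<open>The polynomial \<open>\<Prod>j\<in>J. 1 - y j * t\<close> has degree below
  \<open>card I\<close>, so it equals its interpolant at the nodes \<open>t = 1 / x i\<close>; the
  identity is this equality at \<open>t = 0\<close>.\<close>

lemma lagrange_identity:
  fixes x :: "'i \<Rightarrow> 'a :: field" and y :: "'j \<Rightarrow> 'a"
  assumes "finite I" "inj_on x I" "\<And>i. i \<in> I \<Longrightarrow> x i \<noteq> 0" "card J < card I"
  shows "(\<Sum>i\<in>I. (\<Prod>j\<in>J. 1 - y j / x i) / (\<Prod>j\<in>I - {i}. 1 - x j / x i)) = 1"
proof -
  define P where "P = (\<Prod>j\<in>J. [:1, - y j:])"
  define c where "c i = (\<Prod>j\<in>J. 1 - y j / x i) / (\<Prod>j\<in>I - {i}. 1 - x j / x i)" for i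
  define L where "L = (\<Sum>i\<in>I. smult (c i) (\<Prod>j\<in>I - {i}. [:1, - x j:]))"
  have degprod: "degree (\<Prod>j\<in>A. [:1, - f j:]) \<le> card A" for A and f :: "'k \<Rightarrow> 'a"
  proof (induction A rule: infinite_finite_induct)
    case (insert a A)
    have "degree ([:1, - f a:] * (\<Prod>j\<in>A. [:1, - f j:])) \<le> 1 + card A"
      by (rule order_trans[OF degree_mult_le]) (use insert in \<open>auto intro: add_mono order_trans[OF degree_pCons_le]\<close>)
    with insert show ?case by simp
  qed auto
  have I0: "card I > 0" using assms by auto
  have "P = L"
  proof (rule poly_eqI_degree)
    show "card ((\<lambda>i. 1 / x i) ` I) > degree P"
    proof -
      have "inj_on (\<lambda>i. 1 / x i) I" using assms(2) by (auto simp: inj_on_def)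
      then show ?thesis using degprod[of y J] assms(4) by (simp add: card_image P_def)
    qed
    show "card ((\<lambda>i. 1 / x i) ` I) > degree L"
    proof -
      have "inj_on (\<lambda>i. 1 / x i) I" using assms(2) by (auto simp: inj_on_def)
      moreover have "degree L \<le> card I - 1"
        unfolding L_def
      proof (rule degree_sum_le[OF assms(1)])
        fix i assume "i \<in> I"
        then show "degree (smult (c i) (\<Prod>j\<in>I - {i}. [:1, - x j:])) \<le> card I - 1"
          using degprod[of x "I - {i}"] by (auto intro: order_trans[OF degree_smult_le])
      qed
      ultimately show ?thesis using I0 by (simp add: card_image)
    qed
    fix t assume "t \<in> (\<lambda>i. 1 / x i) ` I"
    then obtain i where i: "i \<in> I" "t = 1 / x i" by blast
    have nz: "(\<Prod>j\<in>I - {i}. 1 - x j / x i) \<noteq> 0"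
      using assms i by (auto simp: inj_on_def)
    have "poly L t = (\<Sum>k\<in>I. c k * (\<Prod>j\<in>I - {k}. 1 - x j / x i))"
      unfolding L_def by (simp add: poly_sum poly_prod i)
    also have "\<dots> = (\<Sum>k\<in>{i}. c k * (\<Prod>j\<in>I - {k}. 1 - x j / x i))"
    proof (rule sum.mono_neutral_right)
      show "\<forall>k\<in>I - {i}. c k * (\<Prod>j\<in>I - {k}. 1 - x j / x i) = 0"
      proof
        fix k assume "k \<in> I - {i}"
        then have "i \<in> I - {k}" using i by auto
        moreover have "1 - x i / x i = 0" using assms(3) i by simp
        ultimately have "(\<Prod>j\<in>I - {k}. 1 - x j / x i) = 0"
          using assms(1) by (intro prod_zero) auto
        then show "c k * (\<Prod>j\<in>I - {k}. 1 - x j / x i) = 0" by simp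
      qed
    qed (use assms i in auto)
    also have "\<dots> = (\<Prod>j\<in>J. 1 - y j / x i)" using nz by (simp add: c_def)
    also have "\<dots> = poly P t" by (simp add: P_def poly_prod i)
    finally show "poly P t = poly L t" ..
  qed
  then have "poly L 0 = poly P 0" by simp
  then show ?thesis
    by (simp add: L_def P_def poly_sum poly_prod c_def)
qed

section \<open>A finite connection identity\<close>

text \<open>The quotient of two nodes is \<open>q ^ (n - n')\<close>: smaller \<open>n'\<close> give
  positive exponents up to \<open>n\<close>, larger ones give negative exponents down to
  \<open>n - N\<close>. For the nodes \<open>a * q ^ m\<close> below, the two ranges change
  roles.\<close>

lemma prod_minus_node_inverse:
  fixes q :: complex
  assumes "q \<noteq> 0" "n \<le> N"
  shows "(\<Prod>n'\<in>{..<Suc N} - {n}. 1 - (1 / q ^ n') / (1 / q ^ n)) =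
           qpoch q q n * qpoch (1 / q ^ (N - n)) q (N - n)"
proof -
  have U: "{..<Suc N} - {n} = {..<n} \<union> {n<..N}" using assms by auto
  have "(\<Prod>n'\<in>{..<Suc N} - {n}. 1 - (1 / q ^ n') / (1 / q ^ n)) =
      (\<Prod>n'<n. 1 - (1 / q ^ n') / (1 / q ^ n)) * (\<Prod>n'\<in>{n<..N}. 1 - (1 / q ^ n') / (1 / q ^ n))"
    unfolding U by (rule prod.union_disjoint) auto
  also have "(\<Prod>n'<n. 1 - (1 / q ^ n') / (1 / q ^ n)) = (\<Prod>j<n. 1 - q * q ^ j)"
  proof (rule prod.reindex_bij_witness[of _ "\<lambda>j. n - Suc j" "\<lambda>j. n - Suc j"], goal_cases)
    case (5 j)
    then have "n = Suc (n - Suc j) + j" by simp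
    then have "q ^ n = q * q ^ (n - Suc j) * q ^ j" by (metis power_add power_Suc)
    then show ?case using assms by simp
  qed auto
  also have "(\<Prod>n'\<in>{n<..N}. 1 - (1 / q ^ n') / (1 / q ^ n)) = (\<Prod>j<N - n. 1 - 1 / q ^ (N - n) * q ^ j)"
  proof (rule prod.reindex_bij_witness[of _ "\<lambda>j. N - j" "\<lambda>j. N - j"], goal_cases)
    case (5 j)
    then have "N - n = (j - n) + (N - j)" "j = (j - n) + n" by auto
    then have "q ^ (N - n) = q ^ (j - n) * q ^ (N - j)" "q ^ j = q ^ (j - n) * q ^ n" by (metis power_add)+
    then show ?case using assms by simp
  qed auto
  finally show ?thesis by (simp add: qpoch_def)
qed

lemma prod_minus_node:
  fixes q :: complex
  assumes "q \<noteq> 0" "m \<le> N" "a \<noteq> 0"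
  shows "(\<Prod>m'\<in>{..<Suc N} - {m}. 1 - (a * q ^ m') / (a * q ^ m)) =
           qpoch (1 / q ^ m) q m * qpoch q q (N - m)"
proof -
  have U: "{..<Suc N} - {m} = {..<m} \<union> {m<..N}" using assms by auto
  have "(\<Prod>m'\<in>{..<Suc N} - {m}. 1 - (a * q ^ m') / (a * q ^ m)) =
      (\<Prod>m'<m. 1 - (a * q ^ m') / (a * q ^ m)) * (\<Prod>m'\<in>{m<..N}. 1 - (a * q ^ m') / (a * q ^ m))"
    unfolding U by (rule prod.union_disjoint) auto
  also have "(\<Prod>m'<m. 1 - (a * q ^ m') / (a * q ^ m)) = (\<Prod>j<m. 1 - 1 / q ^ m * q ^ j)"
    using assms by (intro prod.cong) auto
  also have "(\<Prod>m'\<in>{m<..N}. 1 - (a * q ^ m') / (a * q ^ m)) = (\<Prod>j<N - m. 1 - q * q ^ j)"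
  proof (rule prod.reindex_bij_witness[of _ "\<lambda>j. m + Suc j" "\<lambda>j. j - Suc m"], goal_cases)
    case (5 j)
    then have "j = m + Suc (j - Suc m)" by auto
    then have "q ^ j = q ^ m * (q * q ^ (j - Suc m))" by (metis power_add power_Suc)
    then show ?case using assms by simp
  qed auto
  finally show ?thesis by (simp add: qpoch_def)
qed

lemma qpoch_reverse_split:
  assumes "q \<noteq> 0" "x \<noteq> 0"
  shows "qpoch (x / q ^ m) q (m + e) = (- x) ^ m / q ^ (m * Suc m div 2) * qpoch (q / x) q m * qpoch x q e"
  using assms by (simp add: qpoch_add qpoch_reverse)

text \<open>Reversing the first \<open>N\<close> factors releases the power
  \<open>q ^ (N * Suc N div 2)\<close> in the denominator, which diverges relative to the rest. The
  case \<open>w = 1\<close> releases the same power, and comparing the two leaves only products that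
  converge, namely to the two factors of \<open>jprod q (1 / w)\<close>.\<close>

lemma qpoch_kernel_ratio:
  assumes "q \<noteq> 0" "w \<noteq> 0"
  shows "qpoch (1 / (w * q ^ N)) q (N + e) * w ^ N * qpoch q q N =
           qpoch (1 / q ^ N) q N * (qpoch (q * w) q N * qpoch (1 / w) q e)"
proof -
  have "qpoch (1 / (w * q ^ N)) q (N + e) = (- (1 / w)) ^ N / q ^ (N * Suc N div 2) * qpoch (q * w) q N * qpoch (1 / w) q e"
    using qpoch_reverse_split[of q "1/w" N e] assms by simp
  moreover have "qpoch (1 / q ^ N) q N = (- 1) ^ N / q ^ (N * Suc N div 2) * qpoch q q N"
    using qpoch_reverse[of q 1 N] assms by simp
  moreover have "(- (1 / w)) ^ N * w ^ N = (- 1) ^ N"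
    using assms by (simp add: power_mult_distrib[symmetric])
  ultimately show ?thesis by (simp add: mult_ac)
qed

text \<open>The terms of Lagrange's identity for the nodes \<open>1 / q ^ n\<close> and \<open>a i * q ^ m\<close>
  (\<open>n, m \<le> N\<close>), all multiplied by the same factor, chosen so that \<open>conn_lhs\<close> tends to the
  \<open>n\<close>-th term of the Borel transform as \<open>N \<rightarrow> \<infinity>\<close>. The terms \<open>conn_rhs\<close> have
  changed sides, and \<open>conn_rem\<close> is what becomes of the constant 1.\<close>

definition conn_lhs where
  "conn_lhs r s a b q z N n =
     (\<Prod>i<r. qpoch (a i) q n / qpoch (a i * q ^ Suc N) q n) *
     (\<Prod>l<s. qpoch (b l * q ^ Suc N) q n / qpoch (b l) q n) *
     (z ^ n / qpoch q q n * (qpoch q q N / qpoch q q (N - n)) *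
      (qpoch (q * z) q (N - n) / qpoch (q * z) q N) *
      (qpoch (1 / z) q (Suc N + n) / qpoch (1 / z) q (Suc N)))"
  for r s :: nat and a b :: "nat \<Rightarrow> complex"

definition conn_rhs where
  "conn_rhs r s a b q z N i m =
     (\<Prod>l<s. qpoch (b l / (a i * q ^ m)) q (Suc N) / qpoch (b l) q (Suc N)) *
     (\<Prod>i'\<in>{..<r} - {i}. qpoch (a i') q (Suc N) / qpoch (a i' / (a i * q ^ m)) q (Suc N)) *
     (a i * q ^ m * (qpoch (a i) q m / qpoch (a i * q ^ Suc N) q m) *
      (qpoch q q N / (qpoch (1 / q ^ m) q m * qpoch q q (N - m))) *
      (qpoch (q * (a i * q ^ m * z)) q N * qpoch (1 / (a i * q ^ m * z)) q (Suc N) /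
       (qpoch (q * z) q N * qpoch (1 / z) q (Suc N))))"
  for r s :: nat and a b :: "nat \<Rightarrow> complex"

definition conn_rem where
  "conn_rem r s a b q z N =
     (\<Prod>i<r. qpoch (a i) q (Suc N)) / (\<Prod>l<s. qpoch (b l) q (Suc N)) *
     (z ^ N * qpoch q q N / (qpoch (q * z) q N * qpoch (1 / z) q (Suc N)))"
  for r s :: nat and a b :: "nat \<Rightarrow> complex"

text \<open>Lagrange's identity with tagged indices: \<open>Inl n\<close> for the node
  \<open>1 / q ^ n\<close>, \<open>Inr (i, m)\<close> for \<open>a i * q ^ m\<close>. The hypothesis
  \<open>a1\<close> keeps these two families of nodes apart; \<open>aa\<close> separates the nodes
  of different \<open>a i\<close>.\<close>

lemma finite_connection_generic:
  fixes a b :: "nat \<Rightarrow> complex"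
  assumes q: "q \<noteq> 0" "norm q < 1"
    and a0: "\<And>i. i < r \<Longrightarrow> a i \<noteq> 0"
    and aa: "\<And>i j n. i < r \<Longrightarrow> j < r \<Longrightarrow> i \<noteq> j \<Longrightarrow> a i / a j \<noteq> q powi n"
    and b1: "\<And>l j. l < s \<Longrightarrow> b l * q ^ j \<noteq> 1"
    and z: "z \<noteq> 0" "\<And>n. z \<noteq> q powi n"
    and rs: "s < r"
    and a1: "\<And>i j. i < r \<Longrightarrow> a i * q ^ j \<noteq> 1"
  shows "(\<Sum>n<Suc N. conn_lhs r s a b q z N n) =
           conn_rem r s a b q z N + (\<Sum>i<r. \<Sum>m<Suc N. conn_rhs r s a b q z N i m)"
proof -
  define M where "M = Suc N"
  define I where "I = {..<M} <+> ({..<r} \<times> {..<M})"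
  define J where "J = ({..<s} \<times> {..<M}) <+> {..<N + M}"
  define x where "x = case_sum (\<lambda>n. 1 / q ^ n) (\<lambda>(i, m). a i * q ^ m)"
  define y where "y = case_sum (\<lambda>(l, m). b l * q ^ m) (\<lambda>j. q ^ j / (z * q ^ N))"
  \<comment> \<open>\<open>W\<close> is the reciprocal of the Lagrange term at the node
    \<open>1 / q ^ 0\<close>, so that the normalised term for \<open>n = 0\<close> is exactly
    1.\<close>
  define W where "W = (\<Prod>i<r. qpoch (a i) q M) / (\<Prod>l<s. qpoch (b l) q M) *
     (qpoch (1 / q ^ N) q N / qpoch (1 / (z * q ^ N)) q (N + M))"
  have qpow_inj: "m = n" if "q ^ m = q ^ n" for m n
  proof -
    have "norm q ^ m = norm q ^ n" using that by (metis norm_power)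
    then show ?thesis using q by (metis power_inject_exp' less_irrefl zero_less_norm_iff)
  qed
  note q1 = qpow_neq_1[OF q]
  have qn1: "1 / q ^ m * q ^ j \<noteq> 1" if "j < m" for j m
    using qpow_inj[of m j] that q by (auto simp: field_simps)
  note zq = not_qpow_shift(1)[OF q(1) z(1) z(2)] and zq' = not_qpow_shift(2)[OF q(1) z(1) z(2)]
  have aaq: "a i' / a i * (1 / q ^ m) * q ^ j \<noteq> 1" if "i < r" "i' < r" "i \<noteq> i'" for i i' m j
  proof
    assume *: "a i' / a i * (1 / q ^ m) * q ^ j = 1"
    have "a i' / a i = q powi (int m - int j)"
    proof -
      have "q powi (int m - int j) = q ^ m / q ^ j" using q by (simp add: power_int_diff)
      moreover have "a i' * q ^ j = a i * q ^ m" using * q a0[of i] that by (simp add: divide_simps)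
      then have "a i' / a i = q ^ m / q ^ j" using q a0[of i] that by (simp add: divide_simps mult_ac)
      ultimately show ?thesis by (simp only:)
    qed
    with aa[of i' i] that show False by blast
  qed
  have finI: "finite I" "finite J" by (auto simp: I_def J_def)
  have x0: "x i \<noteq> 0" if "i \<in> I" for i
    using that q a0 by (auto simp: I_def x_def)
  have inj: "inj_on x I"
  proof (rule inj_onI)
    have *: False if "i < r" "a i * q ^ m = 1 / q ^ n" for i m n
      using a1[OF that(1), of "m + n"] that(2) q by (simp add: power_add field_simps)
    have **: "i = i' \<and> m = m'" if "i < r" "i' < r" "a i * q ^ m = a i' * q ^ m'" for i i' m m'
    proof -
      have "i = i'" using aaq[of i' i m' m] that a0[of i'] q by (auto simp: field_simps)
      then show ?thesis using that a0 qpow_inj by auto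
    qed
    fix u v assume "u \<in> I" "v \<in> I" "x u = x v"
    then show "u = v"
    proof (cases u; cases v)
      fix n n' assume "u = Inl n" "v = Inl n'"
      with \<open>x u = x v\<close> show ?thesis using qpow_inj q by (simp add: x_def)
    next
      fix n im assume uv: "u = Inl n" "v = Inr im"
      obtain i m where "im = (i, m)" by force
      with uv \<open>x u = x v\<close> \<open>v \<in> I\<close> show ?thesis using *[of i m n] by (auto simp: x_def I_def)
    next
      fix n im assume uv: "u = Inr im" "v = Inl n"
      obtain i m where "im = (i, m)" by force
      with uv \<open>x u = x v\<close> \<open>u \<in> I\<close> show ?thesis using *[of i m n] by (auto simp: x_def I_def)
    next
      fix im im' assume uv: "u = Inr im" "v = Inr im'"
      obtain i m where 1: "im = (i, m)" by force
      obtain i' m' where 2: "im' = (i', m')" by force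
      from 1 2 uv \<open>x u = x v\<close> \<open>u \<in> I\<close> \<open>v \<in> I\<close> show ?thesis using **[of i i' m m'] by (auto simp: x_def I_def)
    qed
  qed
  \<comment> \<open>In units of \<open>M = Suc N\<close>: \<open>s * M\<close> zeros from the
    \<open>b l\<close> and \<open>N + M\<close> from the kernel stand against
    \<open>M + r * M\<close> nodes. Since \<open>s + 1 \<le> r\<close>, strictness comes from
    \<open>N < M\<close>.\<close>
  have card: "card J < card I"
  proof -
    have "card I = M + r * M" "card J = s * M + (N + M)"
      by (simp_all add: I_def J_def card_Plus)
    moreover have "s * M + M \<le> r * M" using rs by (metis Suc_leI add.commute mult_Suc mult_le_mono1)
    ultimately show ?thesis by (simp add: M_def)
  qed
  have prodJ: "(\<Prod>j\<in>J. 1 - y j / t) = (\<Prod>l<s. qpoch (b l / t) q M) * qpoch (1 / (z * q ^ N * t)) q (N + M)" for t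
    unfolding J_def by (simp add: prod.Plus prod.cartesian_product' y_def qpoch_def mult_ac)
  have lag: "W = (\<Sum>i\<in>I. W * ((\<Prod>j\<in>J. 1 - y j / x i) / (\<Prod>j\<in>I - {i}. 1 - x j / x i)))"
    using lagrange_identity[OF finI(1) inj x0 card, of y] by (simp only: sum_distrib_left[symmetric] mult_1_right)
  have nz: "qpoch (1 / q ^ N) q N \<noteq> 0" "qpoch q q n \<noteq> 0" "qpoch (q * z) q n \<noteq> 0" "qpoch (1 / z) q n \<noteq> 0"
     "qpoch (1 / q ^ n) q n \<noteq> 0" for n
    using qn1 q1 zq zq' by (auto simp: qpoch_eq_0_iff)
  have kern: "qpoch (1 / (z * q ^ n)) q (n + e) = qpoch (1 / q ^ n) q n * (qpoch (q * z) q n * qpoch (1 / z) q e) / (z ^ n * qpoch q q n)" for n e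
    using qpoch_kernel_ratio[OF q(1) z(1), of n e] nz(2-5)[of n] z by (simp add: field_simps)
  have W_eq: "W = conn_rem r s a b q z N"
    unfolding W_def kern conn_rem_def M_def using nz by (simp add: field_simps)
  have termA: "W * ((\<Prod>j\<in>J. 1 - y j / x (Inl n)) / (\<Prod>j\<in>I - {Inl n}. 1 - x j / x (Inl n))) = conn_lhs r s a b q z N n"
    if n: "n < M" for n
  proof -
    have nN: "n \<le> N" using n by (simp add: M_def)
    have "I - {Inl n} = ({..<M} - {n}) <+> ({..<r} \<times> {..<M})" by (auto simp: I_def)
    then have "(\<Prod>j\<in>I - {Inl n}. 1 - x j / x (Inl n)) =
        (\<Prod>n'\<in>{..<M} - {n}. 1 - (1 / q ^ n') / (1 / q ^ n)) * (\<Prod>i<r. \<Prod>m<M. 1 - a i * q ^ n * q ^ m)"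
      by (simp add: prod.Plus prod.cartesian_product' x_def mult_ac)
    also have "\<dots> = qpoch q q n * qpoch (1 / q ^ (N - n)) q (N - n) * (\<Prod>i<r. qpoch (a i * q ^ n) q M)"
      unfolding M_def using prod_minus_node_inverse[OF q(1) nN] by (simp add: qpoch_def)
    finally have den: "(\<Prod>j\<in>I - {Inl n}. 1 - x j / x (Inl n)) = \<dots>" .
    have "z * q ^ N * (1 / q ^ n) = z * q ^ (N - n)" using q nN by (simp add: power_diff)
    moreover have "N + M = (N - n) + (M + n)" using nN by simp
    ultimately have num: "(\<Prod>j\<in>J. 1 - y j / x (Inl n)) = (\<Prod>l<s. qpoch (b l * q ^ n) q M) * qpoch (1 / (z * q ^ (N - n))) q ((N - n) + (M + n))"
      unfolding prodJ by (simp add: x_def)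
    have A: "(\<Prod>i<r. qpoch (a i) q M) / (\<Prod>i<r. qpoch (a i * q ^ n) q M) = (\<Prod>i<r. qpoch (a i) q n / qpoch (a i * q ^ Suc N) q n)"
      unfolding prod_dividef[symmetric]
    proof (rule prod.cong)
      fix i assume "i \<in> {..<r}"
      then have "a i * q ^ Suc N * q ^ j \<noteq> 1" "a i * q ^ n * q ^ j \<noteq> 1" for j
        using a1[of i "Suc N + j"] a1[of i "n + j"] by (auto simp: power_add mult_ac)
      then have "qpoch (a i * q ^ Suc N) q n \<noteq> 0" "qpoch (a i * q ^ n) q M \<noteq> 0"
        by (auto simp: qpoch_eq_0_iff)
      then show "qpoch (a i) q M / qpoch (a i * q ^ n) q M = qpoch (a i) q n / qpoch (a i * q ^ Suc N) q n"
        using qpoch_shift_swap[of "a i" q M n] by (simp add: M_def divide_simps)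
    qed simp
    have B: "(\<Prod>l<s. qpoch (b l * q ^ n) q M) / (\<Prod>l<s. qpoch (b l) q M) = (\<Prod>l<s. qpoch (b l * q ^ Suc N) q n / qpoch (b l) q n)"
      unfolding prod_dividef[symmetric]
    proof (rule prod.cong)
      fix l assume "l \<in> {..<s}"
      then have "qpoch (b l) q n \<noteq> 0" "qpoch (b l) q M \<noteq> 0"
        using b1 by (auto simp: qpoch_eq_0_iff)
      then show "qpoch (b l * q ^ n) q M / qpoch (b l) q M = qpoch (b l * q ^ Suc N) q n / qpoch (b l) q n"
        using qpoch_shift_swap[of "b l" q M n] by (simp add: M_def divide_simps mult_ac)
    qed simp
    have "z ^ N = z ^ n * z ^ (N - n)" using nN by (metis le_add_diff_inverse power_add)
    then have K: "qpoch (1 / q ^ N) q N / qpoch (1 / (z * q ^ N)) q (N + M) *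
        (qpoch (1 / (z * q ^ (N - n))) q ((N - n) + (M + n)) / (qpoch q q n * qpoch (1 / q ^ (N - n)) q (N - n))) =
        z ^ n / qpoch q q n * (qpoch q q N / qpoch q q (N - n)) *
      (qpoch (q * z) q (N - n) / qpoch (q * z) q N) *
      (qpoch (1 / z) q (M + n) / qpoch (1 / z) q M)"
      unfolding kern using nz z by (simp add: field_simps)
    show ?thesis
      unfolding conn_lhs_def A[symmetric] B[symmetric] K[symmetric, unfolded M_def] num den
      by (simp add: W_def M_def mult_ac)
  qed
  have termB: "W * ((\<Prod>j\<in>J. 1 - y j / x (Inr (i, m))) / (\<Prod>j\<in>I - {Inr (i, m)}. 1 - x j / x (Inr (i, m)))) = - conn_rhs r s a b q z N i m"
    if im: "i < r" "m < M" for i m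
  proof -
    have mN: "m \<le> N" using im by (simp add: M_def)
    define w where "w = a i * q ^ m"
    have w0: "w \<noteq> 0" using a0 q im by (simp add: w_def)
    have w1: "w * q ^ j \<noteq> 1" for j using a1[OF im(1), of "m + j"] by (simp add: w_def power_add mult_ac)
    have "I - {Inr (i, m)} = {..<M} <+> (({..<r} - {i}) \<times> {..<M} \<union> {i} \<times> ({..<M} - {m}))"
      using im by (auto simp: I_def)
    then have "(\<Prod>j\<in>I - {Inr (i, m)}. 1 - x j / x (Inr (i, m))) =
        (\<Prod>n<M. 1 - (1 / q ^ n) / w) * (\<Prod>j\<in>({..<r} - {i}) \<times> {..<M} \<union> {i} \<times> ({..<M} - {m}). 1 - x (Inr j) / w)"
      by (simp add: prod.Plus x_def w_def)
    also have "(\<Prod>j\<in>({..<r} - {i}) \<times> {..<M} \<union> {i} \<times> ({..<M} - {m}). 1 - x (Inr j) / w) =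
        (\<Prod>j\<in>({..<r} - {i}) \<times> {..<M}. 1 - x (Inr j) / w) * (\<Prod>j\<in>{i} \<times> ({..<M} - {m}). 1 - x (Inr j) / w)"
      by (rule prod.union_disjoint) auto
    also have "(\<Prod>j\<in>({..<r} - {i}) \<times> {..<M}. 1 - x (Inr j) / w) = (\<Prod>i'\<in>{..<r} - {i}. qpoch (a i' / w) q M)"
      by (simp add: prod.cartesian_product' x_def qpoch_def)
    also have "(\<Prod>j\<in>{i} \<times> ({..<M} - {m}). 1 - x (Inr j) / w) = (\<Prod>m'\<in>{..<Suc N} - {m}. 1 - (a i * q ^ m') / (a i * q ^ m))"
      by (simp add: prod.cartesian_product' x_def w_def M_def)
    also have "\<dots> = qpoch (1 / q ^ m) q m * qpoch q q (N - m)"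
      by (rule prod_minus_node) (use q mN a0 im in auto)
    also have "(\<Prod>n<M. 1 - (1 / q ^ n) / w) = qpoch (1 / (w * q ^ N)) q (N + 1)"
      unfolding qpoch_def
    proof (rule prod.reindex_bij_witness[of _ "\<lambda>j. N - j" "\<lambda>j. N - j"], goal_cases)
      case (5 j)
      then have "N = j + (N - j)" by (auto simp: M_def)
      then have "q ^ N = q ^ j * q ^ (N - j)" by (metis power_add)
      then show ?case using q w0 by (simp add: mult_ac)
    qed (auto simp: M_def)
    finally have den: "(\<Prod>j\<in>I - {Inr (i, m)}. 1 - x j / x (Inr (i, m))) =
       qpoch (1 / (w * q ^ N)) q (N + 1) * ((\<Prod>i'\<in>{..<r} - {i}. qpoch (a i' / w) q M) * (qpoch (1 / q ^ m) q m * qpoch q q (N - m)))" .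
    have num: "(\<Prod>j\<in>J. 1 - y j / x (Inr (i, m))) = (\<Prod>l<s. qpoch (b l / w) q M) * qpoch (1 / (w * z * q ^ N)) q (N + M)"
      unfolding prodJ by (simp add: x_def w_def mult_ac)
    have k1: "qpoch (1 / (w * z * q ^ N)) q (N + M) = qpoch (1 / q ^ N) q N * (qpoch (q * (w * z)) q N * qpoch (1 / (w * z)) q M) / ((w * z) ^ N * qpoch q q N)"
      using qpoch_kernel_ratio[OF q(1), of "w * z" N M] nz z w0 by (simp add: field_simps)
    have wq: "qpoch w q M = (1 - w) * qpoch (q * w) q N" by (simp add: M_def qpoch_Suc_left mult.commute)
    have wnz: "qpoch w q M \<noteq> 0" using w1 by (auto simp: qpoch_eq_0_iff)
    \<comment> \<open>The factor \<open>1 - 1 / w = - (1 - w) / w\<close> is the source both of the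
      sign with which these terms change sides and of the prefactor \<open>a i * q ^ m\<close> in
      \<open>conn_rhs\<close>.\<close>
    have k2: "qpoch (1 / (w * q ^ N)) q (N + 1) = - (qpoch (1 / q ^ N) q N * qpoch w q M / (w * w ^ N * qpoch q q N))"
    proof -
      have "qpoch (1 / (w * q ^ N)) q (N + 1) = qpoch (1 / q ^ N) q N * (qpoch (q * w) q N * (1 - 1 / w)) / (w ^ N * qpoch q q N)"
        using qpoch_kernel_ratio[OF q(1), of w N 1] nz w0 by (simp add: field_simps qpoch_Suc)
      also have "(qpoch (q * w) q N * (1 - 1 / w)) = - qpoch w q M / w"
        unfolding wq using w0 by (simp add: field_simps)
      finally show ?thesis by (simp add: field_simps)
    qed
    have K: "qpoch (1 / q ^ N) q N / qpoch (1 / (z * q ^ N)) q (N + M) *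
        (qpoch (1 / (w * z * q ^ N)) q (N + M) / qpoch (1 / (w * q ^ N)) q (N + 1)) =
        - (w * qpoch q q N / qpoch w q M * (qpoch (q * (w * z)) q N * qpoch (1 / (w * z)) q M / (qpoch (q * z) q N * qpoch (1 / z) q M)))"
      unfolding k1 k2 kern using nz z w0 wnz by (simp add: field_simps power_mult_distrib)
    have A: "(\<Prod>i<r. qpoch (a i) q M) = qpoch (a i) q M * (\<Prod>i'\<in>{..<r} - {i}. qpoch (a i') q M)"
      by (rule prod.remove) (use im in auto)
    have A2: "qpoch (a i) q M / qpoch w q M = qpoch (a i) q m / qpoch (a i * q ^ Suc N) q m"
    proof -
      have "a i * q ^ Suc N * q ^ j \<noteq> 1" for j
        using a1[OF im(1), of "Suc N + j"] by (auto simp: power_add mult_ac)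
      then have "qpoch (a i * q ^ Suc N) q m \<noteq> 0" by (auto simp: qpoch_eq_0_iff)
      then show ?thesis
        using qpoch_shift_swap[of "a i" q M m] wnz by (simp add: M_def w_def divide_simps)
    qed
    have "W * ((\<Prod>j\<in>J. 1 - y j / x (Inr (i, m))) / (\<Prod>j\<in>I - {Inr (i, m)}. 1 - x j / x (Inr (i, m)))) =
       (\<Prod>l<s. qpoch (b l / w) q M) / (\<Prod>l<s. qpoch (b l) q M) *
       ((\<Prod>i'\<in>{..<r} - {i}. qpoch (a i') q M) / (\<Prod>i'\<in>{..<r} - {i}. qpoch (a i' / w) q M)) *
       (qpoch (a i) q M * (qpoch (1 / q ^ N) q N / qpoch (1 / (z * q ^ N)) q (N + M) *
        (qpoch (1 / (w * z * q ^ N)) q (N + M) / qpoch (1 / (w * q ^ N)) q (N + 1))) / (qpoch (1 / q ^ m) q m * qpoch q q (N - m)))"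
      unfolding W_def num den A by (simp add: mult_ac)
    also have "\<dots> = - ((\<Prod>l<s. qpoch (b l / w) q M) / (\<Prod>l<s. qpoch (b l) q M) *
       ((\<Prod>i'\<in>{..<r} - {i}. qpoch (a i') q M) / (\<Prod>i'\<in>{..<r} - {i}. qpoch (a i' / w) q M)) *
       (w * (qpoch (a i) q M / qpoch w q M) * (qpoch q q N / (qpoch (1 / q ^ m) q m * qpoch q q (N - m))) *
         (qpoch (q * (w * z)) q N * qpoch (1 / (w * z)) q M / (qpoch (q * z) q N * qpoch (1 / z) q M))))"
      unfolding K by (simp add: mult_ac)
    also have "\<dots> = - conn_rhs r s a b q z N i m"
      unfolding A2 unfolding conn_rhs_def prod_dividef w_def M_def ..
    finally show ?thesis .
  qed
  have "W = (\<Sum>n<M. conn_lhs r s a b q z N n) + (\<Sum>im\<in>{..<r} \<times> {..<M}. - conn_rhs r s a b q z N (fst im) (snd im))"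
  proof -
    have "W = (\<Sum>n<M. W * ((\<Prod>j\<in>J. 1 - y j / x (Inl n)) / (\<Prod>j\<in>I - {Inl n}. 1 - x j / x (Inl n)))) +
        (\<Sum>im\<in>{..<r} \<times> {..<M}. W * ((\<Prod>j\<in>J. 1 - y j / x (Inr im)) / (\<Prod>j\<in>I - {Inr im}. 1 - x j / x (Inr im))))"
    proof -
      have "sum G I = (\<Sum>n<M. G (Inl n)) + (\<Sum>im\<in>{..<r} \<times> {..<M}. G (Inr im))" for G :: "_ \<Rightarrow> complex"
        unfolding I_def by (simp add: sum.Plus)
      from this[of "\<lambda>i. W * ((\<Prod>j\<in>J. 1 - y j / x i) / (\<Prod>j\<in>I - {i}. 1 - x j / x i))"] lag
      show ?thesis by (simp only:)
    qed
    also have "(\<Sum>n<M. W * ((\<Prod>j\<in>J. 1 - y j / x (Inl n)) / (\<Prod>j\<in>I - {Inl n}. 1 - x j / x (Inl n)))) = (\<Sum>n<M. conn_lhs r s a b q z N n)"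
      by (intro sum.cong refl termA) auto
    also have "(\<Sum>im\<in>{..<r} \<times> {..<M}. W * ((\<Prod>j\<in>J. 1 - y j / x (Inr im)) / (\<Prod>j\<in>I - {Inr im}. 1 - x j / x (Inr im)))) = (\<Sum>im\<in>{..<r} \<times> {..<M}. - conn_rhs r s a b q z N (fst im) (snd im))"
      by (intro sum.cong refl) (use termB in auto)
    finally show ?thesis .
  qed
  also have "(\<Sum>im\<in>{..<r} \<times> {..<M}. - conn_rhs r s a b q z N (fst im) (snd im)) = - (\<Sum>i<r. \<Sum>m<M. conn_rhs r s a b q z N i m)"
    by (simp add: sum_negf sum.cartesian_product case_prod_beta)
  finally show ?thesis unfolding W_eq M_def by (simp add: algebra_simps)
qed

lemma tendsto_qpoch [tendsto_intros]:
  "(f \<longlongrightarrow> a) F \<Longrightarrow> ((\<lambda>x. qpoch (f x) q n) \<longlongrightarrow> qpoch a q n) F"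
  unfolding qpoch_def by (intro tendsto_intros)

text \<open>If some \<open>a i\<close> is a power of \<open>1 / q\<close>, the nodes of the generic identity collide. Rescaling all
  \<open>a i\<close> by a common factor \<open>c \<rightarrow> 1\<close> separates them without changing the quotients \<open>a i / a j\<close>.\<close>

lemma finite_connection:
  fixes a b :: "nat \<Rightarrow> complex"
  assumes q: "q \<noteq> 0" "norm q < 1"
    and a0: "\<And>i. i < r \<Longrightarrow> a i \<noteq> 0"
    and aa: "\<And>i j n. i < r \<Longrightarrow> j < r \<Longrightarrow> i \<noteq> j \<Longrightarrow> a i / a j \<noteq> q powi n"
    and b1: "\<And>l j. l < s \<Longrightarrow> b l * q ^ j \<noteq> 1"
    and z: "z \<noteq> 0" "\<And>n. z \<noteq> q powi n"
    and rs: "s < r"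
    and a1: "\<And>i j. i < r \<Longrightarrow> a i * q ^ Suc N * q ^ j \<noteq> 1"
  shows "(\<Sum>n<Suc N. conn_lhs r s a b q z N n) =
           conn_rem r s a b q z N + (\<Sum>i<r. \<Sum>m<Suc N. conn_rhs r s a b q z N i m)"
proof -
  define A where "A c i = c * a i" for c i
  have A1: "A 1 = a" by (simp add: A_def fun_eq_iff)
  \<comment> \<open>The values \<open>c = 1 / (a i * q ^ j)\<close> to be avoided have no finite
    accumulation point. For \<open>norm c < 2\<close> only \<open>j < J\<close> matter, and a
    punctured neighbourhood of 1 misses these finitely many values, even if 1 is among them.\<close>
  have ev: "eventually (\<lambda>c. c \<noteq> 0 \<and> (\<forall>i<r. \<forall>j. A c i * q ^ j \<noteq> 1)) (at 1)"
  proof -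
    have "eventually (\<lambda>c. \<forall>j. A c i * q ^ j \<noteq> 1) (at 1)" if "i < r" for i
    proof -
      have "(\<lambda>j. 2 * norm (a i) * norm q ^ j) \<longlonglongrightarrow> 0"
        using q by (intro tendsto_mult_right_zero LIMSEQ_realpow_zero) auto
      then have "eventually (\<lambda>j. 2 * norm (a i) * norm q ^ j < 1) sequentially"
        by (rule order_tendstoD) simp
      then obtain J where J: "\<And>j. j \<ge> J \<Longrightarrow> 2 * norm (a i) * norm q ^ j < 1"
        by (auto simp: eventually_at_top_linorder)
      have "((\<lambda>c::complex. norm c) \<longlongrightarrow> norm (1::complex)) (at 1)" by (intro tendsto_intros)
      then have "eventually (\<lambda>c::complex. norm c < 2) (at 1)"
        by (rule order_tendstoD) simp
      moreover have "eventually (\<lambda>c. \<forall>j\<in>{..<J}. c \<noteq> 1 / (a i * q ^ j)) (at 1)"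
        by (intro eventually_ball_finite ballI eventually_neq_at_within) auto
      ultimately show ?thesis
      proof eventually_elim
        case (elim c)
        show ?case
        proof
          fix j
          show "A c i * q ^ j \<noteq> 1"
          proof (cases "j < J")
            case True
            then show ?thesis using elim(2) a0[OF that] q unfolding A_def
              by (metis eq_divide_eq lessThan_iff mult.assoc mult_eq_0_iff power_not_zero)
          next
            case False
            have "norm (A c i * q ^ j) = norm c * (norm (a i) * norm q ^ j)"
              by (simp add: A_def norm_mult norm_power)
            also have "\<dots> \<le> 2 * (norm (a i) * norm q ^ j)"
              using elim(1) by (intro mult_right_mono) auto
            also have "\<dots> < 1" using J[of j] False by simp
            finally show ?thesis by auto
          qed
        qed
      qed
    qed
    then have "eventually (\<lambda>c. \<forall>i\<in>{..<r}. \<forall>j. A c i * q ^ j \<noteq> 1) (at 1)"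
      by (intro eventually_ball_finite) auto
    moreover have "eventually (\<lambda>c::complex. c \<noteq> 0) (at 1)" by (rule eventually_neq_at_within)
    ultimately show ?thesis by eventually_elim auto
  qed
  have limA: "((\<lambda>c. A c i) \<longlongrightarrow> a i) (at 1)" for i
    unfolding A_def by (auto intro!: tendsto_eq_intros)
  have aaq: "qpoch (a i' / (a i * q ^ m)) q n \<noteq> 0" if "i < r" "i' < r" "i \<noteq> i'" for i i' m n
  proof -
    have "a i' / (a i * q ^ m) * q ^ j \<noteq> 1" for j
    proof
      assume *: "a i' / (a i * q ^ m) * q ^ j = 1"
      have "a i' / a i = q ^ m / q ^ j" using * q a0[of i] that by (simp add: divide_simps mult_ac)
      also have "\<dots> = q powi (int m - int j)" using q by (simp add: power_int_diff)
      finally show False using aa[of i' i] that by blast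
    qed
    then show ?thesis by (auto simp: qpoch_eq_0_iff)
  qed
  \<comment> \<open>After the cancellations the \<open>a i\<close> enter the vanishing-prone
    denominators only as \<open>a i * q ^ Suc N\<close> or in quotients \<open>a i' / a i\<close>.
    Hence all terms stay continuous at \<open>c = 1\<close> even where nodes collide.\<close>
  have anz: "qpoch (a i * q ^ Suc N) q m \<noteq> 0" if "i < r" for i m
    using a1[OF that] by (auto simp: qpoch_eq_0_iff)
  have limL: "((\<lambda>c. conn_lhs r s (A c) b q z N n) \<longlongrightarrow> conn_lhs r s a b q z N n) (at 1)" for n
    unfolding conn_lhs_def by (intro tendsto_intros limA tendsto_prod) (use anz in auto)
  have limR: "((\<lambda>c. conn_rem r s (A c) b q z N) \<longlongrightarrow> conn_rem r s a b q z N) (at 1)"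
    unfolding conn_rem_def divide_inverse by (intro tendsto_intros limA)
  have limC: "((\<lambda>c. conn_rhs r s (A c) b q z N i m) \<longlongrightarrow> conn_rhs r s a b q z N i m) (at 1)" if "i < r" for i m
    unfolding conn_rhs_def divide_inverse[of _ "qpoch (b l) q (Suc N)" for l]
      divide_inverse[of _ "qpoch (1 / q ^ m) q m * qpoch q q (N - m)"]
      divide_inverse[of _ "qpoch (q * z) q N * qpoch (1 / z) q (Suc N)"]
    by (intro tendsto_intros limA tendsto_prod) (use a0[OF that] q z anz[OF that] aaq[OF that] in auto)
  have lim1: "((\<lambda>c. \<Sum>n<Suc N. conn_lhs r s (A c) b q z N n) \<longlongrightarrow> (\<Sum>n<Suc N. conn_lhs r s a b q z N n)) (at 1)"
    by (intro tendsto_sum limL)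
  have lim2: "((\<lambda>c. conn_rem r s (A c) b q z N + (\<Sum>i<r. \<Sum>m<Suc N. conn_rhs r s (A c) b q z N i m)) \<longlongrightarrow>
      conn_rem r s a b q z N + (\<Sum>i<r. \<Sum>m<Suc N. conn_rhs r s a b q z N i m)) (at 1)"
    by (intro tendsto_add tendsto_sum limR limC) auto
  have "eventually (\<lambda>c. (\<Sum>n<Suc N. conn_lhs r s (A c) b q z N n) =
       conn_rem r s (A c) b q z N + (\<Sum>i<r. \<Sum>m<Suc N. conn_rhs r s (A c) b q z N i m)) (at 1)"
    using ev
  proof eventually_elim
    case (elim c)
    show ?case
    proof (rule finite_connection_generic[OF q _ _ b1 z rs])
      show "A c i \<noteq> 0" if "i < r" for i using elim a0 that by (simp add: A_def)
      show "A c i / A c j \<noteq> q powi n" if "i < r" "j < r" "i \<noteq> j" for i j n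
        using elim aa[OF that, of n] by (simp add: A_def)
      show "A c i * q ^ j \<noteq> 1" if "i < r" for i j using elim that by blast
    qed
  qed
  from tendsto_cong[OF this] lim1 lim2 show ?thesis
    using tendsto_unique[of "at (1::complex)"] by auto
qed

section \<open>The connection formula\<close>

text \<open>Dominated convergence for sums whose length grows with the parameter: terms beyond
  \<open>N\<close> are set to 0, which respects the majorant because it is nonnegative.\<close>

lemma tannery_triangle:
  fixes f :: "nat \<Rightarrow> nat \<Rightarrow> complex"
  assumes lim: "\<And>k. (\<lambda>N. f N k) \<longlonglongrightarrow> g k"
    and bound: "\<And>N k. N \<ge> N0 \<Longrightarrow> k \<le> N \<Longrightarrow> norm (f N k) \<le> M k"
    and M: "summable M" "\<And>k. M k \<ge> 0"
  shows "(\<lambda>N. \<Sum>k<Suc N. f N k) \<longlonglongrightarrow> suminf g" "summable (\<lambda>k. norm (g k))"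
proof -
  define a where "a k N = (if k \<le> N then f N k else 0)" for k N
  have "(\<lambda>N. a k N) \<longlonglongrightarrow> g k" for k
    using lim[of k] by (rule Lim_transform_eventually)
      (auto simp: a_def intro: eventually_mono[OF eventually_ge_at_top[of k]])
  moreover have "eventually (\<lambda>(k,N). norm (a k N) \<le> M k) (at_top \<times>\<^sub>F sequentially)"
    unfolding eventually_prod_filter
    by (rule exI[of _ "\<lambda>_. True"], rule exI[of _ "\<lambda>N. N \<ge> N0"])
       (use bound M(2) in \<open>auto simp: a_def eventually_ge_at_top\<close>)
  ultimately have *: "summable (\<lambda>n. norm (g n)) \<and> ((\<lambda>N. suminf (\<lambda>k. a k N)) \<longlonglongrightarrow> suminf g)"
    using tannerys_theorem[of a g sequentially M] M(1) by auto
  have "suminf (\<lambda>k. a k N) = (\<Sum>k<Suc N. f N k)" for N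
    by (subst suminf_finite[of "{..<Suc N}"]) (auto simp: a_def intro!: sum.cong)
  with * show "(\<lambda>N. \<Sum>k<Suc N. f N k) \<longlonglongrightarrow> suminf g" "summable (\<lambda>k. norm (g k))" by simp_all
qed

section \<open>Closure properties of bounded families, used to obtain majorants without explicit
  constants\<close>

lemma bounded_image_mult:
  fixes f g :: "'i \<Rightarrow> complex"
  assumes "bounded (f ` S)" "bounded (g ` S)"
  shows "bounded ((\<lambda>x. f x * g x) ` S)"
proof -
  obtain A B where A: "\<And>x. x \<in> S \<Longrightarrow> norm (f x) \<le> A" "A > 0"
    and B: "\<And>x. x \<in> S \<Longrightarrow> norm (g x) \<le> B"
    using assms unfolding bounded_pos by (metis image_eqI)
  have "norm (f x * g x) \<le> A * B" if "x \<in> S" for x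
    unfolding norm_mult using A B that by (intro mult_mono) auto
  then show ?thesis by (auto simp: bounded_iff)
qed

lemma bounded_imageE:
  fixes f :: "'i \<Rightarrow> complex"
  assumes "bounded (f ` S)"
  obtains C where "C > 0" "\<And>x. x \<in> S \<Longrightarrow> norm (f x) \<le> C"
  using assms unfolding bounded_pos by blast

lemma bounded_image_prod:
  fixes f :: "'j \<Rightarrow> 'i \<Rightarrow> complex"
  assumes "\<And>j. j \<in> J \<Longrightarrow> bounded (f j ` S)"
  shows "bounded ((\<lambda>x. \<Prod>j\<in>J. f j x) ` S)"
  using assms
proof (induction J rule: infinite_finite_induct)
  case (insert j J)
  then show ?case by (auto intro: bounded_image_mult)
qed (auto simp: bounded_iff intro!: exI[of _ 1])

lemma bounded_image_divide:
  fixes f g :: "'i \<Rightarrow> complex"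
  assumes "bounded (f ` S)" "bounded ((\<lambda>x. inverse (g x)) ` S)"
  shows "bounded ((\<lambda>x. f x / g x) ` S)"
  using bounded_image_mult[OF assms] by (simp add: divide_inverse)

lemma bounded_image_inverse_mult:
  fixes f g :: "'i \<Rightarrow> complex"
  assumes "bounded ((\<lambda>x. inverse (f x)) ` S)" "bounded ((\<lambda>x. inverse (g x)) ` S)"
  shows "bounded ((\<lambda>x. inverse (f x * g x)) ` S)"
  using bounded_image_mult[OF assms] by simp

lemma bounded_image_qpoch:
  fixes g :: "'i \<Rightarrow> complex"
  assumes "norm q < 1" "\<And>x. x \<in> S \<Longrightarrow> norm (g x) \<le> B"
  shows "bounded ((\<lambda>x. qpoch (g x) q (n x)) ` S)"
  using norm_qpoch_le[OF assms(1) assms(2)] by (auto simp: bounded_iff)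

lemma bounded_image_inverse_qpoch:
  assumes "norm q < 1" "\<And>j. a * q ^ j \<noteq> 1"
  shows "bounded ((\<lambda>x. inverse (qpoch a q (n x))) ` S)"
proof -
  obtain c where c: "c > 0" "\<And>n. norm (qpoch a q n) \<ge> c"
    using qpoch_bounded_below[OF assms] by blast
  then have "norm (inverse (qpoch a q (n x))) \<le> inverse c" for x
    by (auto simp: norm_inverse intro!: le_imp_inverse_le)
  then show ?thesis by (auto simp: bounded_iff)
qed

lemma bounded_image_inverse_qpoch':
  assumes "norm q < 1" "\<And>x. x \<in> S \<Longrightarrow> norm (g x) \<le> norm q"
  shows "bounded ((\<lambda>x. inverse (qpoch (g x) q (n x))) ` S)"
proof -
  obtain c where c: "c > 0" "\<And>a n. norm a \<le> norm q \<Longrightarrow> norm (qpoch a q n) \<ge> c"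
    using qpoch_bounded_below_uniform[OF assms(1)] by blast
  then have "norm (inverse (qpoch (g x) q (n x))) \<le> inverse c" if "x \<in> S" for x
    using assms(2)[OF that] by (auto simp: norm_inverse intro!: le_imp_inverse_le)
  then show ?thesis by (auto simp: bounded_iff)
qed

text \<open>Consecutive terms have ratio \<open>D * q ^ (k * Suc m)\<close>, which tends to 0 for
  every \<open>D\<close> because \<open>k \<ge> 1\<close>. This is why the series in
  \<open>1 / z\<close> converge on the whole punctured plane.\<close>

lemma summable_power_tri:
  fixes D q :: real
  assumes "0 \<le> q" "q < 1" "D \<ge> 0" "k \<ge> 1"
  shows "summable (\<lambda>m. D ^ m * q ^ (k * (m * Suc m div 2)))"
proof -
  have "(\<lambda>m. D * q ^ m) \<longlonglongrightarrow> 0"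
    using assms by (intro tendsto_mult_right_zero LIMSEQ_realpow_zero) auto
  then have "eventually (\<lambda>m. D * q ^ m < 1 / 2) sequentially"
    by (rule order_tendstoD) simp
  then obtain N where N: "\<And>m. m \<ge> N \<Longrightarrow> D * q ^ m < 1 / 2"
    by (auto simp: eventually_at_top_linorder)
  show ?thesis
  proof (rule summable_ratio_test[of "1/2" N])
    fix m assume "m \<ge> N"
    have "D ^ Suc m * q ^ (k * (Suc m * Suc (Suc m) div 2)) =
        (D * q ^ (k * Suc m)) * (D ^ m * q ^ (k * (m * Suc m div 2)))"
      unfolding tri_Suc distrib_left power_add power_Suc by (simp only: mult_ac)
    also have "\<dots> \<le> 1 / 2 * (D ^ m * q ^ (k * (m * Suc m div 2)))"
    proof (rule mult_right_mono)
      have "m \<le> k * Suc m" using assms(4) by (cases k) auto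
      then have "q ^ (k * Suc m) \<le> q ^ m"
        using assms by (intro power_decreasing) auto
      then have "D * q ^ (k * Suc m) \<le> D * q ^ m" using assms by (intro mult_left_mono)
      then show "D * q ^ (k * Suc m) \<le> 1 / 2" using N[OF \<open>m \<ge> N\<close>] by linarith
    qed (use assms in auto)
    finally show "norm (D ^ Suc m * q ^ (k * (Suc m * Suc (Suc m) div 2))) \<le> 1 / 2 * norm (D ^ m * q ^ (k * (m * Suc m div 2)))"
      using assms by (simp add: abs_mult)
  qed auto
qed

text \<open>The q-analogue of \<open>conn_coeff\<close>: as \<open>q \<rightarrow> 1\<close> its
  quotients of infinite products become quotients of Gamma functions, up to powers of
  \<open>1 - q\<close>.\<close>

definition conn_const where
  "conn_const r s a b q i =
     (\<Prod>i'\<in>{..<r} - {i}. qinf (a i') q / qinf (a i' / a i) q) * (\<Prod>l<s. qinf (b l / a i) q / qinf (b l) q)"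
  for r s :: nat and a b :: "nat \<Rightarrow> complex"

text \<open>Coefficients of a basic hypergeometric series with \<open>s + 1\<close> upper and
  \<open>r - 1\<close> lower parameters, stripped of the Gaussian factor. That factor is kept apart
  because the Laplace sum absorbs it.\<close>

definition conn_ser where
  "conn_ser r s a b q i m =
     qpoch (a i) q m * (\<Prod>l<s. qpoch (q * a i / b l) q m) /
     (qpoch q q m * (\<Prod>i'\<in>{..<r} - {i}. qpoch (q * a i / a i') q m))"
  for r s :: nat and a b :: "nat \<Rightarrow> complex"

text \<open>For \<open>r = s + 1 + k\<close> and nonzero \<open>a i\<close> this is
  \<open>(-1) ^ k * q * a i ^ k\<close> times the product of all \<open>b l\<close> divided by the
  product of all \<open>a i\<close>. The form given is the one in which the factors emerge from
  \<open>qpoch_reverse_split\<close>.\<close>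

definition conn_arg where
  "conn_arg r s a b q i = q / a i * (\<Prod>l<s. - (b l / a i)) / (\<Prod>i'\<in>{..<r} - {i}. - (a i' / a i))"
  for r s :: nat and a b :: "nat \<Rightarrow> complex"

text \<open>Every product whose argument contains \<open>1 / q ^ m\<close> is reversed, which costs
  a factor \<open>1 / t\<close> with \<open>t = q ^ (m * Suc m div 2)\<close>. The numerators over
  \<open>b\<close> give \<open>s\<close> such factors, the denominators over the other
  \<open>a i'\<close> give \<open>s + k\<close>, and those of the kernel and of
  \<open>qpoch (1 / q ^ m) q m\<close> cancel. What survives is \<open>t ^ k\<close>, the Gaussian
  factor.\<close>

lemma conn_rhs_eq:
  fixes a b :: "nat \<Rightarrow> complex"
  assumes q: "q \<noteq> 0"
    and a0: "\<And>i. i < r \<Longrightarrow> a i \<noteq> 0"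
    and b0: "\<And>l. l < s \<Longrightarrow> b l \<noteq> 0"
    and z: "z \<noteq> 0"
    and rs: "r = s + 1 + k"
    and im: "i < r" "m \<le> N"
  shows "conn_rhs r s a b q z N i m =
     (conn_arg r s a b q i / z) ^ m * q ^ (k * (m * Suc m div 2)) *
     ((\<Prod>l<s. qpoch (q * a i / b l) q m * (qpoch (b l / a i) q (Suc N - m) / qpoch (b l) q (Suc N))) *
      (\<Prod>i'\<in>{..<r} - {i}. (qpoch (a i') q (Suc N) / qpoch (a i' / a i) q (Suc N - m)) / qpoch (q * a i / a i') q m) *
      (a i * (qpoch (a i) q m / qpoch (a i * q ^ Suc N) q m) *
       (qpoch q q N / (qpoch q q m * qpoch q q (N - m))) *
       (qpoch (q * (a i * z)) q (m + N) * qpoch (1 / (a i * z)) q (Suc N - m) /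
        (qpoch (q * z) q N * qpoch (1 / z) q (Suc N)))))"
proof -
  define t where "t = q ^ (m * Suc m div 2)"
  have t0: "t \<noteq> 0" using q by (simp add: t_def)
  have ai: "a i \<noteq> 0" using a0 im by simp
  have e: "Suc N = m + (Suc N - m)" using im by simp
  have rev: "qpoch (x / (a i * q ^ m)) q (Suc N) =
      (- (x / a i)) ^ m / t * (qpoch (q * a i / x) q m * qpoch (x / a i) q (Suc N - m))" if "x \<noteq> 0" for x
    using qpoch_reverse_split[OF q, of "x / a i" m "Suc N - m"] that ai im by (simp add: t_def)
  have P1: "(\<Prod>l<s. qpoch (b l / (a i * q ^ m)) q (Suc N) / qpoch (b l) q (Suc N)) =
      (\<Prod>l<s. - (b l / a i)) ^ m / t ^ s *
      (\<Prod>l<s. qpoch (q * a i / b l) q m * (qpoch (b l / a i) q (Suc N - m) / qpoch (b l) q (Suc N)))"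
  proof -
    have "(\<Prod>l<s. qpoch (b l / (a i * q ^ m)) q (Suc N) / qpoch (b l) q (Suc N)) =
      (\<Prod>l<s. (- (b l / a i)) ^ m / t * (qpoch (q * a i / b l) q m * (qpoch (b l / a i) q (Suc N - m) / qpoch (b l) q (Suc N))))"
      using b0 by (intro prod.cong) (auto simp: rev)
    then show ?thesis
      by (simp only: prod.distrib prod_dividef prod_power_distrib prod_constant card_lessThan)
  qed
  have P2: "(\<Prod>i'\<in>{..<r} - {i}. qpoch (a i') q (Suc N) / qpoch (a i' / (a i * q ^ m)) q (Suc N)) =
      t ^ (s + k) / (\<Prod>i'\<in>{..<r} - {i}. - (a i' / a i)) ^ m *
      (\<Prod>i'\<in>{..<r} - {i}. (qpoch (a i') q (Suc N) / qpoch (a i' / a i) q (Suc N - m)) / qpoch (q * a i / a i') q m)"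
  proof -
    have c: "card ({..<r} - {i}) = s + k" using im rs by simp
    have "(\<Prod>i'\<in>{..<r} - {i}. qpoch (a i') q (Suc N) / qpoch (a i' / (a i * q ^ m)) q (Suc N)) =
      (\<Prod>i'\<in>{..<r} - {i}. t / (- (a i' / a i)) ^ m * ((qpoch (a i') q (Suc N) / qpoch (a i' / a i) q (Suc N - m)) / qpoch (q * a i / a i') q m))"
      using a0 t0 by (intro prod.cong) (auto simp: rev mult_ac)
    then show ?thesis
      by (simp only: prod.distrib prod_dividef prod_power_distrib prod_constant c)
  qed
  have P3: "qpoch (1 / q ^ m) q m = (- 1) ^ m / t * qpoch q q m"
    using qpoch_reverse[OF q, of 1 m] by (simp add: t_def)
  have P4: "qpoch (1 / (a i * q ^ m * z)) q (Suc N) = (- (1 / (a i * z))) ^ m / t * (qpoch (q * (a i * z)) q m * qpoch (1 / (a i * z)) q (Suc N - m))"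
    using rev[of "1 / z"] z by (simp add: mult_ac)
  have P5: "qpoch (q * (a i * q ^ m * z)) q N * (qpoch (q * (a i * z)) q m * Y) = qpoch (q * (a i * z)) q (m + N) * Y" for Y
    by (simp add: qpoch_add mult_ac)
  have pw: "(\<Prod>l<s. - (b l / a i)) ^ m / t ^ s * (t ^ (s + k) / (\<Prod>i'\<in>{..<r} - {i}. - (a i' / a i)) ^ m) *
     (q ^ m * (t / (- 1) ^ m) * ((- (1 / (a i * z))) ^ m / t)) = (conn_arg r s a b q i / z) ^ m * q ^ (k * (m * Suc m div 2))"
  proof -
    have "q ^ (k * (m * Suc m div 2)) = t ^ k"
      by (simp add: t_def power_mult[symmetric] mult.commute)
    moreover have "(- (1 / (a i * z))) ^ m = (- 1) ^ m / (a i * z) ^ m"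
      using power_minus[of "1 / (a i * z)" m] by (simp add: power_one_over)
    moreover have "t ^ (s + k) = t ^ s * t ^ k" by (rule power_add)
    ultimately show ?thesis
      using t0 by (simp add: conn_arg_def power_divide power_mult_distrib mult_ac)
  qed
  have "conn_rhs r s a b q z N i m = (\<Prod>l<s. - (b l / a i)) ^ m / t ^ s * (t ^ (s + k) / (\<Prod>i'\<in>{..<r} - {i}. - (a i' / a i)) ^ m) *
     (q ^ m * (t / (- 1) ^ m) * ((- (1 / (a i * z))) ^ m / t)) *
     ((\<Prod>l<s. qpoch (q * a i / b l) q m * (qpoch (b l / a i) q (Suc N - m) / qpoch (b l) q (Suc N))) *
      (\<Prod>i'\<in>{..<r} - {i}. (qpoch (a i') q (Suc N) / qpoch (a i' / a i) q (Suc N - m)) / qpoch (q * a i / a i') q m) *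
      (a i * (qpoch (a i) q m / qpoch (a i * q ^ Suc N) q m) *
       (qpoch q q N / (qpoch q q m * qpoch q q (N - m))) *
       (qpoch (q * (a i * q ^ m * z)) q N * (qpoch (q * (a i * z)) q m * qpoch (1 / (a i * z)) q (Suc N - m)) /
        (qpoch (q * z) q N * qpoch (1 / z) q (Suc N)))))"
    unfolding conn_rhs_def P1 P2 P3 P4 by (simp add: mult_ac)
  then show ?thesis unfolding pw P5 .
qed

lemma quotient_not_qpow:
  fixes a :: "nat \<Rightarrow> complex"
  assumes q: "q \<noteq> 0"
    and a0: "\<And>i. i < r \<Longrightarrow> a i \<noteq> 0"
    and aa: "\<And>i j n. i < r \<Longrightarrow> j < r \<Longrightarrow> i \<noteq> j \<Longrightarrow> a i / a j \<noteq> q powi n"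
    and "i < r" "i' < r" "i \<noteq> i'"
  shows "a i' / a i * q ^ j \<noteq> 1" "q * a i / a i' * q ^ j \<noteq> 1"
proof -
  show "a i' / a i * q ^ j \<noteq> 1"
  proof
    assume *: "a i' / a i * q ^ j = 1"
    then have "a i / a i' = q ^ j" using assms by (auto simp: divide_simps mult_ac)
    also have "\<dots> = q powi (int j)" by simp
    finally show False using aa[of i i'] assms by blast
  qed
  show "q * a i / a i' * q ^ j \<noteq> 1"
  proof
    assume *: "q * a i / a i' * q ^ j = 1"
    then have "a i' / a i = q ^ Suc j" using assms by (auto simp: divide_simps mult_ac)
    also have "\<dots> = q powi (int (Suc j))" by (simp only: power_int_of_nat)
    finally show False using aa[of i' i] assms by blast
  qed
qed

lemma conn_ser_bounded:
  fixes a b :: "nat \<Rightarrow> complex"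
  assumes q: "q \<noteq> 0" "norm q < 1"
    and a0: "\<And>i. i < r \<Longrightarrow> a i \<noteq> 0"
    and aa: "\<And>i j n. i < r \<Longrightarrow> j < r \<Longrightarrow> i \<noteq> j \<Longrightarrow> a i / a j \<noteq> q powi n"
    and i: "i < r"
  obtains C where "C > 0" "\<And>m. norm (conn_ser r s a b q i m) \<le> C"
proof -
  have bq: "bounded (range (\<lambda>m. qpoch x q m))" for x
    by (rule bounded_image_qpoch[OF q(2), of _ _ "norm x"]) simp
  have bi: "bounded (range (\<lambda>m. inverse (qpoch x q m)))" if "\<And>j. x * q ^ j \<noteq> 1" for x
    by (rule bounded_image_inverse_qpoch[OF q(2) that])
  have "bounded (range (\<lambda>m. qpoch (a i) q m * (\<Prod>l<s. qpoch (q * a i / b l) q m) *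
      (inverse (qpoch q q m) * (\<Prod>i'\<in>{..<r} - {i}. inverse (qpoch (q * a i / a i') q m)))))"
    by (intro bounded_image_mult bounded_image_prod bq bi quotient_not_qpow(2)[where a = a and r = r, OF q(1) a0 aa i] qpow_neq_1 q) auto
  also have "(\<lambda>m. qpoch (a i) q m * (\<Prod>l<s. qpoch (q * a i / b l) q m) *
      (inverse (qpoch q q m) * (\<Prod>i'\<in>{..<r} - {i}. inverse (qpoch (q * a i / a i') q m)))) = conn_ser r s a b q i"
    by (simp add: fun_eq_iff conn_ser_def divide_inverse prod_inversef[unfolded o_def])
  finally show ?thesis using that unfolding bounded_pos by blast
qed

text \<open>The limit \<open>N \<rightarrow> \<infinity>\<close> of
  \<open>finite_connection\<close>. The bound \<open>norm z < 1\<close> dominates the power series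
  on the left and sends the remainder to 0; the right-hand side makes sense for all \<open>z\<close>
  off the spiral.\<close>

lemma connection_formula:
  fixes a b :: "nat \<Rightarrow> complex"
  assumes q: "q \<noteq> 0" "norm q < 1"
    and a0: "\<And>i. i < r \<Longrightarrow> a i \<noteq> 0"
    and aa: "\<And>i j n. i < r \<Longrightarrow> j < r \<Longrightarrow> i \<noteq> j \<Longrightarrow> a i / a j \<noteq> q powi n"
    and b0: "\<And>l. l < s \<Longrightarrow> b l \<noteq> 0"
    and b1: "\<And>l j. l < s \<Longrightarrow> b l * q ^ j \<noteq> 1"
    and z: "z \<noteq> 0" "norm z < 1" "\<And>n. z \<noteq> q powi n"
    and rs: "r = s + 1 + k" "k \<ge> 1"
  shows "(\<Sum>n. (\<Prod>i<r. qpoch (a i) q n) / ((\<Prod>l<s. qpoch (b l) q n) * qpoch q q n) * z ^ n) =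
     (\<Sum>i<r. conn_const r s a b q i * (jprod q (a i * z) / jprod q z) *
        (\<Sum>m. conn_ser r s a b q i m * (conn_arg r s a b q i / z) ^ m * q ^ (k * (m * Suc m div 2))))"
proof -
  note q1 = qpow_neq_1[OF q]
  note zq = not_qpow_shift(1)[OF q(1) z(1) z(3)] and zq' = not_qpow_shift(2)[OF q(1) z(1) z(3)]
  have aaq: "a i' / a i * q ^ j \<noteq> 1" "q * a i / a i' * q ^ j \<noteq> 1" if "i < r" "i' < r" "i \<noteq> i'" for i i' j
    by (rule quotient_not_qpow[of q r a]; use q(1) a0 aa that in blast)+
  have nz: "qinf q q \<noteq> 0" "qinf (q * z) q \<noteq> 0" "qinf (1 / z) q \<noteq> 0" "\<And>n. qpoch q q n \<noteq> 0"
    using q1 zq zq' q by (auto simp: qinf_eq_0_iff qpoch_eq_0_iff)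
  have bnz: "qinf (b l) q \<noteq> 0" "qpoch (b l) q n \<noteq> 0" if "l < s" for l n
    using b1[OF that] q by (auto simp: qinf_eq_0_iff qpoch_eq_0_iff)
  have anz: "qinf (a i' / a i) q \<noteq> 0" "qpoch (q * a i / a i') q n \<noteq> 0" if "i < r" "i' < r" "i \<noteq> i'" for i i' n
    using aaq[OF that] q by (auto simp: qinf_eq_0_iff qpoch_eq_0_iff)
  have fl: "filterlim (\<lambda>N. Suc N) at_top sequentially" "filterlim (\<lambda>N. N - n) at_top sequentially"
     "filterlim (\<lambda>N. Suc N - n) at_top sequentially" "filterlim (\<lambda>N. n + N) at_top sequentially"
     "filterlim (\<lambda>N. Suc N + n) at_top sequentially" "filterlim (\<lambda>N. N) at_top sequentially" for n
  proof -
    show 1: "filterlim (\<lambda>N. Suc N) at_top sequentially" by (rule filterlim_Suc)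
    show 2: "filterlim (\<lambda>N. N - n) at_top sequentially" for n by (rule filterlim_minus_const_nat_at_top)
    show 3: "filterlim (\<lambda>N. n + N) at_top sequentially" for n
      using filterlim_add_const_nat_at_top[of n] by (simp add: add.commute)
    show "filterlim (\<lambda>N. Suc N - n) at_top sequentially" by (rule filterlim_compose[OF 2 1])
    show "filterlim (\<lambda>N. Suc N + n) at_top sequentially" using 3[of "Suc n"] by (simp add: add.commute)
  qed (rule filterlim_ident)
  note ql = fl[THEN qpoch_filterlim_qinf[OF q(2)]]
  have qp0: "(\<lambda>N. x * q ^ Suc N) \<longlonglongrightarrow> 0" for x
    using q by (intro tendsto_mult_right_zero filterlim_compose[OF LIMSEQ_power_zero fl(1)]) auto
  have qp1: "(\<lambda>N. qpoch (x * q ^ Suc N) q n) \<longlonglongrightarrow> 1" for x n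
    using tendsto_qpoch[OF qp0[of x], of q n] by (simp add: qpoch_def)
  \<comment> \<open>From \<open>N0\<close> on, \<open>a i * q ^ Suc N\<close> has norm below
    \<open>norm q\<close>. This provides both the uniform lower bound of the denominators and the
    hypothesis \<open>a1\<close> of \<open>finite_connection\<close>.\<close>
  have "\<exists>N0. \<forall>N\<ge>N0. \<forall>i\<in>{..<r}. norm (a i * q ^ Suc N) < norm q"
    unfolding eventually_at_top_linorder[symmetric]
  proof (intro eventually_ball_finite ballI)
    fix i
    have "(\<lambda>N. norm (a i * q ^ Suc N)) \<longlonglongrightarrow> 0" using tendsto_norm[OF qp0[of "a i"]] by simp
    then show "eventually (\<lambda>N. norm (a i * q ^ Suc N) < norm q) sequentially"
      by (rule order_tendstoD) (use q in simp)
  qed simp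
  then obtain N0 where N0: "\<And>N i. N \<ge> N0 \<Longrightarrow> i < r \<Longrightarrow> norm (a i * q ^ Suc N) < norm q" by blast
  define S where "S = {(N, m). N0 \<le> N \<and> m \<le> (N :: nat)}"
  have qle: "norm q ^ n \<le> 1" for n using q by (simp add: power_le_one)
  have qle': "norm (x * q ^ n) \<le> norm x" for x n
    using qle[of n] mult_left_le[of "norm q ^ n" "norm x"] by (simp add: norm_mult norm_power)
  have bq: "bounded ((\<lambda>p. qpoch x q (f p)) ` S)" for x and f :: "nat \<times> nat \<Rightarrow> nat"
    by (rule bounded_image_qpoch[OF q(2), of _ _ "norm x"]) simp
  have bi: "bounded ((\<lambda>p. inverse (qpoch x q (f p))) ` S)" if "\<And>j. x * q ^ j \<noteq> 1" for x and f :: "nat \<times> nat \<Rightarrow> nat"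
    by (rule bounded_image_inverse_qpoch[OF q(2) that])
  have bc: "bounded ((\<lambda>p. c) ` S)" for c :: complex by (auto simp: bounded_iff)
  have ba: "bounded ((\<lambda>p. inverse (qpoch (a i * q ^ Suc (fst p)) q (f p))) ` S)" if "i < r" for i f
    by (rule bounded_image_inverse_qpoch'[OF q(2)]) (use N0[THEN less_imp_le] that in \<open>auto simp: S_def simp del: power_Suc\<close>)
  have bb: "bounded ((\<lambda>p. qpoch (x * q ^ Suc (fst p)) q (f p)) ` S)" for x f
    by (rule bounded_image_qpoch[OF q(2), of _ _ "norm x"]) (rule qle')

  have L: "(\<lambda>N. \<Sum>n<Suc N. conn_lhs r s a b q z N n) \<longlonglongrightarrow>
     (\<Sum>n. (\<Prod>i<r. qpoch (a i) q n) / ((\<Prod>l<s. qpoch (b l) q n) * qpoch q q n) * z ^ n)"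
  proof -
    have "(\<lambda>N. conn_lhs r s a b q z N n) \<longlonglongrightarrow> (\<Prod>i<r. qpoch (a i) q n / 1) * (\<Prod>l<s. 1 / qpoch (b l) q n) *
       (z ^ n / qpoch q q n * (qinf q q / qinf q q) * (qinf (q * z) q / qinf (q * z) q) * (qinf (1 / z) q / qinf (1 / z) q))" for n
      unfolding conn_lhs_def
      by (intro tendsto_mult tendsto_prod tendsto_divide tendsto_const qp1 ql) (use nz bnz in auto)
    then have lim: "(\<lambda>N. conn_lhs r s a b q z N n) \<longlonglongrightarrow> (\<Prod>i<r. qpoch (a i) q n) / ((\<Prod>l<s. qpoch (b l) q n) * qpoch q q n) * z ^ n" for n
      using nz by (simp add: prod_dividef)
    \<comment> \<open>\<open>G\<close> is \<open>conn_lhs\<close> without \<open>z ^ n\<close>.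
      Being bounded over all pairs in \<open>S\<close>, it leaves the geometric series in
      \<open>norm z\<close> as majorant.\<close>
    define G where "G N n = (\<Prod>i<r. qpoch (a i) q n / qpoch (a i * q ^ Suc N) q n) *
         (\<Prod>l<s. qpoch (b l * q ^ Suc N) q n / qpoch (b l) q n) *
         (1 / qpoch q q n * (qpoch q q N / qpoch q q (N - n)) *
          (qpoch (q * z) q (N - n) / qpoch (q * z) q N) *
          (qpoch (1 / z) q (Suc N + n) / qpoch (1 / z) q (Suc N)))" for N n
    have "bounded ((\<lambda>p. G (fst p) (snd p)) ` S)"
      unfolding G_def
      by (intro bounded_image_mult bounded_image_prod bounded_image_divide bq bb ba bc bi q1 zq zq' b1) auto
    then obtain C where C: "C > 0" "\<And>p. p \<in> S \<Longrightarrow> norm (G (fst p) (snd p)) \<le> C"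
      by (rule bounded_imageE) blast
    have bd: "norm (conn_lhs r s a b q z N n) \<le> C * norm z ^ n" if "N \<ge> N0" "n \<le> N" for N n
    proof -
      have "conn_lhs r s a b q z N n = G N n * z ^ n"
        by (simp add: conn_lhs_def G_def)
      moreover have "norm (G N n) \<le> C" using C(2)[of "(N, n)"] that by (simp add: S_def)
      ultimately show ?thesis by (simp add: norm_mult norm_power mult_right_mono)
    qed
    show ?thesis
      by (rule tannery_triangle(1)[OF lim bd]) (use z C in \<open>auto intro!: summable_mult summable_geometric\<close>)
  qed

  have Rm: "(\<lambda>N. conn_rem r s a b q z N) \<longlonglongrightarrow> 0"
  proof -
    have "(\<lambda>N. conn_rem r s a b q z N) \<longlonglongrightarrow> (\<Prod>i<r. qinf (a i) q) / (\<Prod>l<s. qinf (b l) q) * (0 * qinf q q / (qinf (q * z) q * qinf (1 / z) q))"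
      unfolding conn_rem_def
      by (intro tendsto_mult tendsto_prod tendsto_divide ql LIMSEQ_power_zero) (use nz bnz z in auto)
    then show ?thesis by simp
  qed

  have R: "(\<lambda>N. \<Sum>m<Suc N. conn_rhs r s a b q z N i m) \<longlonglongrightarrow>
     conn_const r s a b q i * (jprod q (a i * z) / jprod q z) *
        (\<Sum>m. conn_ser r s a b q i m * (conn_arg r s a b q i / z) ^ m * q ^ (k * (m * Suc m div 2)))" if i: "i < r" for i
  proof -
    have ai: "a i \<noteq> 0" using a0 i by simp
    define D where "D = conn_arg r s a b q i / z"
    define G where "G N m = (\<Prod>l<s. qpoch (q * a i / b l) q m * (qpoch (b l / a i) q (Suc N - m) / qpoch (b l) q (Suc N))) *
      (\<Prod>i'\<in>{..<r} - {i}. (qpoch (a i') q (Suc N) / qpoch (a i' / a i) q (Suc N - m)) / qpoch (q * a i / a i') q m) *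
      (a i * (qpoch (a i) q m / qpoch (a i * q ^ Suc N) q m) *
       (qpoch q q N / (qpoch q q m * qpoch q q (N - m))) *
       (qpoch (q * (a i * z)) q (m + N) * qpoch (1 / (a i * z)) q (Suc N - m) /
        (qpoch (q * z) q N * qpoch (1 / z) q (Suc N))))" for N m
    have eq: "conn_rhs r s a b q z N i m = D ^ m * q ^ (k * (m * Suc m div 2)) * G N m" if "m \<le> N" for N m
      unfolding G_def D_def by (rule conn_rhs_eq[where a = a and b = b, OF q(1) a0 b0 z(1) rs(1) i that])
    define H where "H m = (\<Prod>l<s. qpoch (q * a i / b l) q m * (qinf (b l / a i) q / qinf (b l) q)) *
      (\<Prod>i'\<in>{..<r} - {i}. (qinf (a i') q / qinf (a i' / a i) q) / qpoch (q * a i / a i') q m) *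
      (a i * (qpoch (a i) q m / 1) * (qinf q q / (qpoch q q m * qinf q q)) *
       (qinf (q * (a i * z)) q * qinf (1 / (a i * z)) q / (qinf (q * z) q * qinf (1 / z) q)))" for m
    have "(\<lambda>N. G N m) \<longlonglongrightarrow> H m" for m
      unfolding G_def H_def
      by (intro tendsto_mult tendsto_prod tendsto_divide tendsto_const qp1 ql) (use nz bnz anz i in auto)
    then have lim0: "(\<lambda>N. D ^ m * q ^ (k * (m * Suc m div 2)) * G N m) \<longlonglongrightarrow> D ^ m * q ^ (k * (m * Suc m div 2)) * H m" for m
      by (intro tendsto_mult tendsto_const)
    \<comment> \<open>The limit produces \<open>jprod\<close> at \<open>1 / (a i * z)\<close> and
      \<open>1 / z\<close>. Inverting both arguments yields a factor \<open>1 / a i\<close>, which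
      the prefactor \<open>a i\<close> cancels.\<close>
    have H: "H m = conn_const r s a b q i * (jprod q (a i * z) / jprod q z) * conn_ser r s a b q i m" for m
    proof -
      have "qinf (q * (a i * z)) q * qinf (1 / (a i * z)) q = jprod q (1 / (a i * z))"
        "qinf (q * z) q * qinf (1 / z) q = jprod q (1 / z)"
        unfolding jprod_def by simp_all
      then have "a i * (qinf (q * (a i * z)) q * qinf (1 / (a i * z)) q / (qinf (q * z) q * qinf (1 / z) q)) =
          a i * (jprod q (1 / (a i * z)) / jprod q (1 / z))" by (simp only:)
      also have "\<dots> = a i * ((- jprod q (a i * z) / (a i * z)) / (- jprod q z / z))"
        using jprod_inverse[OF q(2) q(1)] ai z by simp
      also have "\<dots> = jprod q (a i * z) / jprod q z"
        using ai z jprod_eq_0_iff[OF q(2) q(1) z(1)] by (simp add: field_simps)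
      finally have th: "a i * (qinf (q * (a i * z)) q * qinf (1 / (a i * z)) q / (qinf (q * z) q * qinf (1 / z) q)) = jprod q (a i * z) / jprod q z" .
      have "H m = (\<Prod>l<s. qpoch (q * a i / b l) q m) * (\<Prod>l<s. qinf (b l / a i) q / qinf (b l) q) *
         ((\<Prod>i'\<in>{..<r} - {i}. qinf (a i') q / qinf (a i' / a i) q) / (\<Prod>i'\<in>{..<r} - {i}. qpoch (q * a i / a i') q m)) *
         (a i * (qinf (q * (a i * z)) q * qinf (1 / (a i * z)) q / (qinf (q * z) q * qinf (1 / z) q))) * (qpoch (a i) q m / qpoch q q m)"
        unfolding H_def prod.distrib prod_dividef[of _ "\<lambda>i'. qpoch (q * a i / a i') q m"] using nz by (simp add: mult_ac)
      then show ?thesis unfolding th conn_const_def conn_ser_def by (simp add: mult_ac)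
    qed
    have "bounded ((\<lambda>p. G (fst p) (snd p)) ` S)"
      unfolding G_def
      by (intro bounded_image_mult bounded_image_prod bounded_image_divide bounded_image_inverse_mult
             bq bb ba bc bi q1 zq zq' b1 aaq) (use i in auto)
    then obtain C where C: "C > 0" "\<And>p. p \<in> S \<Longrightarrow> norm (G (fst p) (snd p)) \<le> C"
      by (rule bounded_imageE) blast
    have bd: "norm (D ^ m * q ^ (k * (m * Suc m div 2)) * G N m) \<le> norm D ^ m * norm q ^ (k * (m * Suc m div 2)) * C" if "N \<ge> N0" "m \<le> N" for N m
      unfolding norm_mult norm_power using C(2)[of "(N, m)"] that by (intro mult_left_mono) (auto simp: S_def)
    have sm: "summable (\<lambda>m. norm D ^ m * norm q ^ (k * (m * Suc m div 2)) * C)"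
      using q rs by (intro summable_mult2 summable_power_tri) auto
    note T = tannery_triangle[OF lim0 bd sm]
    have "(\<Sum>m<Suc N. conn_rhs r s a b q z N i m) = (\<Sum>m<Suc N. D ^ m * q ^ (k * (m * Suc m div 2)) * G N m)" for N
      by (intro sum.cong) (auto simp: eq)
    then have l1: "(\<lambda>N. \<Sum>m<Suc N. conn_rhs r s a b q z N i m) \<longlonglongrightarrow> (\<Sum>m. D ^ m * q ^ (k * (m * Suc m div 2)) * H m)"
      using T(1) C by simp
    define K where "K = conn_const r s a b q i * (jprod q (a i * z) / jprod q z)"
    have summ: "summable (\<lambda>m. conn_ser r s a b q i m * D ^ m * q ^ (k * (m * Suc m div 2)))"
    proof -
      obtain C where C: "C > 0" "\<And>m. norm (conn_ser r s a b q i m) \<le> C"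
        using conn_ser_bounded[where a = a and r = r and s = s and b = b, OF q a0 aa i] by blast
      show ?thesis
      proof (rule summable_comparison_test')
        show "summable (\<lambda>m. C * (norm D ^ m * norm q ^ (k * (m * Suc m div 2))))"
          using q rs by (intro summable_mult summable_power_tri) auto
        show "norm (conn_ser r s a b q i m * D ^ m * q ^ (k * (m * Suc m div 2))) \<le> C * (norm D ^ m * norm q ^ (k * (m * Suc m div 2)))" for m
          unfolding norm_mult norm_power mult.assoc using C(2)[of m] by (intro mult_right_mono) auto
      qed
    qed
    have "(\<Sum>m. D ^ m * q ^ (k * (m * Suc m div 2)) * H m) = (\<Sum>m. K * (conn_ser r s a b q i m * D ^ m * q ^ (k * (m * Suc m div 2))))"
      unfolding H K_def by (simp add: mult_ac)
    also have "\<dots> = K * (\<Sum>m. conn_ser r s a b q i m * D ^ m * q ^ (k * (m * Suc m div 2)))"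
      using summ by (rule suminf_mult)
    finally show ?thesis using l1 by (simp add: D_def K_def)
  qed

  have "eventually (\<lambda>N. (\<Sum>n<Suc N. conn_lhs r s a b q z N n) =
       conn_rem r s a b q z N + (\<Sum>i<r. \<Sum>m<Suc N. conn_rhs r s a b q z N i m)) sequentially"
    using eventually_ge_at_top[of N0]
  proof eventually_elim
    case (elim N)
    show ?case
    proof (rule finite_connection[where a = a and r = r and s = s and b = b, OF q a0 aa b1 z(1,3)])
      show "a i * q ^ Suc N * q ^ j \<noteq> 1" if "i < r" for i j
      proof -
        have "norm (a i * q ^ Suc N * q ^ j) \<le> norm (a i * q ^ Suc N)" by (rule qle')
        also have "\<dots> < 1" using N0[OF elim that] q by linarith
        finally show ?thesis by auto
      qed
    qed (use rs in auto)
  qed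
  from tendsto_cong[OF this] L have "(\<lambda>N. conn_rem r s a b q z N + (\<Sum>i<r. \<Sum>m<Suc N. conn_rhs r s a b q z N i m)) \<longlonglongrightarrow>
     (\<Sum>n. (\<Prod>i<r. qpoch (a i) q n) / ((\<Prod>l<s. qpoch (b l) q n) * qpoch q q n) * z ^ n)" by simp
  moreover have "(\<lambda>N. conn_rem r s a b q z N + (\<Sum>i<r. \<Sum>m<Suc N. conn_rhs r s a b q z N i m)) \<longlonglongrightarrow>
      0 + (\<Sum>i<r. conn_const r s a b q i * (jprod q (a i * z) / jprod q z) *
        (\<Sum>m. conn_ser r s a b q i m * (conn_arg r s a b q i / z) ^ m * q ^ (k * (m * Suc m div 2))))"
    by (intro tendsto_add Rm tendsto_sum R) auto
  ultimately show ?thesis using LIMSEQ_unique by fastforce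
qed

section \<open>The Jacobi triple product\<close>

text \<open>Induction on \<open>N\<close>: splitting off the last factor
  \<open>1 + x * q ^ N\<close> corresponds to the q-Pascal rule \<open>BS\<close>.\<close>

lemma qbinomial_theorem:
  fixes q x :: complex
  assumes "q \<noteq> 0" "norm q < 1"
  shows "qpoch (- x) q N = (\<Sum>n\<le>N. qpoch q q N / (qpoch q q n * qpoch q q (N - n)) * q ^ (n * (n - 1) div 2) * x ^ n)"
proof -
  \<comment> \<open>Setting the Gaussian binomial coefficient to 0 for \<open>n > N\<close> makes
    the q-Pascal rule hold at \<open>n = N\<close> as well.\<close>
  define B where "B N n = (if n \<le> N then qpoch q q N / (qpoch q q n * qpoch q q (N - n)) else 0)" for N n
  have nz: "qpoch q q n \<noteq> 0" for n
    using qpow_neq_1[OF assms] by (auto simp: qpoch_eq_0_iff)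
  have nz1: "1 - q * q ^ n \<noteq> 0" for n using qpow_neq_1[OF assms, of n] by auto
  have B0: "B N 0 = 1" for N using nz by (simp add: B_def)
  have BS: "B (Suc N) (Suc n) = B N (Suc n) + q ^ (N - n) * B N n" if le: "n \<le> N" for N n
  proof (cases "n = N")
    case True
    then show ?thesis using nz by (simp add: B_def)
  next
    case False
    then obtain d where d: "N = Suc (n + d)" using le False less_iff_Suc_add[of n N] by auto
    have "1 - q * q ^ N = (1 - q * q ^ d) + q * q ^ d * (1 - q * q ^ n)"
      by (simp add: d power_add algebra_simps)
    moreover have "N - n = Suc d" "N - Suc n = d" "Suc N - Suc n = Suc d" using d by auto
    ultimately show ?thesis
      unfolding B_def using d nz[of n] nz[of d] nz1[of n] nz1[of d]
      by (simp add: qpoch_Suc divide_simps) (simp add: algebra_simps power_add)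
  qed
  have "qpoch (- x) q N = (\<Sum>n\<le>N. B N n * q ^ (n * (n - 1) div 2) * x ^ n)"
  proof (induction N)
    case 0
    then show ?case by (simp add: B_def)
  next
    case (Suc N)
    have e: "Suc n * n div 2 = n * (n - 1) div 2 + n" for n
      using tri_Suc[of "n - 1"] by (cases n) (simp_all add: mult.commute)
    have "(\<Sum>n\<le>Suc N. B (Suc N) n * q ^ (n * (n - 1) div 2) * x ^ n) =
        1 + (\<Sum>n\<le>N. B (Suc N) (Suc n) * q ^ (n * (n - 1) div 2 + n) * x ^ Suc n)"
      by (subst sum.atMost_Suc_shift) (simp add: B0 e del: power_Suc mult_Suc mult_Suc_right)
    also have "(\<Sum>n\<le>N. B (Suc N) (Suc n) * q ^ (n * (n - 1) div 2 + n) * x ^ Suc n) =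
        (\<Sum>n\<le>N. B N (Suc n) * q ^ (n * (n - 1) div 2 + n) * x ^ Suc n + x * q ^ N * (B N n * q ^ (n * (n - 1) div 2) * x ^ n))"
    proof (rule sum.cong)
      fix n assume "n \<in> {..N}"
      then have "n \<le> N" by simp
      then have qn: "q ^ (N - n) * q ^ n = q ^ N" by (metis le_add_diff_inverse2 power_add)
      show "B (Suc N) (Suc n) * q ^ (n * (n - 1) div 2 + n) * x ^ Suc n =
        B N (Suc n) * q ^ (n * (n - 1) div 2 + n) * x ^ Suc n + x * q ^ N * (B N n * q ^ (n * (n - 1) div 2) * x ^ n)"
        unfolding BS[OF \<open>n \<le> N\<close>] qn[symmetric] by (simp add: power_add algebra_simps)
    qed simp
    also have "\<dots> = (\<Sum>n\<le>N. B N (Suc n) * q ^ (n * (n - 1) div 2 + n) * x ^ Suc n) + x * q ^ N * qpoch (- x) q N"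
      by (simp add: sum.distrib Suc.IH sum_distrib_left)
    also have "1 + \<dots> = (1 + (\<Sum>n\<le>N. B N (Suc n) * q ^ (n * (n - 1) div 2 + n) * x ^ Suc n)) + x * q ^ N * qpoch (- x) q N"
      by (rule add.assoc[symmetric])
    also have "1 + (\<Sum>n\<le>N. B N (Suc n) * q ^ (n * (n - 1) div 2 + n) * x ^ Suc n) = (\<Sum>n\<le>Suc N. B N n * q ^ (n * (n - 1) div 2) * x ^ n)"
      by (subst sum.atMost_Suc_shift) (simp add: B0 e del: power_Suc mult_Suc mult_Suc_right)
    also have "\<dots> = qpoch (- x) q N"
      by (simp add: Suc.IH B_def)
    finally show ?case by (simp add: qpoch_Suc algebra_simps)
  qed
  then show ?thesis by (simp add: B_def)
qed

text \<open>The q-binomial theorem with \<open>2 * M\<close> factors, recentred at its middle term: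
  the argument \<open>u / q ^ M\<close> puts \<open>M\<close> factors on either side, and the index
  becomes \<open>M + j\<close> or \<open>M - Suc j\<close>.\<close>

lemma jacobi_triple_finite:
  fixes q u :: complex
  assumes q: "q \<noteq> 0" "norm q < 1" and u: "u \<noteq> 0"
  shows "qpoch (- (q / u)) q M * qpoch (- u) q M =
    (\<Sum>j<Suc M. qpoch q q (2 * M) / (qpoch q q (M + j) * qpoch q q (M - j)) * (q ^ (j * (j - 1) div 2) * u ^ j)) +
    (\<Sum>j<M. qpoch q q (2 * M) / (qpoch q q (M - Suc j) * qpoch q q (M + Suc j)) * (q ^ (Suc j * Suc (Suc j) div 2) * (1 / u) ^ Suc j))"
proof -
  define c where "c n = qpoch q q (2 * M) / (qpoch q q n * qpoch q q (2 * M - n))" for n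
  \<comment> \<open>The inverse of the monomial released by reversing the first \<open>M\<close>
    factors of \<open>qpoch (- (u / q ^ M)) q (2 * M)\<close>.\<close>
  define T where "T = q ^ (M * Suc M div 2) / u ^ M"
  have T: "qpoch (- (q / u)) q M * qpoch (- u) q M = T * qpoch (- (u / q ^ M)) q (2 * M)"
    using qpoch_reverse_split[OF q(1), of "- u" M M] q u by (simp add: T_def mult_2)
  have "qpoch (- (u / q ^ M)) q (2 * M) = (\<Sum>n\<le>2 * M. c n * q ^ (n * (n - 1) div 2) * (u / q ^ M) ^ n)"
    unfolding c_def by (rule qbinomial_theorem[OF q])
  also have "{..2 * M} = {..<M} \<union> {M..2 * M}" by auto
  also have "(\<Sum>n\<in>{..<M} \<union> {M..2 * M}. c n * q ^ (n * (n - 1) div 2) * (u / q ^ M) ^ n) =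
     (\<Sum>n<M. c n * q ^ (n * (n - 1) div 2) * (u / q ^ M) ^ n) + (\<Sum>n\<in>{M..2 * M}. c n * q ^ (n * (n - 1) div 2) * (u / q ^ M) ^ n)"
    by (rule sum.union_disjoint) auto
  finally have "qpoch (- (q / u)) q M * qpoch (- u) q M =
     (\<Sum>n<M. T * (c n * q ^ (n * (n - 1) div 2) * (u / q ^ M) ^ n)) + (\<Sum>n\<in>{M..2 * M}. T * (c n * q ^ (n * (n - 1) div 2) * (u / q ^ M) ^ n))"
    unfolding T by (simp add: distrib_left sum_distrib_left)
  also have "(\<Sum>n<M. T * (c n * q ^ (n * (n - 1) div 2) * (u / q ^ M) ^ n)) =
     (\<Sum>j<M. qpoch q q (2 * M) / (qpoch q q (M - Suc j) * qpoch q q (M + Suc j)) * (q ^ (Suc j * Suc (Suc j) div 2) * (1 / u) ^ Suc j))"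
  proof (rule sum.reindex_bij_witness[of _ "\<lambda>j. M - Suc j" "\<lambda>j. M - Suc j"], goal_cases)
    case (5 n)
    define j where "j = M - Suc n"
    have M: "M = n + Suc j" using 5 by (auto simp: j_def)
    have "even (n * (n - 1))" "even (M * Suc M)" "even (Suc j * Suc (Suc j))" by (cases n; simp)+
    then have "2 * (M * Suc M div 2 + n * (n - 1) div 2) = M * Suc M + n * (n - 1)"
      "2 * (Suc j * Suc (Suc j) div 2 + M * n) = Suc j * Suc (Suc j) + 2 * (M * n)" by auto
    moreover have "M * Suc M + n * (n - 1) = Suc j * Suc (Suc j) + 2 * (M * n)"
      unfolding M by (cases n) (simp_all add: algebra_simps)
    ultimately have "M * Suc M div 2 + n * (n - 1) div 2 = Suc j * Suc (Suc j) div 2 + M * n" by (metis mult_left_cancel zero_neq_numeral)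
    then have e: "q ^ (M * Suc M div 2) * q ^ (n * (n - 1) div 2) = q ^ (Suc j * Suc (Suc j) div 2) * (q ^ M) ^ n"
      by (metis power_add power_mult)
    have "u ^ M = u ^ n * u ^ Suc j" unfolding M by (rule power_add)
    moreover have "M - Suc j = n" "M + Suc j = 2 * M - n" "M - Suc n = j" using M by auto
    ultimately show ?case
      using e u q by (simp add: T_def c_def power_divide power_one_over del: power_Suc) (simp add: divide_simps del: power_Suc)
  qed auto
  also have "(\<Sum>n\<in>{M..2 * M}. T * (c n * q ^ (n * (n - 1) div 2) * (u / q ^ M) ^ n)) =
     (\<Sum>j<Suc M. qpoch q q (2 * M) / (qpoch q q (M + j) * qpoch q q (M - j)) * (q ^ (j * (j - 1) div 2) * u ^ j))"
  proof (rule sum.reindex_bij_witness[of _ "\<lambda>j. M + j" "\<lambda>n. n - M"], goal_cases)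
    case (5 n)
    define j where "j = n - M"
    have n: "n = M + j" using 5 by (auto simp: j_def)
    have "even (n * (n - 1))" "even (M * Suc M)" "even (j * (j - 1))" by (cases n; cases j; simp)+
    then have "2 * (M * Suc M div 2 + n * (n - 1) div 2) = M * Suc M + n * (n - 1)"
      "2 * (j * (j - 1) div 2 + M * n) = j * (j - 1) + 2 * (M * n)" by auto
    moreover have "M * Suc M + n * (n - 1) = j * (j - 1) + 2 * (M * n)"
      unfolding n by (cases j; cases M) (simp_all add: algebra_simps)
    ultimately have "M * Suc M div 2 + n * (n - 1) div 2 = j * (j - 1) div 2 + M * n" by (metis mult_left_cancel zero_neq_numeral)
    then have e: "q ^ (M * Suc M div 2) * q ^ (n * (n - 1) div 2) = q ^ (j * (j - 1) div 2) * (q ^ M) ^ n"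
      by (metis power_add power_mult)
    have "u ^ n = u ^ M * u ^ j" unfolding n by (rule power_add)
    moreover have "2 * M - n = M - j" "M + j = n" using n by auto
    ultimately show ?case
      using e u q unfolding j_def[symmetric] by (simp add: T_def c_def power_divide) (simp add: divide_simps)
  qed auto
  finally show ?thesis by (simp only: add.commute)
qed

lemma theta_summable:
  fixes q u :: complex
  assumes q: "q \<noteq> 0" "norm q < 1"
  shows "summable (\<lambda>j. norm (q ^ (j * (j - 1) div 2) * u ^ j))"
    "summable (\<lambda>j. norm (q ^ (Suc j * Suc (Suc j) div 2) * (1 / u) ^ Suc j))"
proof -
  have "summable (\<lambda>j. norm u * (norm u ^ j * norm q ^ (1 * (j * Suc j div 2))))"
    using q by (intro summable_mult summable_power_tri) auto
  then have "summable (\<lambda>j. norm (q ^ (Suc j * (Suc j - 1) div 2) * u ^ Suc j))"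
    by (rule summable_cong[THEN iffD1, rotated]) (auto simp: norm_mult norm_power mult_ac)
  then show "summable (\<lambda>j. norm (q ^ (j * (j - 1) div 2) * u ^ j))"
    using summable_Suc_iff[of "\<lambda>j. norm (q ^ (j * (j - 1) div 2) * u ^ j)"] by simp
  have "summable (\<lambda>j. norm (1 / u) ^ j * norm q ^ (1 * (j * Suc j div 2)))"
    using q by (intro summable_power_tri) auto
  then have "summable (\<lambda>j. norm (q ^ (j * Suc j div 2) * (1 / u) ^ j))"
    by (rule summable_cong[THEN iffD1, rotated]) (auto simp: norm_mult norm_power norm_divide mult_ac)
  then show "summable (\<lambda>j. norm (q ^ (Suc j * Suc (Suc j) div 2) * (1 / u) ^ Suc j))"
    by (subst (asm) summable_Suc_iff[symmetric]) simp
qed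

text \<open>The Gaussian binomial coefficients around the middle are uniformly bounded and tend to
  \<open>1 / qinf q q\<close>, while the remaining factors are summable; so the finite identity
  passes to the limit termwise.\<close>

lemma jacobi_triple_series:
  fixes q u :: complex
  assumes q: "q \<noteq> 0" "norm q < 1" and u: "u \<noteq> 0"
  shows "qinf q q * jprod q (- u) =
    (\<Sum>j. q ^ (j * (j - 1) div 2) * u ^ j) + (\<Sum>j. q ^ (Suc j * Suc (Suc j) div 2) * (1 / u) ^ Suc j)"
proof -
  have q1: "\<And>j. q * q ^ j \<noteq> 1" by (rule qpow_neq_1[OF q])
  then have nz: "qinf q q \<noteq> 0" "\<And>n. qpoch q q n \<noteq> 0" using q by (auto simp: qinf_eq_0_iff qpoch_eq_0_iff)
  obtain C where C: "C > 0" "\<And>x. norm (qpoch q q (fst x) / (qpoch q q (fst (snd x)) * qpoch q q (snd (snd x)))) \<le> C"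
  proof (rule bounded_imageE)
    show "bounded ((\<lambda>x. qpoch q q (fst x) / (qpoch q q (fst (snd x)) * qpoch q q (snd (snd x)))) ` UNIV)"
      by (intro bounded_image_divide bounded_image_inverse_mult bounded_image_qpoch[of _ _ _ "norm q"] bounded_image_inverse_qpoch q q1) auto
  qed (use that in blast)
  note C' = C(2)[of "(a, b, c)" for a b c, simplified fst_conv snd_conv]
  have f2: "filterlim (\<lambda>M::nat. 2 * M) at_top sequentially"
    by (rule filterlim_subseq) (auto simp: strict_mono_def)
  have fp: "filterlim (\<lambda>M::nat. M + j) at_top sequentially" for j by (rule filterlim_add_const_nat_at_top)
  have fm: "filterlim (\<lambda>M::nat. M - j) at_top sequentially" for j by (rule filterlim_minus_const_nat_at_top)
  have A: "(\<lambda>M. \<Sum>j<Suc M. qpoch q q (2 * M) / (qpoch q q (M + j) * qpoch q q (M - j)) * (q ^ (j * (j - 1) div 2) * u ^ j))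
     \<longlonglongrightarrow> (\<Sum>j. qinf q q / (qinf q q * qinf q q) * (q ^ (j * (j - 1) div 2) * u ^ j))"
  proof (rule tannery_triangle(1))
    show "(\<lambda>M. qpoch q q (2 * M) / (qpoch q q (M + j) * qpoch q q (M - j)) * (q ^ (j * (j - 1) div 2) * u ^ j))
     \<longlonglongrightarrow> qinf q q / (qinf q q * qinf q q) * (q ^ (j * (j - 1) div 2) * u ^ j)" for j
      by (intro tendsto_mult tendsto_divide tendsto_const f2 fp fm [THEN qpoch_filterlim_qinf[OF q(2)]]
          f2[THEN qpoch_filterlim_qinf[OF q(2)]] fp[THEN qpoch_filterlim_qinf[OF q(2)]]) (use nz in auto)
    show "summable (\<lambda>j. C * norm (q ^ (j * (j - 1) div 2) * u ^ j))"
      by (intro summable_mult theta_summable q)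
    show "norm (qpoch q q (2 * M) / (qpoch q q (M + j) * qpoch q q (M - j)) * (q ^ (j * (j - 1) div 2) * u ^ j))
      \<le> C * norm (q ^ (j * (j - 1) div 2) * u ^ j)" for M j
      unfolding norm_mult[of "_ / _"] by (intro mult_right_mono C') auto
  qed (use C in auto)
  \<comment> \<open>The sum over negative powers runs over \<open>j < M\<close> only. Replacing
    \<open>M\<close> by \<open>Suc M\<close> gives it the length that
    \<open>tannery_triangle\<close> expects.\<close>
  have B: "(\<lambda>M. \<Sum>j<Suc M. qpoch q q (2 * Suc M) / (qpoch q q (Suc M - Suc j) * qpoch q q (Suc M + Suc j)) * (q ^ (Suc j * Suc (Suc j) div 2) * (1 / u) ^ Suc j))
     \<longlonglongrightarrow> (\<Sum>j. qinf q q / (qinf q q * qinf q q) * (q ^ (Suc j * Suc (Suc j) div 2) * (1 / u) ^ Suc j))"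
  proof (rule tannery_triangle(1))
    show "(\<lambda>M. qpoch q q (2 * Suc M) / (qpoch q q (Suc M - Suc j) * qpoch q q (Suc M + Suc j)) * (q ^ (Suc j * Suc (Suc j) div 2) * (1 / u) ^ Suc j))
     \<longlonglongrightarrow> qinf q q / (qinf q q * qinf q q) * (q ^ (Suc j * Suc (Suc j) div 2) * (1 / u) ^ Suc j)" for j
      by (intro tendsto_mult tendsto_divide tendsto_const fm[THEN filterlim_compose, OF filterlim_Suc, THEN qpoch_filterlim_qinf[OF q(2)]]
          f2[THEN filterlim_compose, OF filterlim_Suc, THEN qpoch_filterlim_qinf[OF q(2)]]
          fp[THEN filterlim_compose, OF filterlim_Suc, THEN qpoch_filterlim_qinf[OF q(2)]]) (use nz in auto)
    show "summable (\<lambda>j. C * norm (q ^ (Suc j * Suc (Suc j) div 2) * (1 / u) ^ Suc j))"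
      by (intro summable_mult theta_summable q)
    show "norm (qpoch q q (2 * Suc M) / (qpoch q q (Suc M - Suc j) * qpoch q q (Suc M + Suc j)) * (q ^ (Suc j * Suc (Suc j) div 2) * (1 / u) ^ Suc j))
      \<le> C * norm (q ^ (Suc j * Suc (Suc j) div 2) * (1 / u) ^ Suc j)" for M j
      unfolding norm_mult[of "_ / _"] by (intro mult_right_mono C') auto
  qed (use C in auto)
  have "(\<lambda>M. qpoch (- (q / u)) q (Suc M) * qpoch (- u) q (Suc M)) \<longlonglongrightarrow>
     (\<Sum>j. qinf q q / (qinf q q * qinf q q) * (q ^ (j * (j - 1) div 2) * u ^ j)) +
     (\<Sum>j. qinf q q / (qinf q q * qinf q q) * (q ^ (Suc j * Suc (Suc j) div 2) * (1 / u) ^ Suc j))"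
    unfolding jacobi_triple_finite[OF q u]
    by (intro tendsto_add B filterlim_compose[OF A filterlim_Suc])
  moreover have "(\<lambda>M. qpoch (- (q / u)) q (Suc M) * qpoch (- u) q (Suc M)) \<longlonglongrightarrow> qinf (- (q / u)) q * qinf (- u) q"
    by (intro tendsto_mult qpoch_filterlim_qinf q filterlim_Suc)
  ultimately have "qinf (- (q / u)) q * qinf (- u) q = (\<Sum>j. qinf q q / (qinf q q * qinf q q) * (q ^ (j * (j - 1) div 2) * u ^ j)) +
     (\<Sum>j. qinf q q / (qinf q q * qinf q q) * (q ^ (Suc j * Suc (Suc j) div 2) * (1 / u) ^ Suc j))"
    using LIMSEQ_unique by blast
  also have "\<dots> = qinf q q / (qinf q q * qinf q q) * ((\<Sum>j. q ^ (j * (j - 1) div 2) * u ^ j) + (\<Sum>j. q ^ (Suc j * Suc (Suc j) div 2) * (1 / u) ^ Suc j))"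
    using suminf_mult[OF summable_norm_cancel[OF theta_summable(1)[OF q, of u]]]
      suminf_mult[OF summable_norm_cancel[OF theta_summable(2)[OF q, of u]]]
    by (simp only: distrib_left)
  finally show ?thesis using nz by (simp add: jprod_def field_simps)
qed

text \<open>The integers split into \<open>j\<close> and \<open>- 1 - j\<close> with
  \<open>j\<close> natural, matching the two series of \<open>jacobi_triple_series\<close>. Absolute
  summability is recorded because the rearrangement of the Laplace sum depends on it.\<close>

lemma qtheta_has_sum:
  fixes q u :: complex
  assumes q: "q \<noteq> 0" "norm q < 1" and u: "u \<noteq> 0"
  shows "(\<lambda>n::int. norm (q powi (n * (n - 1) div 2) * u powi n)) summable_on UNIV"
    "((\<lambda>n::int. q powi (n * (n - 1) div 2) * u powi n) has_sum (qinf q q * jprod q (- u))) UNIV"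
proof -
  let ?f = "\<lambda>n::int. q powi (n * (n - 1) div 2) * u powi n"
  have U: "(UNIV :: int set) = range int \<union> range (\<lambda>j. - 1 - int j)"
  proof -
    have "n \<in> range int \<union> range (\<lambda>j. - 1 - int j)" for n :: int
    proof (cases "n \<ge> 0")
      case True
      then show ?thesis by (auto intro!: image_eqI[of _ _ "nat n"])
    next
      case False
      then have "n = - 1 - int (nat (- 1 - n))" by simp
      then show ?thesis by blast
    qed
    then show ?thesis by blast
  qed
  have D: "range int \<inter> range (\<lambda>j. - 1 - int j) = {}" by auto
  have f1: "?f (int j) = q ^ (j * (j - 1) div 2) * u ^ j" for j
  proof -
    have "int j * (int j - 1) div 2 = int (j * (j - 1) div 2)"
      by (cases j) (simp_all add: zdiv_int algebra_simps)
    then show ?thesis by (simp only: power_int_of_nat)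
  qed
  have f2: "?f (- 1 - int j) = q ^ (Suc j * Suc (Suc j) div 2) * (1 / u) ^ Suc j" for j
  proof -
    have "(- 1 - int j) * (- 1 - int j - 1) div 2 = int (Suc j * Suc (Suc j) div 2)"
      by (simp add: zdiv_int algebra_simps)
    moreover have "u powi (- 1 - int j) = (1 / u) ^ Suc j"
    proof -
      have "u powi (- 1 - int j) = u powi (- int (Suc j))" by simp
      then show ?thesis by (simp only: power_int_minus power_int_of_nat) (simp add: power_one_over inverse_eq_divide)
    qed
    ultimately show ?thesis by (simp only: power_int_of_nat)
  qed
  have i1: "inj int" "inj (\<lambda>j. - 1 - int j)" by (auto simp: inj_on_def)
  have s1: "(\<lambda>j. norm (q ^ (j * (j - 1) div 2) * u ^ j)) summable_on UNIV"
    using norm_summable_imp_summable_on[of "\<lambda>j. norm (q ^ (j * (j - 1) div 2) * u ^ j)"] theta_summable(1)[OF q, of u] by simp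
  have s2: "(\<lambda>j. norm (q ^ (Suc j * Suc (Suc j) div 2) * (1 / u) ^ Suc j)) summable_on UNIV"
    using norm_summable_imp_summable_on[of "\<lambda>j. norm (q ^ (Suc j * Suc (Suc j) div 2) * (1 / u) ^ Suc j)"] theta_summable(2)[OF q, of u] by (simp del: power_Suc)
  have "(\<lambda>n. norm (?f n)) summable_on (range int)"
    using summable_on_reindex[OF i1(1), of "\<lambda>n. norm (?f n)"] s1 unfolding o_def f1 by simp
  moreover have "(\<lambda>n. norm (?f n)) summable_on (range (\<lambda>j. - 1 - int j))"
    using summable_on_reindex[OF i1(2), of "\<lambda>n. norm (?f n)"] s2 unfolding o_def f2 by simp
  ultimately show "(\<lambda>n. norm (?f n)) summable_on UNIV"
    unfolding U using summable_on_Un_disjoint[OF _ _ D] by blast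
  have "(?f has_sum (\<Sum>j. q ^ (j * (j - 1) div 2) * u ^ j)) (range int)"
    using has_sum_reindex[OF i1(1), of ?f] norm_summable_imp_has_sum[OF theta_summable(1)[OF q, of u] summable_sums[OF summable_norm_cancel[OF theta_summable(1)[OF q, of u]]]]
    unfolding o_def f1 by simp
  moreover have "(?f has_sum (\<Sum>j. q ^ (Suc j * Suc (Suc j) div 2) * (1 / u) ^ Suc j)) (range (\<lambda>j. - 1 - int j))"
    using has_sum_reindex[OF i1(2), of ?f] norm_summable_imp_has_sum[OF theta_summable(2)[OF q, of u] summable_sums[OF summable_norm_cancel[OF theta_summable(2)[OF q, of u]]]]
    unfolding o_def f2 by blast
  ultimately show "(?f has_sum (qinf q q * jprod q (- u))) UNIV"
    unfolding U jacobi_triple_series[OF q u] by (rule has_sum_Un_disjoint[OF _ _ D])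
qed

lemma jacobi_triple_product:
  assumes "q \<noteq> 0" "norm q < 1" "u \<noteq> 0"
  shows "qtheta q u = qinf q q * jprod q (- u)"
  unfolding qtheta_def using qtheta_has_sum(2)[OF assms] by (rule infsumI)

section \<open>Quasi-periodicity of theta functions along spirals\<close>

lemma jprod_qpow_nat:
  assumes "norm q < 1" "q \<noteq> 0" "y \<noteq> 0"
  shows "jprod q (q ^ n * y) * (- y) ^ n * q ^ (n * (n - 1) div 2) = jprod q y"
proof (induction n)
  case (Suc n)
  have e: "Suc n * (Suc n - 1) div 2 = n * (n - 1) div 2 + n"
    using tri_Suc[of "n - 1"] by (cases n) (simp_all add: mult.commute)
  have "jprod q (q ^ Suc n * y) = - jprod q (q ^ n * y) / (q ^ n * y)"
    using jprod_mult[of q "q ^ n * y"] assms by (simp add: mult.assoc)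
  then have "jprod q (q ^ Suc n * y) * (- y) ^ Suc n * q ^ (n * (n - 1) div 2 + n) =
      jprod q (q ^ n * y) * (- y) ^ n * q ^ (n * (n - 1) div 2)"
    using assms by (simp add: power_add)
  then show ?case unfolding e using Suc.IH by simp
qed simp

text \<open>For a negative exponent \<open>- m\<close> the formula for naturals is applied at
  \<open>w = y / q ^ m\<close>, whose \<open>m\<close>-th shift is \<open>y\<close>.\<close>

lemma jprod_qpow:
  fixes n :: int
  assumes "norm q < 1" "q \<noteq> 0" "y \<noteq> 0"
  shows "jprod q (q powi n * y) * (- y) powi n * q powi (n * (n - 1) div 2) = jprod q y"
proof (cases "n \<ge> 0")
  case True
  then obtain m where m: "n = int m" by (metis nonneg_int_cases)
  have e: "int m * (int m - 1) div 2 = int (m * (m - 1) div 2)"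
    by (cases m) (simp_all add: zdiv_int algebra_simps)
  show ?thesis unfolding m e power_int_of_nat by (rule jprod_qpow_nat[OF assms])
next
  case False
  then obtain m where m: "n = - int m" by (metis nat_le_linear int_cases2 nonneg_int_cases of_nat_0_le_iff)
  define w where "w = y / q ^ m"
  have w: "w \<noteq> 0" "y = q ^ m * w" using assms by (auto simp: w_def)
  have e: "- int m * (- int m - 1) div 2 = int (m * Suc m div 2)"
    by (simp add: zdiv_int algebra_simps)
  have "m * m = m * Suc m div 2 + m * (m - 1) div 2"
  proof -
    have "even (m * Suc m)" "even (m * (m - 1))" by (cases m; simp)+
    then have "2 * (m * Suc m div 2 + m * (m - 1) div 2) = m * Suc m + m * (m - 1)" by auto
    also have "\<dots> = 2 * (m * m)" by (cases m) simp_all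
    finally show ?thesis by simp
  qed
  then have qm: "(q ^ m) ^ m = q ^ (m * Suc m div 2) * q ^ (m * (m - 1) div 2)"
    by (metis power_add power_mult)
  have qw: "q powi n * y = w" using assms by (simp add: m w power_int_minus)
  have yn: "(- y) powi n = 1 / ((- w) ^ m * (q ^ m) ^ m)"
  proof -
    have "(- y) ^ m = (- w) ^ m * (q ^ m) ^ m" unfolding w power_mult_distrib[symmetric] by (simp add: mult.commute)
    then show ?thesis by (simp add: m power_int_minus inverse_eq_divide)
  qed
  have "jprod q y = jprod q w * (1 / ((- w) ^ m * (q ^ m) ^ m)) * q ^ (m * Suc m div 2)"
    using jprod_qpow_nat[OF assms(1,2) w(1), of m, folded w(2)] unfolding qm using w assms by (simp add: field_simps)
  then show ?thesis unfolding qw yn unfolding m e power_int_of_nat by simp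
qed

lemma qtheta_qpow:
  fixes n :: int
  assumes "norm q < 1" "q \<noteq> 0" "y \<noteq> 0"
  shows "qtheta q (y * q powi n) * y powi n * q powi (n * (n - 1) div 2) = qtheta q y"
  using jprod_qpow[of q "- y" n] assms
  by (simp add: jacobi_triple_product mult_ac)

text \<open>Numerator and denominator acquire the same Gaussian factor, so only the pure power of
  \<open>a\<close> remains.\<close>

lemma jprod_ratio_qpow:
  fixes n :: int
  assumes "norm q < 1" "q \<noteq> 0" "y \<noteq> 0" "a \<noteq> 0"
  shows "jprod q (a * (y * q powi n)) / jprod q (y * q powi n) = a powi (- n) * (jprod q (a * y) / jprod q y)"
proof -
  define T where "T = (- y) powi n * q powi (n * (n - 1) div 2)"
  have T: "T \<noteq> 0" using assms by (simp add: T_def)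
  have 1: "jprod q y = jprod q (y * q powi n) * T"
    using jprod_qpow[OF assms(1-3), of n] by (simp add: T_def mult_ac)
  have "(- (a * y)) powi n = a powi n * (- y) powi n"
    using power_int_mult_distrib[of a "- y" n] by simp
  then have 2: "jprod q (a * y) = jprod q (a * (y * q powi n)) * (a powi n * T)"
    using jprod_qpow[OF assms(1,2), of "a * y" n] assms by (simp add: T_def mult_ac)
  show ?thesis unfolding 1 2 using T assms by (simp add: power_int_minus)
qed

section \<open>The Borel-Laplace sum in closed form\<close>

lemma has_sum_sum_finite:
  fixes f :: "'i \<Rightarrow> 'a \<Rightarrow> complex"
  assumes "\<And>i. i \<in> I \<Longrightarrow> (f i has_sum S i) A"
  shows "((\<lambda>x. \<Sum>i\<in>I. f i x) has_sum (\<Sum>i\<in>I. S i)) A"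
  using assms
proof (induction I rule: infinite_finite_induct)
  case (insert i I)
  then show ?case by (simp add: has_sum_add)
qed simp_all

text \<open>The substitution \<open>n = j + m\<close> turns the double series of the Laplace transform into a product.\<close>

lemma theta_convolution:
  fixes c :: "nat \<Rightarrow> complex" and p u v :: complex
  assumes p: "p \<noteq> 0" "norm p < 1" and u: "u \<noteq> 0"
    and c: "summable (\<lambda>m. norm (c m * (u * v) ^ m))"
  shows "((\<lambda>n::int. \<Sum>m. c m * v ^ m * p powi ((n - int m) * (n - int m - 1) div 2) * u powi n) has_sum
           (\<Sum>m. c m * (u * v) ^ m) * qtheta p u) UNIV"
proof -
  let ?t = "\<lambda>j::int. p powi (j * (j - 1) div 2) * u powi j"
  let ?S = "\<lambda>m. c m * (u * v) ^ m"
  have tsum: "(\<lambda>j. norm (?t j)) summable_on UNIV" "(?t has_sum qtheta p u) UNIV"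
    using qtheta_has_sum[OF p u] by (simp_all add: jacobi_triple_product[OF p u])
  have Ssum: "(?S has_sum suminf ?S) UNIV"
    by (rule norm_summable_imp_has_sum[OF c summable_sums[OF summable_norm_cancel[OF c]]])
  have Snorm: "(\<lambda>m. norm (?S m)) summable_on UNIV"
    using norm_summable_imp_summable_on[of "\<lambda>m. norm (?S m)"] c by simp
  \<comment> \<open>Absolute summability of the product family justifies both the product form of
    its sum and the shear \<open>(j, m) \<rightarrow> (j + m, m)\<close>.\<close>
  have "(\<lambda>(j, m). norm (?t j) * norm (?S m)) summable_on (UNIV \<times> UNIV)"
  proof (rule summable_on_SigmaI)
    show "((\<lambda>m. case (j, m) of (j, m) \<Rightarrow> norm (?t j) * norm (?S m)) has_sum norm (?t j) * infsum (\<lambda>m. norm (?S m)) UNIV) UNIV" for j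
      using has_sum_cmult_right[OF has_sum_infsum[OF Snorm], of "norm (?t j)"] by simp
    show "(\<lambda>j. norm (?t j) * infsum (\<lambda>m. norm (?S m)) UNIV) summable_on UNIV"
      by (rule summable_on_cmult_left[OF tsum(1)])
  qed auto
  then have "(\<lambda>x. norm ((\<lambda>(j, m). ?t j * ?S m) x)) summable_on (UNIV \<times> UNIV)"
    by (simp add: case_prod_unfold norm_mult)
  then have "(\<lambda>(j, m). ?t j * ?S m) summable_on (UNIV \<times> UNIV)"
    by (rule abs_summable_summable)
  then have P: "((\<lambda>(j, m). ?t j * ?S m) has_sum (qtheta p u * suminf ?S)) (UNIV \<times> UNIV)"
    using has_sum_cmult_right[OF Ssum] has_sum_cmult_left[OF tsum(2)]
    by (intro has_sum_SigmaI[where g = "\<lambda>j. ?t j * suminf ?S"]) auto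
  have "((\<lambda>(n, m). ?t (n - int m) * ?S m) has_sum (qtheta p u * suminf ?S)) (UNIV \<times> UNIV)"
    using P by (subst has_sum_reindex_bij_witness[of _ "\<lambda>(j, m). (j + int m, m)" "\<lambda>(n, m). (n - int m, m)" "UNIV \<times> UNIV" "\<lambda>(j, m). ?t j * ?S m"]) auto
  then have "((\<lambda>n. \<Sum>m. ?t (n - int m) * ?S m) has_sum (qtheta p u * suminf ?S)) UNIV"
  proof (rule has_sum_SigmaD)
    fix n :: int
    \<comment> \<open>Within one row the theta terms need only be bounded, since the coefficients
      \<open>?S m\<close> are summable by themselves.\<close>
    have bt: "bounded (range ?t)"
    proof -
      have "norm (?t j) \<le> infsum (\<lambda>j. norm (?t j)) UNIV" for j
        using infsum_mono_neutral[of "\<lambda>j. norm (?t j)" "{j}" "\<lambda>j. norm (?t j)" UNIV] tsum(1) by simp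
      then show ?thesis by (auto simp: bounded_iff)
    qed
    then obtain C where C: "C > 0" "\<And>j. norm (?t j) \<le> C" by (auto elim: bounded_imageE)
    have "summable (\<lambda>m. norm (?t (n - int m) * ?S m))"
    proof (rule summable_comparison_test')
      show "summable (\<lambda>m. C * norm (?S m))" by (intro summable_mult c)
      have "norm (?t (n - int m) * ?S m) \<le> C * norm (?S m)" for m
        unfolding norm_mult[of "?t (n - int m)"] by (rule mult_right_mono[OF C(2)]) simp
      then show "norm (norm (?t (n - int m) * ?S m)) \<le> C * norm (?S m)" for m
        by (simp only: real_norm_def abs_norm_cancel)
    qed
    from norm_summable_imp_has_sum[OF this summable_sums[OF summable_norm_cancel[OF this]]]
    show "((\<lambda>m. case (n, m) of (n, m) \<Rightarrow> ?t (n - int m) * ?S m) has_sum (\<Sum>m. ?t (n - int m) * ?S m)) UNIV"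
      by simp
  qed
  moreover have "?t (n - int m) * ?S m = c m * v ^ m * p powi ((n - int m) * (n - int m - 1) div 2) * u powi n" for n m
  proof -
    have "u powi n = u powi (n - int m) * u ^ m"
      using u power_int_add[of u "n - int m" "int m"] by simp
    then show ?thesis by (simp add: power_mult_distrib mult_ac)
  qed
  ultimately have "((\<lambda>n. \<Sum>m. c m * v ^ m * p powi ((n - int m) * (n - int m - 1) div 2) * u powi n) has_sum
      (qtheta p u * suminf ?S)) UNIV" by (simp only:)
  then show ?thesis by (simp only: mult.commute[of "qtheta p u"])
qed

section \<open>Analytic continuation from the disc\<close>

lemma entire_series:
  fixes d :: "nat \<Rightarrow> complex"
  assumes "\<And>w. summable (\<lambda>m. d m * w ^ m)"
  shows "(\<lambda>w. \<Sum>m. d m * w ^ m) holomorphic_on A"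
proof -
  have "(\<lambda>w. \<Sum>m. d m * w ^ m) field_differentiable (at w)" for w
  proof -
    have "(\<lambda>w. \<Sum>m. d m * w ^ m) holomorphic_on ball 0 (norm w + 1)"
    proof (rule power_series_holomorphic)
      show "(\<lambda>n. d n * (x - 0) ^ n) sums (\<Sum>m. d m * x ^ m)" for x
        using summable_sums[OF assms[of x]] by simp
    qed
    then show ?thesis by (rule holomorphic_on_imp_differentiable_at) auto
  qed
  then show ?thesis by (auto simp: holomorphic_on_def intro: field_differentiable_at_within)
qed

lemma jprod_holomorphic [holomorphic_intros]:
  assumes "norm q < 1" "f holomorphic_on A" "\<And>x. x \<in> A \<Longrightarrow> f x \<noteq> 0"
  shows "(\<lambda>x. jprod q (f x)) holomorphic_on A"
  unfolding jprod_def using assms by (intro holomorphic_intros) auto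

text \<open>A single holomorphic \<open>h\<close> with the right values in the disc shows that the
  choice is not vacuous, and the identity theorem on the connected set \<open>S\<close> then forces
  the chosen function to be \<open>h\<close>.\<close>

lemma continue_from_disc_unique:
  assumes S: "open S" "connected S" "S \<inter> ball 0 1 \<noteq> {}"
    and h: "h holomorphic_on S" "\<And>\<xi>. \<xi> \<in> S \<Longrightarrow> norm \<xi> < 1 \<Longrightarrow> h \<xi> = g \<xi>"
    and "\<xi> \<in> S"
  shows "continue_from_disc S g \<xi> = h \<xi>"
proof -
  define f where "f = continue_from_disc S g"
  have f: "f holomorphic_on S \<and> (\<forall>\<xi>\<in>S. norm \<xi> < 1 \<longrightarrow> f \<xi> = g \<xi>)"
    unfolding f_def continue_from_disc_def
  proof (rule someI[of _ h], intro conjI ballI impI)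
    show "h \<xi> = g \<xi>" if "\<xi> \<in> S" "norm \<xi> < 1" for \<xi> using h(2) that by blast
  qed (rule h(1))
  show ?thesis
    unfolding f_def[symmetric]
  proof (rule analytic_continuation_open[of "S \<inter> ball 0 1" S f h])
    show "f z = h z" if "z \<in> S \<inter> ball 0 1" for z
      using that f h(2)[of z] by simp
  qed (use S f h(1) \<open>\<xi> \<in> S\<close> in auto)
qed

lemma qpochs_conv_prod: "qpochs as q n = (\<Prod>i<length as. qpoch (as ! i) q n)"
  unfolding qpochs_def by (subst prod.list_conv_set_nth) (auto intro!: prod.cong simp: atLeast0LessThan)

text \<open>The exponent \<open>1 + s - r\<close> is \<open>- k\<close>, so the Gaussian factor of
  the series is exactly the inverse of the one introduced by the Borel transform in base
  \<open>q ^ k\<close>. Only the sign \<open>(-1) ^ (k * n)\<close> is left over.\<close>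

lemma qborel_qhyp_phi_nth:
  assumes "q \<noteq> 0" "length as = length bs + 1 + k"
  shows "fps_nth (qborel (q ^ k) (qhyp_phi as bs q)) n =
    (\<Prod>i<length as. qpoch (as ! i) q n) / ((\<Prod>l<length bs. qpoch (bs ! l) q n) * qpoch q q n) * ((- 1) ^ k) ^ n"
proof -
  define t where "t = q ^ (n * (n - Suc 0) div 2)"
  have t: "t \<noteq> 0" using assms by (simp add: t_def)
  have e: "1 + int (length bs) - int (length as) = - int k" using assms by simp
  have "((- 1) ^ n * t) powi (- int k) * t ^ k = inverse (((- 1) ^ n) ^ k)"
    using t by (simp add: power_int_minus power_mult_distrib)
  also have "\<dots> = ((- 1) ^ k) ^ n"
    by (cases "even k"; cases "even n") simp_all
  finally have "((- 1) ^ n * t) powi (- int k) * t ^ k = ((- 1) ^ k) ^ n" .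
  moreover have "(q ^ k) ^ (n * (n - Suc 0) div 2) = t ^ k"
    by (simp add: t_def power_mult[symmetric] mult.commute)
  ultimately show ?thesis
    by (simp add: qborel_def qhyp_phi_def qpochs_conv_prod e t_def[symmetric])
qed

text \<open>The connection formula is inserted on the spiral of \<open>l\<close>, and each of its
  \<open>r\<close> terms is summed by \<open>theta_convolution\<close>. The sign
  \<open>(-1) ^ k\<close> turns \<open>l\<close> into the base point \<open>z0\<close> for the
  variable of the connection formula. \<open>E i\<close> must have norm below 1 because the Gaussian
  factor has gone into the theta function.\<close>

lemma rfs_closed_form:
  fixes as bs :: "complex list" and q l X :: complex and k :: nat
  defines "r \<equiv> length as" and "s \<equiv> length bs" and "z0 \<equiv> (- 1) ^ k * l"
  defines "E \<equiv> \<lambda>i. (- 1) ^ k * conn_arg r s (nth as) (nth bs) q i / (as ! i ^ k * X)"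
  assumes q: "q \<noteq> 0" "norm q < 1"
    and a0: "\<And>i. i < r \<Longrightarrow> as ! i \<noteq> 0"
    and aa: "\<And>i j n. i < r \<Longrightarrow> j < r \<Longrightarrow> i \<noteq> j \<Longrightarrow> as ! i / as ! j \<noteq> q powi n"
    and b0: "\<And>l. l < s \<Longrightarrow> bs ! l \<noteq> 0"
    and b1: "\<And>l j. l < s \<Longrightarrow> bs ! l * q ^ j \<noteq> 1"
    and rs: "r = s + 1 + k" "k \<ge> 1"
    and l: "l \<noteq> 0" "\<And>n. z0 \<noteq> q powi n" and X: "X \<noteq> 0"
    and E: "\<And>i. i < r \<Longrightarrow> norm (E i) < 1"
  shows "rfs as bs l q X =
    (\<Sum>i<r. conn_const r s (nth as) (nth bs) q i * (jprod q (as ! i * z0) / jprod q z0) *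
       (qtheta (q ^ k) (l / (as ! i ^ k * X)) / qtheta (q ^ k) (l / X)) *
       (\<Sum>m. conn_ser r s (nth as) (nth bs) q i m * E i ^ m))"
proof -
  define p where "p = q ^ k"
  define sg where "sg = (- 1 :: complex) ^ k"
  have sg: "sg * sg = 1" "sg \<noteq> 0" "norm sg = 1" "1 / sg = sg"
    by (simp_all add: sg_def norm_power power_mult_distrib[symmetric] power_one_over[symmetric])
  have p: "p \<noteq> 0" "norm p < 1"
    using q rs by (auto simp: p_def norm_power power_less_one_iff)
  define S where "S = - {0} - qspiral sg q"
  define gs where "gs = eval_fps (qborel p (qhyp_phi as bs q))"
  define D where "D i = conn_arg r s (nth as) (nth bs) q i" for i
  define cs where "cs i m = conn_ser r s (nth as) (nth bs) q i m" for i m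
  define K where "K i = conn_const r s (nth as) (nth bs) q i" for i
  \<comment> \<open>The candidate for the continuation: the right-hand side of the connection
    formula at \<open>z = sg * \<xi>\<close>.\<close>
  define h where "h \<xi> = (\<Sum>i<r. K i * (jprod q (as ! i * (sg * \<xi>)) / jprod q (sg * \<xi>)) *
        (\<Sum>m. cs i m * (D i / (sg * \<xi>)) ^ m * q ^ (k * (m * Suc m div 2))))" for \<xi>
  have S_iff: "\<xi> \<in> S \<longleftrightarrow> \<xi> \<noteq> 0 \<and> (\<forall>n. sg * \<xi> \<noteq> q powi n)" for \<xi>
  proof -
    have "\<xi> = sg * q powi n \<longleftrightarrow> sg * \<xi> = q powi n" for n
      using sg(1) by (metis mult.assoc mult_1)
    then show ?thesis by (auto simp: S_def qspiral_def)
  qed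
  \<comment> \<open>The spiral accumulates at 0, so it is not closed in the plane. Written as the
    nonvanishing set of \<open>jprod\<close> inside the punctured plane, \<open>S\<close> is visibly
    open; connectedness follows below because only countably many points are removed.\<close>
  have S_eq: "S = - {0} \<inter> (\<lambda>\<xi>. jprod q (sg * \<xi>)) -` (- {0})"
    using jprod_eq_0_iff[OF q(2,1)] sg by (auto simp: S_iff)
  have openS: "open S"
    unfolding S_eq using sg
    by (intro continuous_open_preimage holomorphic_on_imp_continuous_on jprod_holomorphic q holomorphic_intros) auto
  have S_compl: "S = - insert 0 (qspiral sg q)" by (auto simp: S_def)
  have cnt: "countable (insert 0 (qspiral sg q))" by (simp add: qspiral_def)
  have connS: "connected S"
    unfolding S_compl by (intro path_connected_imp_connected path_connected_complement_countable cnt) simp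
  have neS: "S \<inter> ball 0 1 \<noteq> {}"
  proof
    assume "S \<inter> ball 0 1 = {}"
    then have "ball 0 1 \<subseteq> insert 0 (qspiral sg q)" by (auto simp: S_compl)
    with cnt have "countable (ball (0::complex) 1)" by (rule countable_subset[rotated])
    with uncountable_ball[of 1 "0::complex"] show False by simp
  qed
  have cs_bd: "\<exists>C>0. \<forall>m. norm (cs i m) \<le> C" if i: "i < r" for i
  proof -
    obtain C where "C > 0" "\<And>m. norm (conn_ser r s (nth as) (nth bs) q i m) \<le> C"
    proof (rule conn_ser_bounded[of q r "nth as" i s "nth bs"])
      show "as ! i' / as ! j \<noteq> q powi n" if "i' < r" "j < r" "i' \<noteq> j" for i' j n by (rule aa[OF that])
    qed (use q a0 i in auto)
    then show ?thesis unfolding cs_def by blast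
  qed
  have holh: "h holomorphic_on S"
    unfolding h_def
  proof (intro holomorphic_on_sum holomorphic_on_mult holomorphic_on_const holomorphic_on_divide jprod_holomorphic q holomorphic_on_ident)
    fix i assume i: "i \<in> {..<r}"
    then obtain C where C: "C > 0" "\<And>m. norm (cs i m) \<le> C" using cs_bd by auto
    have sm: "summable (\<lambda>m. (cs i m * q ^ (k * (m * Suc m div 2))) * w ^ m)" for w
    proof (rule summable_comparison_test')
      show "summable (\<lambda>m. C * (norm w ^ m * norm q ^ (k * (m * Suc m div 2))))"
        using q rs by (intro summable_mult summable_power_tri) auto
      show "norm (cs i m * q ^ (k * (m * Suc m div 2)) * w ^ m) \<le> C * (norm w ^ m * norm q ^ (k * (m * Suc m div 2)))" for m
        using mult_right_mono[OF C(2)[of m], of "norm w ^ m * norm q ^ (k * (m * Suc m div 2))"]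
        by (simp only: norm_mult norm_power mult_ac) simp
    qed
    have "(\<lambda>w. \<Sum>m. (cs i m * q ^ (k * (m * Suc m div 2))) * w ^ m) holomorphic_on UNIV"
      by (rule entire_series[OF sm])
    moreover have "(\<lambda>\<xi>. D i / (sg * \<xi>)) holomorphic_on S"
      using sg by (intro holomorphic_intros) (auto simp: S_iff)
    ultimately have "((\<lambda>w. \<Sum>m. (cs i m * q ^ (k * (m * Suc m div 2))) * w ^ m) \<circ> (\<lambda>\<xi>. D i / (sg * \<xi>))) holomorphic_on S"
      by (intro holomorphic_on_compose_gen[where t = UNIV]) auto
    then show "(\<lambda>\<xi>. \<Sum>m. cs i m * (D i / (sg * \<xi>)) ^ m * q ^ (k * (m * Suc m div 2))) holomorphic_on S"
      by (simp add: o_def mult_ac)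
  qed (use sg a0 jprod_eq_0_iff[OF q(2,1)] in \<open>auto simp: S_iff\<close>)
  have h_gs: "h \<xi> = gs \<xi>" if "\<xi> \<in> S" "norm \<xi> < 1" for \<xi>
  proof -
    have "h \<xi> = (\<Sum>n. (\<Prod>i<r. qpoch (as ! i) q n) / ((\<Prod>l<s. qpoch (bs ! l) q n) * qpoch q q n) * (sg * \<xi>) ^ n)"
      unfolding h_def K_def cs_def D_def
      by (rule connection_formula[symmetric]) (use q a0 aa b0 b1 rs that sg in \<open>auto simp: S_iff norm_mult\<close>)
    also have "\<dots> = gs \<xi>"
      unfolding gs_def eval_fps_def p_def using rs qborel_qhyp_phi_nth[OF q(1), of as bs k]
      by (simp add: r_def s_def sg_def[symmetric] power_mult_distrib mult_ac)
    finally show ?thesis .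
  qed
  have cont: "continue_from_disc S gs \<xi> = h \<xi>" if "\<xi> \<in> S" for \<xi>
    by (rule continue_from_disc_unique[OF openS connS neS holh h_gs that])
  \<comment> \<open>Since \<open>p = q ^ k\<close>, the spiral of base \<open>p\<close> lies on that
    of base \<open>q\<close>, so avoiding the poles at one point means avoiding them at all
    points.\<close>
  have lS: "l * p powi n \<in> S" for n
  proof -
    have "sg * (l * p powi n) \<noteq> q powi n'" for n'
    proof
      assume "sg * (l * p powi n) = q powi n'"
      moreover have "p powi n = q powi (int k * n)"
        by (simp add: p_def power_int_mult)
      ultimately have "z0 * q powi (int k * n) = q powi n'" by (simp add: z0_def sg_def mult_ac)
      then have "z0 = q powi (n' - int k * n)" using q by (simp add: power_int_diff field_simps)
      with l(2) show False by blast
    qed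
    then show ?thesis using l p by (simp add: S_iff)
  qed
  define y where "y = l / X"
  have y: "y \<noteq> 0" using l X by (simp add: y_def)
  define u where "u i = y / as ! i ^ k" for i
  have z0: "z0 \<noteq> 0" using l by (simp add: z0_def)
  have uv: "u i * (D i / z0) = E i" if "i < r" for i
  proof -
    have "sg * z0 = l" using sg by (simp add: z0_def sg_def[symmetric] mult.assoc[symmetric])
    then have "l / z0 = sg" using z0 by (simp add: field_simps)
    then show ?thesis unfolding u_def y_def E_def D_def sg_def[symmetric]
      by (metis (no_types, lifting) mult.commute mult.left_commute times_divide_eq_left times_divide_eq_right divide_divide_eq_left)
  qed
  have lterm: "h (l * p powi n) / qtheta p (l * p powi n / X) =
     (\<Sum>i<r. K i * (jprod q (as ! i * z0) / jprod q z0) / qtheta p y *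
        (\<Sum>m. cs i m * (D i / z0) ^ m * p powi ((n - int m) * (n - int m - 1) div 2) * u i powi n))" for n
  proof -
    \<comment> \<open>If the theta function vanishes at one point of the spiral it vanishes at all
      of them, and then both sides are 0 by the convention for division by 0.\<close>
    have 1: "1 / qtheta p (l * p powi n / X) = y powi n * p powi (n * (n - 1) div 2) / qtheta p y"
    proof -
      have "l * p powi n / X = y * p powi n" by (simp add: y_def)
      then show ?thesis using qtheta_qpow[OF p(2,1) y, of n] y p
        by (cases "qtheta p (y * p powi n) = 0") (auto simp: field_simps)
    qed
    have pq: "p powi n = q powi (int k * n)" by (simp add: p_def power_int_mult)
    have 2: "K i * (jprod q (as ! i * (sg * (l * p powi n))) / jprod q (sg * (l * p powi n))) *
        (\<Sum>m. cs i m * (D i / (sg * (l * p powi n))) ^ m * q ^ (k * (m * Suc m div 2))) *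
        (y powi n * p powi (n * (n - 1) div 2) / qtheta p y) =
        K i * (jprod q (as ! i * z0) / jprod q z0) / qtheta p y *
        (\<Sum>m. cs i m * (D i / z0) ^ m * p powi ((n - int m) * (n - int m - 1) div 2) * u i powi n)" if i: "i < r" for i
    proof -
      have ai: "as ! i \<noteq> 0" using a0 i by simp
      have e: "sg * (l * p powi n) = z0 * p powi n" by (simp add: z0_def sg_def)
      have r1: "jprod q (as ! i * (z0 * p powi n)) / jprod q (z0 * p powi n) =
          as ! i powi (- (int k * n)) * (jprod q (as ! i * z0) / jprod q z0)"
        unfolding pq by (rule jprod_ratio_qpow[OF q(2,1) z0 ai])
      have un: "u i powi n = y powi n * as ! i powi (- (int k * n))"
      proof -
        have "u i powi n = y powi n / (as ! i ^ k) powi n" by (simp add: u_def power_int_divide_distrib)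
        moreover have "(as ! i ^ k) powi n = as ! i powi (int k * n)" by (simp add: power_int_mult)
        ultimately show ?thesis by (simp add: power_int_minus divide_inverse)
      qed
      \<comment> \<open>Completing the square:
        \<open>m(m+1)/2 + n(n-1)/2 - n m = (n-m)(n-m-1)/2\<close>. This brings the summand into the
        shape required by \<open>theta_convolution\<close>.\<close>
      have pe: "(D i / (z0 * p powi n)) ^ m * q ^ (k * (m * Suc m div 2)) * p powi (n * (n - 1) div 2) =
          (D i / z0) ^ m * p powi ((n - int m) * (n - int m - 1) div 2)" for m
      proof -
        have ev: "even (int m * (int m + 1))" "even (n * (n - 1))" "even ((n - int m) * (n - int m - 1))" by auto
        have m1: "int (m * Suc m div 2) = int m * (int m + 1) div 2" by (simp add: zdiv_int algebra_simps)
        have "2 * (int m * (int m + 1) div 2 + n * (n - 1) div 2 - n * int m) = int m * (int m + 1) + n * (n - 1) - 2 * (n * int m)"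
          unfolding distrib_left right_diff_distrib using ev(1,2) by simp
        also have "\<dots> = (n - int m) * (n - int m - 1)" by (simp add: algebra_simps)
        also have "\<dots> = 2 * ((n - int m) * (n - int m - 1) div 2)" using ev(3) by simp
        finally have "int (m * Suc m div 2) + n * (n - 1) div 2 - n * int m = (n - int m) * (n - int m - 1) div 2"
          unfolding m1 by (subst (asm) mult_cancel_left) simp
        then have "p powi ((n - int m) * (n - int m - 1) div 2) = p powi int (m * Suc m div 2) * p powi (n * (n - 1) div 2) / p powi (n * int m)"
          using p by (metis power_int_add power_int_diff)
        moreover have "p powi (n * int m) = (p powi n) ^ m" by (simp add: power_int_mult)
        moreover have "q ^ (k * (m * Suc m div 2)) = p powi int (m * Suc m div 2)"
          unfolding power_int_of_nat p_def by (rule power_mult)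
        ultimately show ?thesis by (simp add: power_divide power_mult_distrib)
      qed
      obtain C where C: "C > 0" "\<And>m. norm (cs i m) \<le> C" using cs_bd i by auto
      have sm: "summable (\<lambda>m. cs i m * (D i / (z0 * p powi n)) ^ m * q ^ (k * (m * Suc m div 2)))"
      proof (rule summable_comparison_test')
        let ?w = "D i / (z0 * p powi n)"
        show "summable (\<lambda>m. C * (norm ?w ^ m * norm q ^ (k * (m * Suc m div 2))))"
          using q rs by (intro summable_mult summable_power_tri) auto
        show "norm (cs i m * ?w ^ m * q ^ (k * (m * Suc m div 2))) \<le> C * (norm ?w ^ m * norm q ^ (k * (m * Suc m div 2)))" for m
          unfolding norm_mult norm_power mult.assoc using C(2)[of m] by (intro mult_right_mono) auto
      qed
      have "(\<Sum>m. cs i m * (D i / z0) ^ m * p powi ((n - int m) * (n - int m - 1) div 2) * u i powi n) =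
         (\<Sum>m. (p powi (n * (n - 1) div 2) * u i powi n) * (cs i m * (D i / (z0 * p powi n)) ^ m * q ^ (k * (m * Suc m div 2))))"
      proof (rule suminf_cong)
        fix m
        have "(p powi (n * (n - 1) div 2) * u i powi n) * (cs i m * (D i / (z0 * p powi n)) ^ m * q ^ (k * (m * Suc m div 2))) =
            cs i m * u i powi n * ((D i / (z0 * p powi n)) ^ m * q ^ (k * (m * Suc m div 2)) * p powi (n * (n - 1) div 2))"
          by (simp only: mult_ac)
        also have "\<dots> = cs i m * (D i / z0) ^ m * p powi ((n - int m) * (n - int m - 1) div 2) * u i powi n"
          unfolding pe by (simp only: mult_ac)
        finally show "cs i m * (D i / z0) ^ m * p powi ((n - int m) * (n - int m - 1) div 2) * u i powi n =
          (p powi (n * (n - 1) div 2) * u i powi n) * (cs i m * (D i / (z0 * p powi n)) ^ m * q ^ (k * (m * Suc m div 2)))" ..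
      qed
      also have "\<dots> = (p powi (n * (n - 1) div 2) * u i powi n) * (\<Sum>m. cs i m * (D i / (z0 * p powi n)) ^ m * q ^ (k * (m * Suc m div 2)))"
        by (rule suminf_mult[OF sm])
      finally show ?thesis unfolding e r1 un by simp
    qed
    have "h (l * p powi n) / qtheta p (l * p powi n / X) = h (l * p powi n) * (y powi n * p powi (n * (n - 1) div 2) / qtheta p y)"
      unfolding 1[symmetric] by simp
    also have "\<dots> = (\<Sum>i<r. K i * (jprod q (as ! i * z0) / jprod q z0) / qtheta p y *
        (\<Sum>m. cs i m * (D i / z0) ^ m * p powi ((n - int m) * (n - int m - 1) div 2) * u i powi n))"
      unfolding h_def sum_distrib_right by (intro sum.cong refl 2) simp
    finally show ?thesis .
  qed
  have hs: "((\<lambda>n. h (l * p powi n) / qtheta p (l * p powi n / X)) has_sum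
     (\<Sum>i<r. K i * (jprod q (as ! i * z0) / jprod q z0) / qtheta p y * ((\<Sum>m. cs i m * E i ^ m) * qtheta p (u i)))) UNIV"
    unfolding lterm
  proof (intro has_sum_sum_finite has_sum_cmult_right)
    fix i assume "i \<in> {..<r}"
    then have i: "i < r" by simp
    obtain C where C: "C > 0" "\<And>m. norm (cs i m) \<le> C" using cs_bd i by auto
    have "summable (\<lambda>m. norm (cs i m * (u i * (D i / z0)) ^ m))"
    proof (rule summable_comparison_test')
      show "summable (\<lambda>m. C * norm (E i) ^ m)"
        using E[OF i] by (intro summable_mult summable_geometric) auto
      show "norm (norm (cs i m * (u i * (D i / z0)) ^ m)) \<le> C * norm (E i) ^ m" for m
        unfolding uv[OF i] using C(2)[of m] by (simp add: norm_mult norm_power mult_right_mono)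
    qed
    from theta_convolution[OF p _ this] y a0[OF i]
    show "((\<lambda>n. \<Sum>m. cs i m * (D i / z0) ^ m * p powi ((n - int m) * (n - int m - 1) div 2) * u i powi n) has_sum
           (\<Sum>m. cs i m * E i ^ m) * qtheta p (u i)) UNIV"
      unfolding uv[OF i] by (simp add: u_def)
  qed
  have "rfs as bs l q X = qlaplace p l (continue_from_disc S gs) X"
    using rs unfolding rfs_def Let_def S_def gs_def p_def sg_def r_def s_def by simp
  also have "\<dots> = (\<Sum>i<r. K i * (jprod q (as ! i * z0) / jprod q z0) / qtheta p y * ((\<Sum>m. cs i m * E i ^ m) * qtheta p (u i)))"
    unfolding qlaplace_def using hs by (simp only: cont[OF lS]) (rule infsumI)
  finally show ?thesis
    by (simp add: K_def cs_def p_def y_def u_def mult_ac)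
qed

section \<open>Asymptotics of infinite products as q tends to 1\<close>

text \<open>The q-number usually written \<open>[a]_q\<close>, which tends to
  \<open>a\<close>.\<close>

definition qnum :: "real \<Rightarrow> complex \<Rightarrow> complex" where
  "qnum q a = (1 - complex_of_real q powr a) / of_real (1 - q)"

lemma of_real_powr_eq_exp: "q > 0 \<Longrightarrow> complex_of_real q powr a = exp (a * of_real (ln q))"
  by (simp add: powr_def Ln_of_real)

text \<open>A linear rate is recorded, not mere convergence, because the error will be multiplied by
  \<open>ln (1 - q)\<close>.\<close>

lemma qnum_approx:
  obtains L where "L \<ge> 0" "\<And>q. 1 / 2 < q \<Longrightarrow> q < 1 \<Longrightarrow> norm (qnum q a - a) \<le> L * (1 - q)"
proof -
  \<comment> \<open>The first summand bounds the second-order Taylor remainder of \<open>exp\<close>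
    at \<open>a * ln q\<close>, of norm at most \<open>2 * norm a * (1 - q)\<close>; the second
    comes from replacing \<open>ln q\<close> by \<open>- (1 - q)\<close>.\<close>
  define L where "L = exp (2 * norm a) * (4 * norm a ^ 2) + norm a * 2"
  have "norm (qnum q a - a) \<le> L * (1 - q)" if q: "1 / 2 < q" "q < 1" for q
  proof -
    have q0: "q > 0" using q by simp
    have lnup: "ln q \<le> - (1 - q)" using ln_le_minus_one[OF q0] by simp
    have lnlow: "- ((1 - q) / q) \<le> ln q"
      using ln_le_minus_one[of "1 / q"] q0 by (simp add: ln_div field_simps)
    have q2: "(1 - q) / q \<le> 2 * (1 - q)"
      using divide_left_mono[of "1 / 2" q "1 - q"] q by simp
    have ln1: "\<bar>ln q\<bar> \<le> 2 * (1 - q)" using lnup lnlow q2 q by linarith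
    have "(1 - q) / q - (1 - q) = (1 - q) / q * (1 - q)"
      using q0 by (simp add: field_simps)
    also have "\<dots> \<le> 2 * (1 - q) * (1 - q)" using q2 q by (intro mult_right_mono) auto
    finally have ln2: "\<bar>ln q + (1 - q)\<bar> \<le> 2 * (1 - q) ^ 2"
      unfolding power2_eq_square mult.assoc[symmetric] using lnup lnlow by linarith
    define w where "w = a * of_real (ln q)"
    have wn: "norm w \<le> norm a * (2 * (1 - q))"
      unfolding w_def norm_mult using ln1 by (intro mult_left_mono) auto
    also have "\<dots> \<le> norm a * 2" using q by (intro mult_left_mono) auto
    finally have w2: "norm w \<le> 2 * norm a" by simp
    have "norm (exp w - 1 - w) \<le> exp \<bar>Re w\<bar> * norm w ^ 2"
      using Taylor_exp[of w 1] by (simp add: power2_eq_square algebra_simps)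
    also have "\<dots> \<le> exp (2 * norm a) * (norm a * (2 * (1 - q))) ^ 2"
      using wn w2 abs_Re_le_cmod[of w] by (intro mult_mono power_mono) auto
    finally have e1: "norm (exp w - 1 - w) \<le> exp (2 * norm a) * (4 * norm a ^ 2) * (1 - q) ^ 2"
      by (simp only: power_mult_distrib) (simp add: mult_ac)
    have e2: "norm (a * of_real (ln q + (1 - q))) \<le> norm a * 2 * (1 - q) ^ 2"
    proof -
      have "norm (a * of_real (ln q + (1 - q))) = norm a * \<bar>ln q + (1 - q)\<bar>" by (simp only: norm_mult norm_of_real)
      also have "\<dots> \<le> norm a * (2 * (1 - q) ^ 2)" using ln2 by (intro mult_left_mono) auto
      finally show ?thesis by simp
    qed
    have "1 - complex_of_real q powr a - a * of_real (1 - q) = - (exp w - 1 - w) - a * of_real (ln q + (1 - q))"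
      by (simp add: of_real_powr_eq_exp[OF q0] w_def algebra_simps)
    then have "norm (1 - complex_of_real q powr a - a * of_real (1 - q)) \<le> norm (exp w - 1 - w) + norm (a * of_real (ln q + (1 - q)))"
      by (metis norm_minus_cancel norm_triangle_ineq4)
    also have "\<dots> \<le> L * (1 - q) ^ 2" using e1 e2 by (simp add: L_def algebra_simps)
    finally have "norm (1 - complex_of_real q powr a - a * of_real (1 - q)) \<le> L * (1 - q) ^ 2" .
    then have "norm (1 - complex_of_real q powr a - a * of_real (1 - q)) / (1 - q) \<le> L * (1 - q) ^ 2 / (1 - q)"
      using q by (intro divide_right_mono) auto
    also have "\<dots> = L * (1 - q)" using q by (simp add: power2_eq_square)
    also have "qnum q a - a = (1 - complex_of_real q powr a - a * of_real (1 - q)) / of_real (1 - q)"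
      using q by (simp add: qnum_def field_simps)
    then have "norm (1 - complex_of_real q powr a - a * of_real (1 - q)) / (1 - q) = norm (qnum q a - a)"
      using q by (simp only: norm_divide norm_of_real)
    finally show ?thesis .
  qed
  moreover have "L \<ge> 0" by (simp add: L_def)
  ultimately show ?thesis using that by blast
qed

text \<open>Bases are functions \<open>Q\<close> tending to 1 from the left along an arbitrary
  filter, since the theta limit is needed both for base \<open>q\<close> and for base
  \<open>q ^ k\<close>.\<close>

lemma at_left_1_eventually:
  assumes "filterlim Q (at_left (1::real)) F" "c < 1"
  shows "eventually (\<lambda>x. c < Q x \<and> Q x < 1) F"
proof -
  have "eventually (\<lambda>q. c < q \<and> q < 1) (at_left 1)"
    by (rule eventually_mono[OF eventually_at_left_real[OF assms(2)]]) auto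
  then show ?thesis using assms(1) by (rule eventually_compose_filterlim)
qed

lemma at_left_1_half:
  assumes "filterlim Q (at_left (1::real)) F"
  shows "eventually (\<lambda>x. 1 / 2 < Q x \<and> Q x < 1) F"
  by (rule at_left_1_eventually[OF assms]) simp

lemma qnum_tendsto:
  assumes Q: "filterlim Q (at_left (1::real)) F"
  shows "((\<lambda>x. qnum (Q x) a) \<longlongrightarrow> a) F"
proof -
  obtain L where L: "L \<ge> 0" "\<And>q. 1 / 2 < q \<Longrightarrow> q < 1 \<Longrightarrow> norm (qnum q a - a) \<le> L * (1 - q)"
    using qnum_approx by blast
  have Q1: "(Q \<longlongrightarrow> 1) F" using Q by (simp add: filterlim_at)
  have "((\<lambda>x. qnum (Q x) a - a) \<longlongrightarrow> 0) F"
  proof (rule Lim_null_comparison)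
    show "eventually (\<lambda>x. norm (qnum (Q x) a - a) \<le> L * (1 - Q x)) F"
      using at_left_1_half[OF Q] by (rule eventually_mono) (use L in auto)
    show "((\<lambda>x. L * (1 - Q x)) \<longlongrightarrow> 0) F"
      by (rule tendsto_eq_intros Q1 refl | simp)+
  qed
  then show ?thesis by (simp add: LIM_zero_iff)
qed

lemma qnum_bounded:
  assumes Q: "filterlim Q (at_left (1::real)) F"
  shows "eventually (\<lambda>x. norm (qnum (Q x) a) \<le> norm a + 1) F"
proof -
  have "eventually (\<lambda>x. norm (qnum (Q x) a) < norm a + 1) F"
    by (rule order_tendstoD(2)[OF tendsto_norm[OF qnum_tendsto[OF Q]]]) simp
  then show ?thesis by (rule eventually_mono) simp
qed

text \<open>The linear rate beats the logarithm. In \<open>qGamma_limit\<close> this permits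
  replacing the exponent \<open>qnum q (a - 1)\<close> of \<open>1 - q\<close> by
  \<open>a - 1\<close>.\<close>

lemma qnum_correction:
  assumes Q: "filterlim Q (at_left (1::real)) F"
  shows "((\<lambda>x. (qnum (Q x) a - a) * of_real (ln (1 - Q x))) \<longlongrightarrow> 0) F"
proof -
  obtain L where L: "L \<ge> 0" "\<And>q. 1 / 2 < q \<Longrightarrow> q < 1 \<Longrightarrow> norm (qnum q a - a) \<le> L * (1 - q)"
    using qnum_approx by blast
  show ?thesis
  proof (rule Lim_null_comparison)
    show "eventually (\<lambda>x. norm ((qnum (Q x) a - a) * of_real (ln (1 - Q x))) \<le> L * ((1 - Q x) * \<bar>ln (1 - Q x)\<bar>)) F"
      using at_left_1_half[OF Q]
    proof (rule eventually_mono)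
      fix x assume "1 / 2 < Q x \<and> Q x < 1"
      then have "norm (qnum (Q x) a - a) * \<bar>ln (1 - Q x)\<bar> \<le> L * (1 - Q x) * \<bar>ln (1 - Q x)\<bar>"
        using L by (intro mult_right_mono) auto
      then show "norm ((qnum (Q x) a - a) * of_real (ln (1 - Q x))) \<le> L * ((1 - Q x) * \<bar>ln (1 - Q x)\<bar>)"
        by (simp add: norm_mult mult.assoc)
    qed
    have "((\<lambda>x. (1 - Q x) * \<bar>ln (1 - Q x)\<bar>) \<longlongrightarrow> 0) F"
    proof (rule Lim_null_comparison)
      show "eventually (\<lambda>x. norm ((1 - Q x) * \<bar>ln (1 - Q x)\<bar>) \<le> 2 * sqrt (1 - Q x)) F"
        using at_left_1_half[OF Q]
      proof (rule eventually_mono)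
        fix x assume x: "1 / 2 < Q x \<and> Q x < 1"
        define y where "y = 1 - Q x"
        \<comment> \<open>With \<open>y = z * z\<close>, the elementary
          \<open>ln (1 / z) \<le> 1 / z - 1\<close> gives the bound \<open>2 * sqrt y\<close> for
          \<open>y * \<bar>ln y\<bar>\<close>.\<close>
        define z where "z = sqrt y"
        have y: "0 < y" "y < 1" using x by (auto simp: y_def)
        have z: "0 < z" "y = z * z" using y by (simp_all add: z_def)
        have "ln (1 / z) \<le> 1 / z - 1" using z by (intro ln_le_minus_one) simp
        then have "- ln z \<le> 1 / z" using z by (simp add: ln_div)
        then have "z * (z * (- 2 * ln z)) \<le> z * (z * (2 * (1 / z)))" using z by (intro mult_left_mono) auto
        moreover have "\<bar>ln y\<bar> = - 2 * ln z"
        proof -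
          have "ln y = ln z + ln z" unfolding z(2) using z(1) by (simp add: ln_mult)
          moreover have "ln y < 0" using y by simp
          ultimately show ?thesis by linarith
        qed
        ultimately have "y * \<bar>ln y\<bar> \<le> 2 * z" using z by simp
        then show "norm ((1 - Q x) * \<bar>ln (1 - Q x)\<bar>) \<le> 2 * sqrt (1 - Q x)"
          using y by (simp add: y_def z_def abs_mult)
      qed
      have "((\<lambda>x. 2 * sqrt (1 - Q x)) \<longlongrightarrow> 2 * sqrt (1 - 1)) F"
        using Q by (intro tendsto_intros) (simp add: filterlim_at)
      then show "((\<lambda>x. 2 * sqrt (1 - Q x)) \<longlongrightarrow> 0) F" by simp
    qed
    then show "((\<lambda>x. L * ((1 - Q x) * \<bar>ln (1 - Q x)\<bar>)) \<longlongrightarrow> 0) F"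
      by (rule tendsto_mult_right_zero)
  qed
qed

text \<open>Matching \<open>1 + c \<epsilon>\<close> against \<open>(1 + \<epsilon>) powr c\<close> leaves a quadratic error; the second factors
  telescope in all products below.\<close>

lemma binomial_factor_estimate:
  assumes "C \<ge> 0"
  obtains K where "K \<ge> 0"
    "\<And>c e :: complex. norm c \<le> C \<Longrightarrow> norm e < 1 / 2 \<Longrightarrow> norm ((1 + c * e) * exp (- c * Ln (1 + e)) - 1) \<le> K * norm e ^ 2"
proof -
  \<comment> \<open>\<open>K1\<close> bounds the remainder \<open>R\<close> of \<open>exp w\<close>
    about \<open>1 - c * e\<close>: its summands come from the Taylor remainder of
    \<open>exp\<close> and from \<open>Ln (1 + e) - e\<close>. \<open>K\<close> then collects the
    two error terms of the product.\<close>
  define K1 where "K1 = 4 * C ^ 2 * exp C + 2 * C"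
  define K where "K = C ^ 2 + K1 * (1 + C)"
  have "norm ((1 + c * e) * exp (- c * Ln (1 + e)) - 1) \<le> K * norm e ^ 2"
    if c: "norm c \<le> C" and e: "norm e < 1 / 2" for c e :: complex
  proof -
    define w where "w = - c * Ln (1 + e)"
    have l1: "norm (Ln (1 + e)) \<le> 2 * norm e" using norm_Ln_le[OF e] .
    have l2: "norm (Ln (1 + e) - e) \<le> 2 * norm e ^ 2"
    proof -
      have "norm (Ln (1 + e) - e) \<le> norm e ^ 2 / (1 - norm e)" using e by (intro Ln_approx_linear) auto
      also have "\<dots> \<le> norm e ^ 2 / (1 / 2)" using e by (intro divide_left_mono) auto
      finally show ?thesis by simp
    qed
    have w1: "norm w \<le> C * (2 * norm e)" unfolding w_def norm_mult norm_minus_cancel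
      using c l1 assms by (intro mult_mono) auto
    also have "\<dots> \<le> C * 1" using e assms by (intro mult_left_mono) auto
    finally have w2: "norm w \<le> C" by simp
    have "norm (exp w - 1 - w) \<le> exp \<bar>Re w\<bar> * norm w ^ 2"
      using Taylor_exp[of w 1] by (simp add: power2_eq_square algebra_simps)
    also have "\<dots> \<le> exp C * (C * (2 * norm e)) ^ 2"
      using w1 w2 abs_Re_le_cmod[of w] by (intro mult_mono power_mono) auto
    finally have e1: "norm (exp w - 1 - w) \<le> 4 * C ^ 2 * exp C * norm e ^ 2"
      by (simp add: power_mult_distrib mult_ac)
    have e2: "norm (w + c * e) \<le> 2 * C * norm e ^ 2"
    proof -
      have "w + c * e = - (c * (Ln (1 + e) - e))" by (simp add: w_def algebra_simps)
      then have "norm (w + c * e) = norm c * norm (Ln (1 + e) - e)" by (simp add: norm_mult)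
      also have "\<dots> \<le> C * (2 * norm e ^ 2)" using c l2 assms by (intro mult_mono) auto
      finally show ?thesis by simp
    qed
    define R where "R = exp w - 1 + c * e"
    have R: "norm R \<le> K1 * norm e ^ 2"
    proof -
      have "R = (exp w - 1 - w) + (w + c * e)" by (simp add: R_def)
      then have "norm R \<le> norm (exp w - 1 - w) + norm (w + c * e)" by (metis norm_triangle_ineq)
      then show ?thesis using e1 e2 by (simp add: K1_def algebra_simps)
    qed
    \<comment> \<open>Here \<open>exp w = 1 - c * e + R\<close>, so the first-order terms
      cancel.\<close>
    have "(1 + c * e) * exp w - 1 = - ((c * e) ^ 2) + R * (1 + c * e)"
      by (simp add: R_def power2_eq_square algebra_simps)
    then have "norm ((1 + c * e) * exp w - 1) \<le> norm ((c * e) ^ 2) + norm (R * (1 + c * e))"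
      by (metis norm_triangle_ineq norm_minus_cancel)
    also have "norm ((c * e) ^ 2) \<le> C ^ 2 * norm e ^ 2"
      unfolding norm_power norm_mult power_mult_distrib using c by (intro mult_right_mono power_mono) auto
    also have "norm (R * (1 + c * e)) \<le> (K1 * norm e ^ 2) * (1 + C)"
    proof -
      have "norm (c * e) \<le> C * 1" unfolding norm_mult using c e assms by (intro mult_mono) auto
      then have "norm (1 + c * e) \<le> 1 + C" using norm_triangle_ineq[of 1 "c * e"] by simp
      then show ?thesis unfolding norm_mult using R assms by (intro mult_mono) (auto simp: K1_def)
    qed
    finally show ?thesis by (simp add: w_def K_def algebra_simps)
  qed
  moreover have "K \<ge> 0" using assms by (simp add: K_def K1_def)
  ultimately show ?thesis using that by blast
qed

text \<open>The two arguments lie both in \<open>(0, pi)\<close>, both in \<open>(- pi, 0)\<close>,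
  or are both 0. Their difference therefore stays within the principal range.\<close>

lemma Ln_quotient:
  fixes x y :: complex
  assumes "sgn (Im x) = sgn (Im y)" "Im x = 0 \<Longrightarrow> Re x > 0 \<and> Re y > 0"
  shows "Ln (x / y) = Ln x - Ln y"
proof -
  have nz: "x \<noteq> 0" "y \<noteq> 0" using assms by (auto simp: complex_eq_iff sgn_if split: if_splits)
  have neg: "Im (Ln z) < 0 \<and> - pi < Im (Ln z)" if "Im z < 0" for z
  proof -
    have "z \<noteq> 0" using that by auto
    then show ?thesis using that Im_Ln_pos_le[of z] mpi_less_Im_Ln[of z] Im_Ln_le_pi[of z] by auto
  qed
  have "- pi < Im (Ln x - Ln y) \<and> Im (Ln x - Ln y) \<le> pi"
  proof (cases "Im x" "0 :: real" rule: linorder_cases)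
    case less
    then have "Im y < 0" using assms(1) by (auto simp: sgn_if split: if_splits)
    then show ?thesis using neg[of x] neg[of y] less by simp
  next
    case equal
    then have "Im (Ln x) = 0" "Im (Ln y) = 0" using assms nz by (auto simp: Im_Ln_eq_0 sgn_if split: if_splits)
    then show ?thesis by simp
  next
    case greater
    then have "Im y > 0" using assms(1) by (auto simp: sgn_if split: if_splits)
    then show ?thesis using Im_Ln_pos_lt_imp[of x] Im_Ln_pos_lt_imp[of y] greater by simp
  qed
  then have "Ln (exp (Ln x - Ln y)) = Ln x - Ln y" by (intro Ln_exp) auto
  then show ?thesis using nz by (simp add: exp_diff)
qed

text \<open>The ray from 1 in direction \<open>w\<close> misses 0. Off the real axis,
  \<open>\<bar>Im w\<bar> / norm w\<close> is the distance of 0 from the whole line, found by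
  multiplying with \<open>cnj w\<close>.\<close>

lemma ray_distance:
  fixes w :: complex
  assumes "w \<notin> \<real>\<^sub>\<le>\<^sub>0"
  obtains d where "d > 0" "\<And>t::real. t \<ge> 0 \<Longrightarrow> norm (1 + of_real t * w) \<ge> d"
proof (cases "Im w = 0")
  case True
  then have "Re w > 0" using assms by (auto simp: complex_nonpos_Reals_iff)
  have "norm (1 + of_real t * w) \<ge> 1" if "t \<ge> 0" for t :: real
  proof -
    have "1 \<le> Re (1 + of_real t * w)" using that \<open>Re w > 0\<close> by simp
    also have "\<dots> \<le> norm (1 + of_real t * w)" by (rule complex_Re_le_cmod)
    finally show ?thesis .
  qed
  then show ?thesis using that[of 1] by simp
next
  case False
  have w0: "norm w > 0" using False by auto
  have "norm (1 + of_real t * w) \<ge> \<bar>Im w\<bar> / norm w" for t :: real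
  proof -
    have "(1 + of_real t * w) * cnj w = cnj w + of_real (t * norm w ^ 2)"
      by (simp add: algebra_simps complex_norm_square flip: of_real_power)
    then have "Im ((1 + of_real t * w) * cnj w) = - Im w" by simp
    then have "\<bar>Im w\<bar> \<le> norm ((1 + of_real t * w) * cnj w)" using abs_Im_le_cmod[of "(1 + of_real t * w) * cnj w"] by simp
    then have "\<bar>Im w\<bar> \<le> norm (1 + of_real t * w) * norm w" by (simp only: norm_mult complex_mod_cnj)
    then show ?thesis using w0 by (simp add: divide_le_eq)
  qed
  then show ?thesis using that[of "\<bar>Im w\<bar> / norm w"] False w0 by simp
qed

text \<open>The limit form of the q-binomial theorem:
  \<open>(q^a v; q)_\<infinity> / (v; q)_\<infinity>\<close> behaves like
  \<open>(1 - v)^(-a)\<close> at \<open>v = - t * w\<close>. The scale \<open>t\<close> may vary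
  with \<open>x\<close> as long as it stays bounded, which the rescaling in
  \<open>theta_ratio_limit\<close> exploits.\<close>

lemma qbinomial_limit:
  fixes w a :: complex and Q t :: "'x \<Rightarrow> real"
  assumes w: "w \<notin> \<real>\<^sub>\<le>\<^sub>0"
    and Q: "filterlim Q (at_left 1) F"
    and t: "eventually (\<lambda>x. 0 < t x \<and> t x \<le> B) F"
  shows "((\<lambda>x. qinf (- (of_real (Q x) powr a * (of_real (t x) * w))) (of_real (Q x)) / qinf (- (of_real (t x) * w)) (of_real (Q x)) *
           exp (a * Ln (1 + of_real (t x) * w))) \<longlongrightarrow> 1) F"
proof -
  obtain d where d: "d > 0" "\<And>t::real. t \<ge> 0 \<Longrightarrow> norm (1 + of_real t * w) \<ge> d"
    using ray_distance[OF w] by blast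
  have w': "Im w = 0 \<Longrightarrow> Re w > 0" using w by (auto simp: complex_nonpos_Reals_iff)
  obtain K where K: "K \<ge> 0" "\<And>c e :: complex. norm c \<le> norm a + 1 \<Longrightarrow> norm e < 1 / 2 \<Longrightarrow> norm ((1 + c * e) * exp (- c * Ln (1 + e)) - 1) \<le> K * norm e ^ 2"
    using binomial_factor_estimate[of "norm a + 1"] by auto
  \<comment> \<open>Makes \<open>norm (e n) \<le> M * (1 - q) * q ^ n\<close>: the numerators are
    controlled by \<open>\<bar>B\<bar> * norm w\<close>, the denominators by the distance
    \<open>d\<close> of the ray from 0.\<close>
  define M where "M = \<bar>B\<bar> * norm w / d"
  have M0: "M \<ge> 0" using d by (simp add: M_def)
  have Q1: "(Q \<longlongrightarrow> 1) F" using Q by (simp add: filterlim_at)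
  define T where "T x = qinf (- (of_real (Q x) powr a * (of_real (t x) * w))) (of_real (Q x)) / qinf (- (of_real (t x) * w)) (of_real (Q x))" for x
  have "((\<lambda>x. M * (1 - Q x)) \<longlongrightarrow> M * (1 - 1)) F" by (intro tendsto_intros Q1)
  then have "eventually (\<lambda>x. M * (1 - Q x) < 1 / 2) F" by (rule order_tendstoD) simp
  with qnum_bounded[OF Q, of a] at_left_1_half[OF Q] t
  have main: "eventually (\<lambda>x. norm (T x * exp (qnum (Q x) a * Ln (1 + of_real (t x) * w)) - 1) \<le> exp (K * M\<^sup>2 * (1 - Q x)) - 1) F"
  proof eventually_elim
    case (elim x)
    define q where "q = Q x"
    define v where "v = - (of_real (t x) * w)"
    define c where "c = qnum q a"
    define e where "e n = of_real q ^ n * v * of_real (1 - q) / (1 - of_real q ^ n * v)" for n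
    have q: "1 / 2 < q" "q < 1" "M * (1 - q) < 1 / 2" "norm c \<le> norm a + 1" using elim by (auto simp: q_def c_def)
    have tx: "0 < t x" "t x \<le> B" using elim by auto
    have qn: "norm (complex_of_real q) < 1" using q by simp
    have one: "1 - of_real q ^ n * v = 1 + of_real (q ^ n * t x) * w" for n
      by (simp add: v_def)
    have low: "norm (1 - of_real q ^ n * v) \<ge> d" for n
      unfolding one using q tx by (intro d) auto
    have nz: "1 - of_real q ^ n * v \<noteq> 0" for n using low[of n] d by auto
    have en: "norm (e n) \<le> M * (1 - q) * q ^ n" for n
    proof -
      have "norm (e n) = q ^ n * (t x * norm w) * (1 - q) / norm (1 - of_real q ^ n * v)"
        using q tx by (simp add: e_def v_def norm_mult norm_divide norm_power del: of_real_diff)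
      also have "\<dots> \<le> q ^ n * (\<bar>B\<bar> * norm w) * (1 - q) / d"
        using low[of n] d q tx by (intro frac_le mult_right_mono mult_left_mono) auto
      finally show ?thesis by (simp add: M_def mult_ac)
    qed
    have e12: "norm (e n) < 1 / 2" for n
    proof -
      have "M * (1 - q) * q ^ n \<le> M * (1 - q) * 1"
        using M0 q by (intro mult_left_mono power_le_one) auto
      then show ?thesis using en[of n] q by simp
    qed
    have step: "1 - of_real q ^ Suc n * v = (1 - of_real q ^ n * v) * (1 + e n)" for n
      using nz[of n] by (simp add: e_def field_simps)
    have fac: "1 - of_real q powr a * v * of_real q ^ n = (1 - of_real q ^ n * v) * (1 + c * e n)" for n
    proof -
      have "c * of_real (1 - q) = 1 - of_real q powr a" using q by (simp add: c_def qnum_def)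
      then have "c * e n = of_real q ^ n * v * (1 - of_real q powr a) / (1 - of_real q ^ n * v)"
        by (simp add: e_def mult_ac)
      then show ?thesis using nz[of n] by (simp add: field_simps)
    qed
    \<comment> \<open>All points \<open>1 - q ^ n * v\<close> lie on one ray from 1 that avoids the
      cut, so consecutive logarithms subtract without a multiple of
      \<open>2 * pi * \<i>\<close>.\<close>
    have Lnstep: "Ln (1 + e n) = Ln (1 - of_real q ^ Suc n * v) - Ln (1 - of_real q ^ n * v)" for n
    proof -
      have "1 + e n = (1 - of_real q ^ Suc n * v) / (1 - of_real q ^ n * v)"
        unfolding step using nz[of n] by simp
      also have "Ln \<dots> = Ln (1 - of_real q ^ Suc n * v) - Ln (1 - of_real q ^ n * v)"
        unfolding one using q tx w' by (intro Ln_quotient) (auto simp: sgn_mult add_pos_pos)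
      finally show ?thesis .
    qed
    have prod: "(\<Prod>n<N. (1 + c * e n) * exp (- c * Ln (1 + e n))) =
        qpoch (of_real q powr a * v) (of_real q) N / qpoch v (of_real q) N * exp (- c * (Ln (1 - of_real q ^ N * v) - Ln (1 - v)))" for N
    proof (induction N)
      case (Suc N)
      have "(1 + c * e N) = (1 - of_real q powr a * v * of_real q ^ N) / (1 - v * of_real q ^ N)"
        using fac[of N] nz[of N] by (simp add: mult.commute)
      moreover have "exp (- c * (Ln (1 - of_real q ^ N * v) - Ln (1 - v))) * exp (- c * Ln (1 + e N)) =
          exp (- c * (Ln (1 - of_real q ^ Suc N * v) - Ln (1 - v)))"
        unfolding Lnstep exp_add[symmetric] by (simp add: algebra_simps)
      ultimately show ?case by (simp only: prod.lessThan_Suc Suc qpoch_Suc) (simp add: mult_ac)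
    qed simp
    have lim: "(\<lambda>N. \<Prod>n<N. (1 + c * e n) * exp (- c * Ln (1 + e n))) \<longlonglongrightarrow> T x * exp (c * Ln (1 + of_real (t x) * w))"
    proof -
      have v1: "1 - v = 1 + of_real (t x) * w" by (simp add: v_def)
      have nzv: "qinf v (of_real q) \<noteq> 0"
        using nz by (auto simp: qinf_eq_0_iff[OF qn] mult.commute)
      have "(\<lambda>N. of_real q ^ N * v) \<longlonglongrightarrow> 0"
        using qn by (intro tendsto_mult_left_zero LIMSEQ_power_zero)
      then have "(\<lambda>N. 1 - of_real q ^ N * v) \<longlonglongrightarrow> 1" by (auto intro: tendsto_eq_intros)
      then have LnL: "(\<lambda>N. Ln (1 - of_real q ^ N * v)) \<longlonglongrightarrow> Ln 1" by (intro tendsto_Ln) auto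
      have "(\<lambda>N. qpoch (of_real q powr a * v) (of_real q) N / qpoch v (of_real q) N * exp (- c * (Ln (1 - of_real q ^ N * v) - Ln (1 - v))))
         \<longlonglongrightarrow> qinf (of_real q powr a * v) (of_real q) / qinf v (of_real q) * exp (- c * (Ln 1 - Ln (1 - v)))"
        by (intro tendsto_mult tendsto_divide tendsto_exp tendsto_diff tendsto_const LnL qpoch_tendsto_qinf qn nzv)
      then show ?thesis unfolding prod v1 by (simp add: T_def q_def v_def)
    qed
    have "norm ((\<Prod>n<N. (1 + c * e n) * exp (- c * Ln (1 + e n))) - 1) \<le> exp (K * M\<^sup>2 * (1 - q)) - 1" for N
    proof -
      define g where "g n = (1 + c * e n) * exp (- c * Ln (1 + e n)) - 1" for n
      \<comment> \<open>One power of \<open>1 - q\<close> is spent on summing the geometric series;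
        the other survives and makes the total error of order \<open>1 - q\<close>.\<close>
      have g: "norm (g n) \<le> K * M\<^sup>2 * (1 - q)\<^sup>2 * q ^ n" for n
      proof -
        have "norm (g n) \<le> K * norm (e n) ^ 2" unfolding g_def using K(2)[OF q(4) e12] .
        also have "\<dots> \<le> K * (M * (1 - q) * q ^ n) ^ 2" using K(1) en by (intro mult_left_mono power_mono) auto
        also have "\<dots> = K * M\<^sup>2 * (1 - q)\<^sup>2 * (q ^ n * q ^ n)" by (simp add: power2_eq_square mult_ac)
        also have "\<dots> \<le> K * M\<^sup>2 * (1 - q)\<^sup>2 * (q ^ n * 1)"
          using K(1) q by (intro mult_left_mono power_le_one) auto
        finally show ?thesis by simp
      qed
      have "norm ((\<Prod>n<N. 1 + g n) - 1) \<le> (\<Prod>n<N. 1 + norm (g n)) - 1" by (rule norm_prod_minus1_le_prod_minus1)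
      also have "(\<Prod>n<N. 1 + norm (g n)) \<le> exp (\<Sum>n<N. norm (g n))" by (rule prod_le_exp_sum) auto
      also have "(\<Sum>n<N. norm (g n)) \<le> (\<Sum>n<N. K * M\<^sup>2 * (1 - q)\<^sup>2 * q ^ n)" by (intro sum_mono g)
      also have "\<dots> = K * M\<^sup>2 * (1 - q)\<^sup>2 * (\<Sum>n<N. q ^ n)" by (simp add: sum_distrib_left)
      also have "\<dots> \<le> K * M\<^sup>2 * (1 - q)\<^sup>2 * (1 / (1 - q))"
      proof (rule mult_left_mono)
        have "(\<Sum>n<N. q ^ n) \<le> (\<Sum>n. q ^ n)" using q by (intro sum_le_suminf summable_geometric) auto
        then show "(\<Sum>n<N. q ^ n) \<le> 1 / (1 - q)" using q suminf_geometric[of q] by simp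
      qed (use K(1) in auto)
      also have "\<dots> = K * M\<^sup>2 * (1 - q)" using q by (simp add: power2_eq_square)
      finally show ?thesis by (simp add: g_def)
    qed
    then have "norm (T x * exp (c * Ln (1 + of_real (t x) * w)) - 1) \<le> exp (K * M\<^sup>2 * (1 - q)) - 1"
      by (intro tendsto_upperbound[OF tendsto_norm[OF tendsto_diff[OF lim tendsto_const]]]) auto
    then show ?case by (simp add: c_def q_def)
  qed
  have L1: "((\<lambda>x. T x * exp (qnum (Q x) a * Ln (1 + of_real (t x) * w))) \<longlongrightarrow> 1) F"
  proof -
    have "((\<lambda>x. exp (K * M\<^sup>2 * (1 - Q x)) - 1) \<longlongrightarrow> exp (K * M\<^sup>2 * (1 - 1)) - 1) F"
      by (intro tendsto_intros Q1)
    then have "((\<lambda>x. T x * exp (qnum (Q x) a * Ln (1 + of_real (t x) * w)) - 1) \<longlongrightarrow> 0) F"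
      by (intro Lim_null_comparison[OF main]) simp
    then show ?thesis by (simp add: LIM_zero_iff)
  qed
  \<comment> \<open>Exchanges the exponent \<open>qnum (Q x) a\<close> for \<open>a\<close>.
    Convergence alone suffices here because the logarithm stays bounded while \<open>t\<close>
    does.\<close>
  have L2: "((\<lambda>x. exp ((a - qnum (Q x) a) * Ln (1 + of_real (t x) * w))) \<longlongrightarrow> 1) F"
  proof -
    define N where "N = \<bar>ln d\<bar> + (1 + \<bar>B\<bar> * norm w) + pi"
    have bd: "norm (Ln (1 + of_real (t x) * w)) \<le> N" if "0 < t x \<and> t x \<le> B" for x
    proof -
      define z where "z = 1 + of_real (t x) * w"
      have z: "norm z \<ge> d" "norm z > 0" using d(2)[of "t x"] d(1) that by (auto simp: z_def)
      have "norm z \<le> 1 + t x * norm w" using norm_triangle_ineq[of 1 "of_real (t x) * w"] that by (simp add: z_def norm_mult)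
      also have "\<dots> \<le> 1 + \<bar>B\<bar> * norm w" using that by (intro add_left_mono mult_right_mono) auto
      finally have z2: "norm z \<le> 1 + \<bar>B\<bar> * norm w" .
      have "ln d \<le> ln (norm z)" "ln (norm z) \<le> norm z" using z d ln_le_minus_one[of "norm z"] by auto
      then have "\<bar>ln (norm z)\<bar> \<le> \<bar>ln d\<bar> + (1 + \<bar>B\<bar> * norm w)" using z2 z by linarith
      moreover have "norm (Ln z) \<le> \<bar>Re (Ln z)\<bar> + \<bar>Im (Ln z)\<bar>" by (rule cmod_le)
      moreover have "Re (Ln z) = ln (norm z)" using z by (intro Re_Ln) auto
      moreover have "\<bar>Im (Ln z)\<bar> \<le> pi" using z mpi_less_Im_Ln[of z] Im_Ln_le_pi[of z] by auto
      ultimately show ?thesis by (simp add: N_def z_def)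
    qed
    have "((\<lambda>x. (a - qnum (Q x) a) * Ln (1 + of_real (t x) * w)) \<longlongrightarrow> 0) F"
    proof (rule Lim_null_comparison)
      show "eventually (\<lambda>x. norm ((a - qnum (Q x) a) * Ln (1 + of_real (t x) * w)) \<le> norm (a - qnum (Q x) a) * N) F"
        using t by (rule eventually_mono) (use bd in \<open>auto simp: norm_mult intro!: mult_left_mono\<close>)
      have "((\<lambda>x. norm (a - qnum (Q x) a) * N) \<longlongrightarrow> norm (a - a) * N) F"
        by (intro tendsto_intros qnum_tendsto[OF Q])
      then show "((\<lambda>x. norm (a - qnum (Q x) a) * N) \<longlongrightarrow> 0) F" by simp
    qed
    from tendsto_exp[OF this] show ?thesis by simp
  qed
  have "((\<lambda>x. T x * exp (qnum (Q x) a * Ln (1 + of_real (t x) * w)) * exp ((a - qnum (Q x) a) * Ln (1 + of_real (t x) * w))) \<longlongrightarrow> 1 * 1) F"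
    by (intro tendsto_mult L1 L2)
  moreover have "exp (qnum (Q x) a * Z) * exp ((a - qnum (Q x) a) * Z) = exp (a * Z)" for x Z
    unfolding exp_add[symmetric] by (simp add: algebra_simps)
  ultimately show ?thesis by (simp add: T_def mult.assoc)
qed

text \<open>The expression is invariant under \<open>t \<rightarrow> Q t\<close>, so that \<open>t\<close> may tend to 0: it can
  always be moved into \<open>[1/2, 1]\<close>.\<close>

lemma theta_ratio_limit:
  fixes w a :: complex and Q t :: "'x \<Rightarrow> real"
  assumes w: "w \<notin> \<real>\<^sub>\<le>\<^sub>0"
    and Q: "filterlim Q (at_left 1) F"
    and t: "eventually (\<lambda>x. 0 < t x) F"
  shows "((\<lambda>x. jprod (of_real (Q x)) (- (of_real (Q x) powr a * (of_real (t x) * w))) / jprod (of_real (Q x)) (- (of_real (t x) * w)) *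
           exp (a * Ln (of_real (t x) * w))) \<longlongrightarrow> 1) F"
proof -
  define R where "R q t = jprod (of_real q) (- (of_real q powr a * (of_real t * w))) / jprod (of_real q) (- (of_real t * w)) *
           exp (a * Ln (of_real t * w))" for q t :: real
  have w0: "w \<noteq> 0" using w by auto
  have iw: "1 / w \<notin> \<real>\<^sub>\<le>\<^sub>0"
    using w by (metis inverse_eq_divide nonpos_Reals_inverse_iff)
  \<comment> \<open>The integer part is chosen so that \<open>t = u * Q powi N\<close> with
    \<open>Q < u \<le> 1\<close>; note that \<open>ln (Q x)\<close> is negative.\<close>
  define N where "N x = \<lfloor>ln (t x) / ln (Q x)\<rfloor>" for x
  define u where "u x = exp (ln (t x) - of_int (N x) * ln (Q x))" for x
  have red: "eventually (\<lambda>x. R (Q x) (t x) = R (Q x) (u x) \<and> 1 / 2 < u x \<and> u x \<le> 1) F"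
    using at_left_1_half[OF Q] t
  proof eventually_elim
    case (elim x)
    define q where "q = Q x"
    have q: "1 / 2 < q" "q < 1" "q > 0" using elim by (auto simp: q_def)
    have lq: "ln q < 0" using q by simp
    have "of_int (N x) \<le> ln (t x) / ln q" "ln (t x) / ln q < of_int (N x) + 1"
      unfolding N_def q_def by linarith+
    then have "ln (t x) \<le> of_int (N x) * ln q" "(of_int (N x) + 1) * ln q < ln (t x)"
      using lq by (simp_all add: le_divide_eq divide_less_eq)
    then have lu: "ln q < ln (u x)" "ln (u x) \<le> 0" by (simp_all add: u_def q_def algebra_simps)
    have u0: "u x > 0" by (simp add: u_def)
    have u1: "q < u x" "u x \<le> 1" using lu u0 q by auto
    have tu: "t x = u x * q powi N x"
    proof -
      have "q powi N x = exp (of_int (N x) * ln q)"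
        using q exp_power_int[of "ln q" "N x"] by simp
      then show ?thesis using elim by (simp add: u_def q_def exp_diff)
    qed
    have Lnu: "Ln (of_real (t x) * w) = of_real (ln (t x)) + Ln w" "Ln (of_real (u x) * w) = of_real (ln (u x)) + Ln w"
      using elim u0 w0 Ln_times_of_real[of _ w] by (auto simp: Ln_of_real)
    have e: "exp (a * Ln (of_real (t x) * w)) = exp (a * Ln (of_real (u x) * w)) * (of_real q powr a) powi N x"
    proof -
      have "(of_real q powr a) powi N x = exp (of_int (N x) * (a * of_real (ln q)))"
        unfolding of_real_powr_eq_exp[OF q(3)] by (simp add: exp_power_int)
      then show ?thesis unfolding Lnu by (simp add: u_def q_def exp_add[symmetric] algebra_simps)
    qed
    have y: "- (of_real (t x) * w) = - (of_real (u x) * w) * of_real q powi N x"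
      "- (of_real q powr a * (of_real (t x) * w)) = of_real q powr a * (- (of_real (u x) * w) * of_real q powi N x)"
      by (simp_all add: tu mult_ac)
    have "R q (t x) = (of_real q powr a) powi (- N x) * (jprod (of_real q) (of_real q powr a * - (of_real (u x) * w)) / jprod (of_real q) (- (of_real (u x) * w))) *
        (exp (a * Ln (of_real (u x) * w)) * (of_real q powr a) powi N x)"
      unfolding R_def e y by (subst jprod_ratio_qpow) (use q u0 w0 in auto)
    also have "\<dots> = R q (u x)"
      using q by (simp add: R_def power_int_minus)
    finally show ?case using u1 q by (simp add: q_def)
  qed
  have uB: "eventually (\<lambda>x. 0 < u x \<and> u x \<le> 1) F" using red by (rule eventually_mono) auto
  have uB': "eventually (\<lambda>x. 0 < 1 / u x \<and> 1 / u x \<le> 2) F" using red by (rule eventually_mono) (auto simp: divide_simps)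
  define y where "y x = of_real (1 / u x) * (1 / w)" for x
  obtain d where d: "d > 0" "\<And>t::real. t \<ge> 0 \<Longrightarrow> norm (1 + of_real t * (1 / w)) \<ge> d"
    using ray_distance[OF iw] by blast
  define A where "A x = qinf (- (of_real (Q x) powr a * (of_real (u x) * w))) (of_real (Q x)) / qinf (- (of_real (u x) * w)) (of_real (Q x)) *
           exp (a * Ln (1 + of_real (u x) * w))" for x
  define B where "B x = qinf (- (of_real (Q x) powr (- a) * y x)) (of_real (Q x)) / qinf (- y x) (of_real (Q x)) *
           exp (- a * Ln (1 + y x))" for x
  \<comment> \<open>\<open>jprod\<close> needs the second product to start at \<open>q / y\<close>,
    whereas \<open>qbinomial_limit\<close> in the variable \<open>1 / y\<close> supplies one that
    starts at \<open>1 / y\<close>. \<open>C\<close> is the quotient of the two surplus first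
    factors.\<close>
  define C where "C x = (1 + of_real (Q x) powr (- a) * y x) / (1 + y x)" for x
  have A: "(A \<longlongrightarrow> 1) F"
    unfolding A_def by (rule qbinomial_limit[OF w Q uB])
  have B: "(B \<longlongrightarrow> 1) F"
    unfolding B_def y_def by (rule qbinomial_limit[OF iw Q uB'])
  have C: "(C \<longlongrightarrow> 1) F"
  proof -
    have Qa: "((\<lambda>x. 1 - of_real (Q x) powr (- a)) \<longlongrightarrow> 0) F"
    proof -
      have Q1: "(Q \<longlongrightarrow> 1) F" using Q by (simp add: filterlim_at)
      have "((\<lambda>x. of_real (1 - Q x) * qnum (Q x) (- a)) \<longlongrightarrow> of_real (1 - 1) * (- a)) F"
        by (intro tendsto_intros qnum_tendsto[OF Q] Q1)
      moreover have "eventually (\<lambda>x. of_real (1 - Q x) * qnum (Q x) (- a) = 1 - of_real (Q x) powr (- a)) F"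
        using at_left_1_half[OF Q] by (rule eventually_mono) (auto simp: qnum_def)
      ultimately show ?thesis using tendsto_cong by force
    qed
    have "((\<lambda>x. C x - 1) \<longlongrightarrow> 0) F"
    proof (rule Lim_null_comparison)
      show "eventually (\<lambda>x. norm (C x - 1) \<le> norm (1 - of_real (Q x) powr (- a)) * (2 * norm (1 / w) / d)) F"
        using uB'
      proof (rule eventually_mono)
        fix x assume x: "0 < 1 / u x \<and> 1 / u x \<le> 2"
        have n1: "norm (1 + y x) \<ge> d" unfolding y_def using x by (intro d(2)) auto
        then have nz: "1 + y x \<noteq> 0" using d(1) by auto
        have "norm (y x) = 1 / u x * norm (1 / w)" by (simp only: y_def norm_mult norm_of_real abs_of_pos[OF conjunct1[OF x]])
        also have "\<dots> \<le> 2 * norm (1 / w)" using x by (intro mult_right_mono) auto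
        finally have n2: "norm (y x) \<le> 2 * norm (1 / w)" .
        have "C x - 1 = - ((1 - of_real (Q x) powr (- a)) * (y x / (1 + y x)))"
          using nz by (simp add: C_def field_simps)
        then have "norm (C x - 1) = norm (1 - of_real (Q x) powr (- a)) * (norm (y x) / norm (1 + y x))"
          by (simp only: norm_minus_cancel norm_mult norm_divide)
        also have "\<dots> \<le> norm (1 - of_real (Q x) powr (- a)) * (2 * norm (1 / w) / d)"
          using n1 n2 d(1) by (intro mult_left_mono frac_le) auto
        finally show "norm (C x - 1) \<le> norm (1 - of_real (Q x) powr (- a)) * (2 * norm (1 / w) / d)" .
      qed
      have "((\<lambda>x. norm (1 - of_real (Q x) powr (- a)) * (2 * norm (1 / w) / d)) \<longlongrightarrow> norm (0::complex) * (2 * norm (1 / w) / d)) F"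
        by (intro tendsto_mult tendsto_norm Qa tendsto_const)
      then show "((\<lambda>x. norm (1 - of_real (Q x) powr (- a)) * (2 * norm (1 / w) / d)) \<longlongrightarrow> 0) F" by simp
    qed
    then show ?thesis by (simp add: LIM_zero_iff)
  qed
  have Cnz: "eventually (\<lambda>x. C x \<noteq> 0) F"
    by (rule tendsto_imp_eventually_ne[OF C]) simp
  have "eventually (\<lambda>x. A x * B x / C x = R (Q x) (t x)) F"
    using red at_left_1_half[OF Q] Cnz
  proof eventually_elim
    case (elim x)
    define q where "q = complex_of_real (Q x)"
    define Z where "Z = of_real (u x) * w"
    define P where "P = q powr a"
    have q: "norm q < 1" "q \<noteq> 0" using elim by (auto simp: q_def)
    have u0: "u x > 0" using elim by auto
    have Z0: "Z \<noteq> 0" using u0 w0 by (simp add: Z_def)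
    have P0: "P \<noteq> 0" using q by (simp add: P_def)
    have yZ: "y x = 1 / Z" by (simp add: y_def Z_def)
    have Pm: "q powr (- a) = 1 / P" by (simp add: P_def powr_minus inverse_eq_divide)
    have s: "qinf v q = (1 - v) * qinf (q * v) q" for v
      using qinf_split[OF q(1), of v 1] by (simp add: qpoch_Suc mult.commute)
    have j: "jprod q (- Y) = qinf (- Y) q * qinf (q * (- (1 / Y))) q" for Y
      by (simp add: jprod_def)
    \<comment> \<open>This merges the two powers: \<open>(1 + Z)^a\<close> against
      \<open>(1 + 1 / Z)^(-a)\<close> leaves \<open>Z^a\<close>, on the principal branch.\<close>
    have LnZ: "Ln (1 + y x) = Ln (1 + Z) - Ln Z"
    proof -
      have "1 + y x = (1 + Z) / Z" using Z0 by (simp add: yZ field_simps)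
      also have "Ln \<dots> = Ln (1 + Z) - Ln Z"
        using u0 w by (intro Ln_quotient) (auto simp: Z_def sgn_mult complex_nonpos_Reals_iff add_pos_pos)
      finally show ?thesis .
    qed
    have c0: "1 + 1 / P * (1 / Z) \<noteq> 0" "1 + 1 / Z \<noteq> 0"
      using elim(3) by (auto simp: C_def q_def[symmetric] Pm yZ)
    have "A x * B x / C x = qinf (- (P * Z)) q / qinf (- Z) q * (((1 + 1 / P * (1 / Z)) * qinf (q * - (1 / P * (1 / Z))) q) / ((1 + 1 / Z) * qinf (q * - (1 / Z)) q)) *
        (exp (a * Ln (1 + Z)) * exp (- a * Ln (1 + y x))) / ((1 + 1 / P * (1 / Z)) / (1 + 1 / Z))"
      unfolding A_def B_def C_def q_def[symmetric] Pm P_def[symmetric] Z_def[symmetric] yZ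
      using s[of "- (1 / P * (1 / Z))"] s[of "- (1 / Z)"] by (simp add: mult_ac)
    also have "exp (a * Ln (1 + Z)) * exp (- a * Ln (1 + y x)) = exp (a * Ln Z)"
      unfolding LnZ exp_add[symmetric] by (simp add: algebra_simps)
    also have "qinf (- (P * Z)) q / qinf (- Z) q * (((1 + 1 / P * (1 / Z)) * qinf (q * - (1 / P * (1 / Z))) q) / ((1 + 1 / Z) * qinf (q * - (1 / Z)) q)) *
        exp (a * Ln Z) / ((1 + 1 / P * (1 / Z)) / (1 + 1 / Z)) =
        jprod q (- (P * Z)) / jprod q (- Z) * exp (a * Ln Z)"
      unfolding j using c0 by simp
    finally show ?case
      using elim by (simp add: R_def q_def[symmetric] P_def[symmetric] Z_def[symmetric])
  qed
  moreover have "((\<lambda>x. A x * B x / C x) \<longlongrightarrow> 1 * 1 / 1) F"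
    by (intro tendsto_mult tendsto_divide A B C) simp
  ultimately show ?thesis
    unfolding R_def[symmetric] using tendsto_cong by force
qed

text \<open>Dominated convergence for infinite products. Only the tail is passed through
  \<open>Ln\<close>; the finitely many factors before \<open>K\<close> are treated as a plain
  product and may vanish, so the limit 0 is allowed. That case occurs when
  \<open>rGamma a = 0\<close>.\<close>

lemma tannery_prod:
  fixes f :: "nat \<Rightarrow> 'x \<Rightarrow> complex"
  assumes F: "F \<noteq> bot"
    and lim: "\<And>n. ((f n) \<longlongrightarrow> g n) F"
    and bound: "eventually (\<lambda>x. \<forall>n\<ge>N0. norm (f n x - 1) \<le> M n) F"
    and M: "summable M"
    and P: "eventually (\<lambda>x. (\<lambda>N. \<Prod>n<N. f n x) \<longlonglongrightarrow> P x) F"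
    and G: "(\<lambda>N. \<Prod>n<N. g n) \<longlonglongrightarrow> G"
  shows "(P \<longlongrightarrow> G) F"
proof -
  have "eventually (\<lambda>n. M n < 1 / 2) sequentially"
    by (rule order_tendstoD(2)[OF summable_LIMSEQ_zero[OF M]]) simp
  then obtain N1 where N1: "\<And>n. n \<ge> N1 \<Longrightarrow> M n < 1 / 2"
    by (auto simp: eventually_at_top_linorder)
  \<comment> \<open>Beyond \<open>K\<close> the factors differ from 1 by less than
    \<open>1 / 2\<close>, hence avoid the cut and satisfy
    \<open>norm (Ln z) \<le> 2 * norm (z - 1)\<close>.\<close>
  define K where "K = max N0 N1"
  have gM: "norm (g n - 1) \<le> M n" if "n \<ge> N0" for n
  proof (rule tendsto_upperbound)
    show "((\<lambda>x. norm (f n x - 1)) \<longlongrightarrow> norm (g n - 1)) F" by (intro tendsto_intros lim)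
    show "eventually (\<lambda>x. norm (f n x - 1) \<le> M n) F" using bound by (rule eventually_mono) (use that in auto)
  qed (rule F)
  have Lnb: "norm (Ln z) \<le> 2 * M n" "z \<notin> \<real>\<^sub>\<le>\<^sub>0" if "norm (z - 1) \<le> M n" "n \<ge> K" for z n
  proof -
    have n: "norm (z - 1) < 1 / 2" using that N1[of n] by (simp add: K_def)
    have "norm (Ln (1 + (z - 1))) \<le> 2 * norm (z - 1)" by (rule norm_Ln_le[OF n])
    then show "norm (Ln z) \<le> 2 * M n" using that by simp
    have "\<bar>Re z - 1\<bar> < 1 / 2" using abs_Re_le_cmod[of "z - 1"] n by simp
    then have "Re z > 0" by linarith
    then show "z \<notin> \<real>\<^sub>\<le>\<^sub>0" by (auto simp: complex_nonpos_Reals_iff)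
  qed
  have prodexp: "(\<lambda>N. \<Prod>n<N. h n) \<longlonglongrightarrow> (\<Prod>n<K. h n) * exp (\<Sum>n. Ln (h (n + K)))"
    if h: "\<And>n. n \<ge> K \<Longrightarrow> norm (h n - 1) \<le> M n" for h
  proof -
    have hb: "norm (Ln (h (n + K))) \<le> 2 * M (n + K)" for n by (rule Lnb(1)[OF h]) auto
    have "summable (\<lambda>n. 2 * M (n + K))" using M by (intro summable_mult summable_ignore_initial_segment)
    then have "summable (\<lambda>n. Ln (h (n + K)))"
      by (rule summable_comparison_test'[where N = 0]) (use hb in auto)
    then have "(\<lambda>N. \<Sum>n<N. Ln (h (n + K))) \<longlonglongrightarrow> (\<Sum>n. Ln (h (n + K)))" by (rule summable_LIMSEQ)
    then have "(\<lambda>N. (\<Prod>n<K. h n) * exp (\<Sum>n<N. Ln (h (n + K)))) \<longlonglongrightarrow> (\<Prod>n<K. h n) * exp (\<Sum>n. Ln (h (n + K)))"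
      by (intro tendsto_intros)
    moreover have "(\<Prod>n<K. h n) * exp (\<Sum>n<N. Ln (h (n + K))) = (\<Prod>n<N + K. h n)" for N
    proof -
      have "h (n + K) \<noteq> 0" for n using Lnb(2)[OF h, of "n + K"] by auto
      then have "exp (\<Sum>n<N. Ln (h (n + K))) = (\<Prod>n<N. h (n + K))" by (simp add: exp_sum)
      then show ?thesis using prod.nat_group[of h] by (induction N) (simp_all add: exp_sum mult_ac \<open>\<And>n. h (n + K) \<noteq> 0\<close>)
    qed
    ultimately have "(\<lambda>N. \<Prod>n<N + K. h n) \<longlonglongrightarrow> (\<Prod>n<K. h n) * exp (\<Sum>n. Ln (h (n + K)))" by simp
    then show ?thesis by (rule LIMSEQ_offset)
  qed
  have bound': "eventually (\<lambda>x. \<forall>n\<ge>K. norm (f n x - 1) \<le> M n) F"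
    using bound by (rule eventually_mono) (auto simp: K_def)
  have "((\<lambda>x. \<Sum>n. Ln (f (n + K) x)) \<longlongrightarrow> (\<Sum>n. Ln (g (n + K)))) F"
  proof -
    have "((\<lambda>x. Ln (f (n + K) x)) \<longlongrightarrow> Ln (g (n + K))) F" for n
      using lim[of "n + K"] Lnb(2)[OF gM, of "n + K"] by (intro tendsto_Ln) (auto simp: K_def)
    moreover have "eventually (\<lambda>(n, x). norm (Ln (f (n + K) x)) \<le> 2 * M (n + K)) (at_top \<times>\<^sub>F F)"
      unfolding eventually_prod_filter
      by (rule exI[of _ "\<lambda>_. True"], rule exI[of _ "\<lambda>x. \<forall>n\<ge>K. norm (f n x - 1) \<le> M n"])
         (use bound' Lnb(1) in auto)
    moreover have "summable (\<lambda>n. 2 * M (n + K))" using M by (intro summable_mult summable_ignore_initial_segment)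
    ultimately show ?thesis using tannerys_theorem[of "\<lambda>n x. Ln (f (n + K) x)" "\<lambda>n. Ln (g (n + K))" F "\<lambda>n. 2 * M (n + K)"] F by blast
  qed
  then have "((\<lambda>x. (\<Prod>n<K. f n x) * exp (\<Sum>n. Ln (f (n + K) x))) \<longlongrightarrow> (\<Prod>n<K. g n) * exp (\<Sum>n. Ln (g (n + K)))) F"
    by (intro tendsto_intros lim)
  moreover have "G = (\<Prod>n<K. g n) * exp (\<Sum>n. Ln (g (n + K)))"
    by (rule LIMSEQ_unique[OF G prodexp]) (use gM in \<open>auto simp: K_def\<close>)
  moreover have "eventually (\<lambda>x. (\<Prod>n<K. f n x) * exp (\<Sum>n. Ln (f (n + K) x)) = P x) F"
    using P bound'
  proof eventually_elim
    case (elim x)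
    show ?case by (rule LIMSEQ_unique[OF prodexp elim(1)]) (use elim in auto)
  qed
  ultimately show ?thesis using tendsto_cong by force
qed

text \<open>By summing the geometric series, \<open>1 + qeps n q = (1 - q ^ (n + 2)) / (1 - q ^ (n + 1))\<close> for
  \<open>q \<noteq> 1\<close>.\<close>

definition qeps :: "nat \<Rightarrow> real \<Rightarrow> real" where
  "qeps n q = q ^ Suc n / (\<Sum>j<Suc n. q ^ j)"

lemma geometric_sum_pos: "0 < q \<Longrightarrow> (\<Sum>j<Suc n. q ^ j) \<ge> (1 :: real)"
  unfolding sum.lessThan_Suc_shift by (simp add: sum_nonneg)

lemma qeps_bounds:
  assumes "0 < q" "q < 1"
  shows "0 < qeps n q" "qeps n q \<le> 1 / real (Suc n)"
proof -
  have S: "(\<Sum>j<Suc n. q ^ j) > 0" using geometric_sum_pos[OF assms(1), of n] by linarith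
  show "0 < qeps n q" using S assms by (simp add: qeps_def)
  have "real (Suc n) * q ^ Suc n = (\<Sum>j<Suc n. q ^ Suc n)" by simp
  also have "\<dots> \<le> (\<Sum>j<Suc n. q ^ j)" using assms by (intro sum_mono power_decreasing) auto
  finally show "qeps n q \<le> 1 / real (Suc n)"
    using S unfolding qeps_def by (simp add: divide_le_eq le_divide_eq mult.commute del: power_Suc of_nat_Suc)
qed

lemma qeps_tendsto:
  assumes "(Q \<longlongrightarrow> 1) F"
  shows "((\<lambda>x. qeps n (Q x)) \<longlongrightarrow> 1 / real (Suc n)) F"
proof -
  have "((\<lambda>x. qeps n (Q x)) \<longlongrightarrow> 1 ^ Suc n / (\<Sum>j<Suc n. 1 ^ j)) F"
    unfolding qeps_def by (intro tendsto_intros assms) simp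
  then show ?thesis by simp
qed

text \<open>From \<open>1 - q^(a+m) = (1 - q^m) + q^m (1 - q^a)\<close> with
  \<open>m = Suc n\<close>. The size of the q-number is split off and the dependence on
  \<open>a\<close> becomes a small relative correction, which serves both the Gamma product and the
  ratio bounds of series.\<close>

lemma qnum_shift:
  assumes "0 < q" "q < 1"
  shows "qnum q (a + of_nat (Suc n)) = of_real (\<Sum>j<Suc n. q ^ j) * (1 + qnum q a * of_real (qeps n q))"
proof -
  define S where "S = (\<Sum>j<Suc n. q ^ j)"
  have S: "S > 0" using geometric_sum_pos[OF assms(1), of n] by (simp add: S_def)
  have "1 - q ^ Suc n = (1 - q) * S" unfolding S_def by (rule one_diff_power_eq)
  then have 1: "1 - complex_of_real q ^ Suc n = of_real (1 - q) * of_real S"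
    by (metis of_real_1 of_real_diff of_real_mult of_real_power)
  have 2: "complex_of_real q powr (a + of_nat (Suc n)) = of_real q powr a * of_real q ^ Suc n"
    using assms by (simp only: powr_add powr_nat')
       (simp add: powr_nat' powr_add)
  have "1 - complex_of_real q powr (a + of_nat (Suc n)) = of_real (1 - q) * of_real S + of_real q ^ Suc n * (1 - of_real q powr a)"
    unfolding 2 1[symmetric] by (simp add: algebra_simps)
  also have "1 - of_real q powr a = of_real (1 - q) * qnum q a" using assms by (simp add: qnum_def)
  finally have "1 - complex_of_real q powr (a + of_nat (Suc n)) = of_real (1 - q) * (of_real S + of_real q ^ Suc n * qnum q a)"
    by (simp add: algebra_simps)
  then have "qnum q (a + of_nat (Suc n)) = of_real S + of_real q ^ Suc n * qnum q a"
    using assms by (simp add: qnum_def del: of_nat_Suc power_Suc)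
  also have "\<dots> = of_real S * (1 + qnum q a * of_real (qeps n q))"
  proof -
    have "complex_of_real (qeps n q) = of_real q ^ Suc n / of_real S"
      by (simp only: qeps_def S_def of_real_divide of_real_power)
    then show ?thesis using S by (simp add: field_simps)
  qed
  finally show ?thesis by (simp add: S_def)
qed

text \<open>Euler's product for \<open>1 / Gamma\<close>: the logarithms telescope to
  \<open>ln (Suc N)\<close> and the linear factors build a Pochhammer symbol.\<close>

lemma rGamma_product_limit:
  fixes a :: complex
  shows "(\<lambda>N. \<Prod>n<N. (1 + (a - 1) * of_real (1 / real (Suc n))) * exp (- (a - 1) * of_real (ln (1 + 1 / real (Suc n))))) \<longlonglongrightarrow> rGamma a"
proof -
  have p: "(\<Prod>n<N. (1 + (a - 1) * of_real (1 / real (Suc n))) * exp (- (a - 1) * of_real (ln (1 + 1 / real (Suc n))))) =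
      pochhammer a N / fact N * exp (- (a - 1) * of_real (ln (real (Suc N))))" for N
  proof (induction N)
    case (Suc N)
    have "(of_nat (Suc N) :: complex) \<noteq> 0" by (simp del: of_nat_Suc)
    moreover have "a + of_nat N = of_nat (Suc N) + (a - 1)" by simp
    ultimately have fac: "1 + (a - 1) * of_real (1 / real (Suc N)) = (a + of_nat N) / of_nat (Suc N)"
      by (simp only:) (simp add: add_divide_distrib del: of_nat_Suc)
    have lnS: "ln (1 + 1 / real (Suc N)) = ln (real (Suc (Suc N))) - ln (real (Suc N))"
    proof -
      have "1 + 1 / real (Suc N) = real (Suc (Suc N)) / real (Suc N)" by (simp add: field_simps)
      then show ?thesis by (simp add: ln_div del: of_nat_Suc)
    qed
    have e: "exp (- (a - 1) * of_real (ln (real (Suc N)))) * exp (- (a - 1) * of_real (ln (1 + 1 / real (Suc N)))) =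
       exp (- (a - 1) * of_real (ln (real (Suc (Suc N)))))"
      unfolding lnS exp_add[symmetric] by (simp add: algebra_simps del: of_nat_Suc)
    show ?case
      unfolding prod.lessThan_Suc Suc.IH fac pochhammer_Suc fact_Suc e[symmetric] by (simp add: mult_ac)
  qed simp
  \<comment> \<open>The partial product with \<open>n + 1\<close> factors differs from
    \<open>rGamma_series a n\<close> by \<open>(n / (n+2))^a * (n+2) / (n+1)\<close>, which tends to
    1.\<close>
  have "(\<lambda>n. rGamma_series a n * (exp (a * of_real (ln (real n) - ln (real (n + 2)))) * of_real (real (n + 2) / real (n + 1)))) \<longlonglongrightarrow> rGamma a * (exp (a * of_real 0) * of_real 1)"
  proof (intro tendsto_intros)
    show "(\<lambda>n. ln (real n) - ln (real (n + 2))) \<longlonglongrightarrow> 0"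
    proof -
      have "(\<lambda>n. - ln (1 + 2 * inverse (real n))) \<longlonglongrightarrow> - ln (1 + 2 * 0)"
        by (intro tendsto_intros lim_inverse_n) auto
      then have "(\<lambda>n. - ln (1 + 2 * inverse (real n))) \<longlonglongrightarrow> 0" by simp
      moreover have "eventually (\<lambda>n. - ln (1 + 2 * inverse (real n)) = ln (real n) - ln (real (n + 2))) sequentially"
        using eventually_gt_at_top[of 0]
      proof eventually_elim
        case (elim n)
        have "1 + 2 * inverse (real n) = real (n + 2) / real n" using elim by (simp add: field_simps)
        then show ?case using elim by (simp add: ln_div)
      qed
      ultimately show ?thesis by (rule Lim_transform_eventually)
    qed
    show "(\<lambda>n. real (n + 2) / real (n + 1)) \<longlonglongrightarrow> 1"
    proof -
      have "(\<lambda>n. 1 + inverse (real (Suc n))) \<longlonglongrightarrow> 1" by (rule LIMSEQ_inverse_real_of_nat_add)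
      moreover have "1 + inverse (real (Suc n)) = real (n + 2) / real (n + 1)" for n by (simp add: field_simps)
      ultimately show ?thesis by simp
    qed
  qed
  then have l: "(\<lambda>n. rGamma_series a n * (exp (a * of_real (ln (real n) - ln (real (n + 2)))) * of_real (real (n + 2) / real (n + 1)))) \<longlonglongrightarrow> rGamma a" by simp
  have "eventually (\<lambda>n. rGamma_series a n * (exp (a * of_real (ln (real n) - ln (real (n + 2)))) * of_real (real (n + 2) / real (n + 1))) =
      pochhammer a (Suc n) / fact (Suc n) * exp (- (a - 1) * of_real (ln (real (Suc (Suc n)))))) sequentially"
    using eventually_gt_at_top[of 0]
  proof eventually_elim
    case (elim n)
    have e: "exp (- (a - 1) * of_real (ln (real (n + 2)))) = exp (- a * of_real (ln (real (n + 2)))) * of_real (real (n + 2))"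
    proof -
      have "- (a - 1) * of_real (ln (real (n + 2))) = - a * of_real (ln (real (n + 2))) + of_real (ln (real (n + 2)))"
        by (simp add: algebra_simps)
      moreover have "exp (complex_of_real (ln (real (n + 2)))) = of_real (real (n + 2))"
        unfolding exp_of_real by simp
      ultimately show ?thesis by (simp only: exp_add)
    qed
    have e2: "exp (a * of_real (ln (real n) - ln (real (n + 2)))) = exp (a * of_real (ln (real n))) * exp (- a * of_real (ln (real (n + 2))))"
      unfolding exp_add[symmetric] by (simp add: algebra_simps)
    have s: "Suc (Suc n) = n + 2" "fact (Suc n) = (of_nat (n + 1) * fact n :: complex)" by simp_all
    show ?case
      unfolding rGamma_series_def s e e2 by (simp add: field_simps del: of_nat_add of_nat_Suc)
  qed
  from Lim_transform_eventually[OF l this]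
  have "(\<lambda>n. pochhammer a (Suc n) / fact (Suc n) * exp (- (a - 1) * of_real (ln (real (Suc (Suc n)))))) \<longlonglongrightarrow> rGamma a" .
  then have "(\<lambda>n. pochhammer a n / fact n * exp (- (a - 1) * of_real (ln (real (Suc n))))) \<longlonglongrightarrow> rGamma a"
    by (rule LIMSEQ_imp_Suc)
  then show ?thesis unfolding p .
qed

text \<open>The left-hand side is the reciprocal of Jackson's q-Gamma function. Working with
  reciprocals makes the poles of \<open>Gamma\<close> ordinary points.\<close>

lemma qGamma_limit:
  fixes a :: complex and Q :: "'x \<Rightarrow> real"
  assumes F: "F \<noteq> bot" and Q: "filterlim Q (at_left 1) F"
  shows "((\<lambda>x. qinf (of_real (Q x) powr a) (of_real (Q x)) / qinf (of_real (Q x)) (of_real (Q x)) *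
            exp ((a - 1) * of_real (ln (1 - Q x)))) \<longlongrightarrow> rGamma a) F"
proof -
  have Q1: "(Q \<longlongrightarrow> 1) F" using Q by (simp add: filterlim_at)
  \<comment> \<open>The factor \<open>(1 - q^(a+n)) / (1 - q^(n+1))\<close> is exactly
    \<open>1 + c * qeps n q\<close> for this \<open>c\<close>, by \<open>qnum_shift\<close> at
    \<open>a - 1\<close>.\<close>
  define c where "c x = qnum (Q x) (a - 1)" for x
  define f where "f n x = (1 + c x * of_real (qeps n (Q x))) * exp (- c x * of_real (ln (1 + qeps n (Q x))))" for n x
  define P where "P x = qinf (of_real (Q x) powr a) (of_real (Q x)) / qinf (of_real (Q x)) (of_real (Q x)) * exp (c x * of_real (ln (1 - Q x)))" for x
  obtain K where K: "K \<ge> 0" "\<And>c e :: complex. norm c \<le> norm (a - 1) + 1 \<Longrightarrow> norm e < 1 / 2 \<Longrightarrow> norm ((1 + c * e) * exp (- c * Ln (1 + e)) - 1) \<le> K * norm e ^ 2"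
    using binomial_factor_estimate[of "norm (a - 1) + 1"] by auto
  have "(P \<longlongrightarrow> rGamma a) F"
  proof (rule tannery_prod[OF F _ _ _ _ rGamma_product_limit])
    show "((f n) \<longlongrightarrow> (1 + (a - 1) * of_real (1 / real (Suc n))) * exp (- (a - 1) * of_real (ln (1 + 1 / real (Suc n))))) F" for n
      unfolding f_def c_def
      by (intro tendsto_intros qnum_tendsto[OF Q] qeps_tendsto[OF Q1]) (simp add: add_pos_pos less_imp_neq[symmetric])
    show "summable (\<lambda>n. K * (1 / real (Suc n)) ^ 2)"
      using inverse_power_summable[of 2, where 'a = real] summable_Suc_iff[of "\<lambda>n. inverse (real n ^ 2)"]
      by (intro summable_mult) (simp add: power_divide inverse_eq_divide del: of_nat_Suc)
    \<comment> \<open>The estimate needs \<open>qeps < 1 / 2\<close>, and the bound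
      \<open>1 / (n + 1)\<close> ensures this only from \<open>n = 2\<close> on.\<close>
    show "eventually (\<lambda>x. \<forall>n\<ge>2. norm (f n x - 1) \<le> K * (1 / real (Suc n)) ^ 2) F"
      using at_left_1_half[OF Q] qnum_bounded[OF Q, of "a - 1"]
    proof eventually_elim
      case (elim x)
      show ?case
      proof (intro allI impI)
        fix n :: nat assume n: "n \<ge> 2"
        define e where "e = qeps n (Q x)"
        have e: "0 < e" "e \<le> 1 / real (Suc n)" using qeps_bounds[of "Q x" n] elim by (auto simp: e_def)
        have "1 / real (Suc n) < 1 / 2" using n by (simp add: field_simps)
        then have "e < 1 / 2" using e by linarith
        then have "norm (complex_of_real e) < 1 / 2" using e by simp
        from K(2)[OF elim(2) this] have "norm ((1 + c x * of_real e) * exp (- c x * Ln (1 + of_real e)) - 1) \<le> K * e ^ 2"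
          using e by (simp add: c_def)
        also have "Ln (1 + of_real e) = of_real (ln (1 + e))"
          using e Ln_of_real[of "1 + e"] by simp
        also have "K * e ^ 2 \<le> K * (1 / real (Suc n)) ^ 2" using K(1) e by (intro mult_left_mono power_mono) auto
        finally show "norm (f n x - 1) \<le> K * (1 / real (Suc n)) ^ 2" by (simp add: f_def e_def)
      qed
    qed
    show "eventually (\<lambda>x. (\<lambda>N. \<Prod>n<N. f n x) \<longlonglongrightarrow> P x) F"
      using at_left_1_half[OF Q]
    proof eventually_elim
      case (elim x)
      define q where "q = Q x"
      have q: "0 < q" "q < 1" using elim by (auto simp: q_def)
      have qn: "norm (complex_of_real q) < 1" "complex_of_real q \<noteq> 0" using q by auto
      have q1: "complex_of_real q * of_real q ^ n \<noteq> 1" for n by (rule qpow_neq_1[OF qn(2,1)])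
      have S: "(\<Sum>j<Suc n. q ^ j) = (1 - q ^ Suc n) / (1 - q)" for n
        using one_diff_power_eq[of q "Suc n"] q by simp
      have pos: "1 - q ^ Suc n > 0" for n using q power_Suc_less_one[of q n] by simp
      have eps: "1 + qeps n q = (1 - q ^ Suc (Suc n)) / (1 - q ^ Suc n)" for n
        using pos[of n] q unfolding qeps_def S by (simp add: field_simps)
      have fac: "1 + c x * of_real (qeps n q) = (1 - of_real q powr a * of_real q ^ n) / (1 - of_real q * of_real q ^ n)" for n
      proof -
        have "qnum q ((a - 1) + of_nat (Suc n)) = of_real (\<Sum>j<Suc n. q ^ j) * (1 + c x * of_real (qeps n q))"
          unfolding c_def q_def[symmetric] by (rule qnum_shift[OF q])
        moreover have "(a - 1) + of_nat (Suc n) = a + of_nat n" by simp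
        moreover have "complex_of_real q powr (a + of_nat n) = of_real q powr a * of_real q ^ n"
          using q by (simp add: powr_add powr_nat')
        moreover have "complex_of_real (\<Sum>j<Suc n. q ^ j) = (1 - of_real q * of_real q ^ n) / of_real (1 - q)"
          unfolding S by simp
        ultimately have "(1 - of_real q powr a * of_real q ^ n) / of_real (1 - q) = (1 - of_real q * of_real q ^ n) / of_real (1 - q) * (1 + c x * of_real (qeps n q))"
          by (simp only: qnum_def)
        then show ?thesis using q q1[of n] by (simp add: field_simps)
      qed
      have prod: "(\<Prod>n<N. f n x) = qpoch (of_real q powr a) (of_real q) N / qpoch (of_real q) (of_real q) N *
          exp (- c x * of_real (ln (1 - q ^ Suc N) - ln (1 - q)))" for N
      proof (induction N)
        case (Suc N)
        have "ln (1 + qeps N q) = ln (1 - q ^ Suc (Suc N)) - ln (1 - q ^ Suc N)"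
          unfolding eps using pos[of N] pos[of "Suc N"] by (simp add: ln_div del: power_Suc)
        note lnS = this
        have e: "exp (- c x * of_real (ln (1 - q ^ Suc N) - ln (1 - q))) * exp (- c x * of_real (ln (1 + qeps N q))) =
            exp (- c x * of_real (ln (1 - q ^ Suc (Suc N)) - ln (1 - q)))"
          unfolding lnS exp_add[symmetric] by (simp add: algebra_simps del: power_Suc)
        show ?case
          unfolding prod.lessThan_Suc Suc.IH unfolding f_def q_def[symmetric] fac qpoch_Suc e[symmetric] by simp
      qed simp
      have "(\<lambda>N. q ^ Suc N) \<longlonglongrightarrow> 0"
        by (rule filterlim_compose[OF LIMSEQ_realpow_zero filterlim_Suc]) (use q in auto)
      then have "(\<lambda>N. ln (1 - q ^ Suc N)) \<longlonglongrightarrow> ln (1 - 0)" by (intro tendsto_intros) auto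
      then have "(\<lambda>N. qpoch (of_real q powr a) (of_real q) N / qpoch (of_real q) (of_real q) N *
          exp (- c x * of_real (ln (1 - q ^ Suc N) - ln (1 - q)))) \<longlonglongrightarrow>
          qinf (of_real q powr a) (of_real q) / qinf (of_real q) (of_real q) * exp (- c x * of_real (ln (1 - 0) - ln (1 - q)))"
        using q1 by (intro tendsto_mult tendsto_divide tendsto_exp tendsto_of_real tendsto_diff tendsto_const qpoch_tendsto_qinf qn)
          (auto simp: qinf_eq_0_iff[OF qn(1)])
      then show ?case unfolding prod by (simp add: P_def q_def)
    qed
  qed
  \<comment> \<open>Here \<open>ln (1 - Q x)\<close> is unbounded, so convergence of
    \<open>c\<close> is not enough and the rate in \<open>qnum_correction\<close> is used.\<close>
  moreover have "((\<lambda>x. exp (- ((c x - (a - 1)) * of_real (ln (1 - Q x))))) \<longlongrightarrow> exp (- 0)) F"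
    unfolding c_def by (intro tendsto_exp tendsto_minus qnum_correction[OF Q])
  ultimately have "((\<lambda>x. P x * exp (- ((c x - (a - 1)) * of_real (ln (1 - Q x))))) \<longlongrightarrow> rGamma a * exp (- 0)) F"
    by (rule tendsto_mult)
  moreover have "P x * exp (- ((c x - (a - 1)) * of_real (ln (1 - Q x)))) = qinf (of_real (Q x) powr a) (of_real (Q x)) / qinf (of_real (Q x)) (of_real (Q x)) *
            exp ((a - 1) * of_real (ln (1 - Q x)))" for x
    unfolding P_def mult.assoc exp_add[symmetric] by (simp add: algebra_simps)
  ultimately show ?thesis by simp
qed

section \<open>Limits of hypergeometric series\<close>

text \<open>The convergent term \<open>t x N\<close> is eventually below
  \<open>norm (g N) + 1\<close>, and the uniform ratio propagates this to a geometric majorant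
  independent of \<open>x\<close>.\<close>

lemma tannery_ratio:
  fixes t :: "'x \<Rightarrow> nat \<Rightarrow> complex"
  assumes F: "F \<noteq> bot"
    and lim: "\<And>m. ((\<lambda>x. t x m) \<longlongrightarrow> g m) F"
    and ratio: "eventually (\<lambda>x. \<forall>m\<ge>N. norm (t x (Suc m)) \<le> 1 / 2 * norm (t x m)) F"
  shows "((\<lambda>x. \<Sum>m. t x m) \<longlongrightarrow> (\<Sum>m. g m)) F"
proof -
  define M where "M m = (norm (g N) + 1) * 2 ^ N * (1 / 2) ^ m" for m :: nat
  have "eventually (\<lambda>x. norm (t x N) < norm (g N) + 1) F"
    by (rule order_tendstoD(2)[OF tendsto_norm[OF lim]]) simp
  with ratio have ev: "eventually (\<lambda>x. \<forall>m\<ge>N. norm (t x m) \<le> M m) F"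
  proof eventually_elim
    case (elim x)
    show ?case
    proof (intro allI impI)
      fix m assume "m \<ge> N"
      then show "norm (t x m) \<le> M m"
      proof (induction m rule: dec_induct)
        case base
        have "(2::real) ^ N * (1 / 2) ^ N = 1" by (simp add: power_mult_distrib[symmetric])
        then show ?case using elim(2) by (simp add: M_def mult.assoc)
      next
        case (step m)
        have "norm (t x (Suc m)) \<le> 1 / 2 * norm (t x m)" using elim(1) step by blast
        also have "\<dots> \<le> 1 / 2 * M m" using step by simp
        finally show ?case by (simp add: M_def)
      qed
    qed
  qed
  have "eventually (\<lambda>(m, x). norm (t x m) \<le> M m) (at_top \<times>\<^sub>F F)"
    unfolding eventually_prod_filter
    by (rule exI[of _ "\<lambda>m. m \<ge> N"], rule exI[of _ "\<lambda>x. \<forall>m\<ge>N. norm (t x m) \<le> M m"])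
       (use ev in \<open>auto simp: eventually_ge_at_top\<close>)
  moreover have "summable M" unfolding M_def by (intro summable_mult summable_geometric) simp
  ultimately show ?thesis
    using tannerys_theorem[of "\<lambda>m x. t x m" g F M] lim F by blast
qed

text \<open>Each factor \<open>1 - q^(a+m)\<close> contributes one \<open>1 - q\<close>; the
  \<open>k\<close> surplus factors of the denominator are compensated by \<open>(1 - q) ^ k\<close>
  in the argument. The ratio of consecutive terms is at most \<open>D / S ^ k\<close> with
  \<open>S\<close> the sum of \<open>q ^ j\<close> over \<open>j \<le> m\<close>, small uniformly in
  \<open>q\<close> near 1 once \<open>m\<close> is large.\<close>

lemma qhyp_limit:
  fixes A B :: "'i \<Rightarrow> complex" and Q :: "'x \<Rightarrow> real" and Y :: "'x \<Rightarrow> complex"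
  assumes F: "F \<noteq> bot" and Q: "filterlim Q (at_left 1) F" and Y: "(Y \<longlongrightarrow> y) F"
    and fin: "finite I" "finite J" and card: "card J = card I + k" "k \<ge> 1"
    and B: "\<And>v m. v \<in> J \<Longrightarrow> B v + of_nat m \<noteq> 0"
  shows "((\<lambda>x. \<Sum>m. (\<Prod>v\<in>I. qpoch (of_real (Q x) powr A v) (of_real (Q x)) m) /
             (\<Prod>v\<in>J. qpoch (of_real (Q x) powr B v) (of_real (Q x)) m) * (Y x * of_real ((1 - Q x) ^ k)) ^ m) \<longlongrightarrow>
           (\<Sum>m. (\<Prod>v\<in>I. pochhammer (A v) m) / (\<Prod>v\<in>J. pochhammer (B v) m) * y ^ m)) F"
proof -
  have Q1: "(Q \<longlongrightarrow> 1) F" using Q by (simp add: filterlim_at)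
  define t where "t x m = (\<Prod>v\<in>I. qpoch (of_real (Q x) powr A v) (of_real (Q x)) m) /
             (\<Prod>v\<in>J. qpoch (of_real (Q x) powr B v) (of_real (Q x)) m) * (Y x * of_real ((1 - Q x) ^ k)) ^ m" for x m
  define g where "g m = (\<Prod>v\<in>I. pochhammer (A v) m) / (\<Prod>v\<in>J. pochhammer (B v) m) * y ^ m" for m
  define \<rho> where "\<rho> x m = (\<Prod>v\<in>I. qnum (Q x) (A v + of_nat m)) / (\<Prod>v\<in>J. qnum (Q x) (B v + of_nat m)) * Y x" for x m
  have rec: "t x (Suc m) = t x m * \<rho> x m" if x: "1 / 2 < Q x \<and> Q x < 1" for x m
  proof -
    define q where "q = Q x"
    have q: "0 < q" "q < 1" using x by (auto simp: q_def)
    define d where "d = complex_of_real (1 - q)"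
    have d: "d \<noteq> 0" using q by (simp add: d_def)
    have f: "1 - of_real q powr a * of_real q ^ m = d * qnum q (a + of_nat m)" for a
      using q by (simp add: qnum_def d_def powr_add powr_nat')
    have p: "(\<Prod>v\<in>K. qpoch (of_real q powr a v) (of_real q) (Suc m)) =
        (\<Prod>v\<in>K. qpoch (of_real q powr a v) (of_real q) m) * (d ^ card K * (\<Prod>v\<in>K. qnum q (a v + of_nat m)))" for K and a :: "'i \<Rightarrow> complex"
      unfolding qpoch_Suc f prod.distrib by simp
    show ?thesis
      unfolding t_def \<rho>_def q_def[symmetric] p card(1) of_real_power d_def[symmetric] power_add
      using d by simp
  qed
  have lim: "((\<lambda>x. t x m) \<longlongrightarrow> g m) F" for m
  proof (induction m)
    case 0
    then show ?case by (simp add: t_def g_def)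
  next
    case (Suc m)
    have "((\<lambda>x. t x m * \<rho> x m) \<longlongrightarrow> g m * ((\<Prod>v\<in>I. A v + of_nat m) / (\<Prod>v\<in>J. B v + of_nat m) * y)) F"
      unfolding \<rho>_def using fin B by (intro tendsto_intros Suc.IH Y qnum_tendsto[OF Q]) auto
    moreover have "g m * ((\<Prod>v\<in>I. A v + of_nat m) / (\<Prod>v\<in>J. B v + of_nat m) * y) = g (Suc m)"
      by (simp add: g_def pochhammer_Suc prod.distrib)
    moreover have "eventually (\<lambda>x. t x m * \<rho> x m = t x (Suc m)) F"
      using at_left_1_half[OF Q] by (rule eventually_mono) (simp add: rec)
    ultimately show ?case using tendsto_cong by force
  qed
  \<comment> \<open>The parameters are lowered by 1 because \<open>qnum_shift\<close> is applied to
    \<open>a + m = (a - 1) + Suc m\<close>.\<close>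
  obtain C where C: "\<And>v. v \<in> I \<Longrightarrow> norm (A v - 1) + 1 \<le> C" "\<And>v. v \<in> J \<Longrightarrow> norm (B v - 1) + 1 \<le> C" "C \<ge> 0"
  proof
    show "norm (A v - 1) + 1 \<le> (\<Sum>v\<in>I. norm (A v - 1) + 1) + (\<Sum>v\<in>J. norm (B v - 1) + 1)" if "v \<in> I" for v
      using member_le_sum[of v I "\<lambda>v. norm (A v - 1) + 1"] that fin sum_nonneg[of J "\<lambda>v. norm (B v - 1) + 1"] by force
    show "norm (B v - 1) + 1 \<le> (\<Sum>v\<in>I. norm (A v - 1) + 1) + (\<Sum>v\<in>J. norm (B v - 1) + 1)" if "v \<in> J" for v
      using member_le_sum[of v J "\<lambda>v. norm (B v - 1) + 1"] that fin sum_nonneg[of I "\<lambda>v. norm (A v - 1) + 1"] by force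
    show "0 \<le> (\<Sum>v\<in>I. norm (A v - 1) + 1) + (\<Sum>v\<in>J. norm (B v - 1) + 1)"
      by (intro add_nonneg_nonneg sum_nonneg) auto
  qed
  define D where "D = 2 ^ (card I + card J) * (norm y + 1)"
  \<comment> \<open>The first bound keeps the relative correction of \<open>qnum_shift\<close> below
    \<open>1 / 2\<close>, so every q-number lies between \<open>S / 2\<close> and
    \<open>2 * S\<close> in norm. The second, together with \<open>S \<ge> N / 2\<close>, gives
    \<open>D / S \<le> 1 / 2\<close>.\<close>
  obtain N where N: "real N \<ge> 2 * C" "real N \<ge> 4 * D"
    using real_arch_simple[of "max (2 * C) (4 * D)"] by auto
  have evA: "eventually (\<lambda>x. \<forall>v\<in>I. norm (qnum (Q x) (A v - 1)) \<le> norm (A v - 1) + 1) F"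
    using fin by (intro eventually_ball_finite ballI qnum_bounded[OF Q])
  have evB: "eventually (\<lambda>x. \<forall>v\<in>J. norm (qnum (Q x) (B v - 1)) \<le> norm (B v - 1) + 1) F"
    using fin by (intro eventually_ball_finite ballI qnum_bounded[OF Q])
  have "((\<lambda>x. \<Sum>j<Suc N. Q x ^ j) \<longlongrightarrow> (\<Sum>j<Suc N. 1 ^ j)) F" by (intro tendsto_intros Q1)
  then have evS: "eventually (\<lambda>x. (\<Sum>j<Suc N. Q x ^ j) > real N / 2) F"
    by (rule order_tendstoD(1)) simp
  have evY: "eventually (\<lambda>x. norm (Y x) < norm y + 1) F"
    by (rule order_tendstoD(2)[OF tendsto_norm[OF Y]]) simp
  have ratio: "eventually (\<lambda>x. \<forall>m\<ge>N. norm (t x (Suc m)) \<le> 1 / 2 * norm (t x m)) F"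
    using at_left_1_half[OF Q] evA evB evS evY
  proof eventually_elim
    case (elim x)
    define q where "q = Q x"
    have q: "0 < q" "q < 1" using elim by (auto simp: q_def)
    show ?case
    proof (intro allI impI)
      fix m assume m: "m \<ge> N"
      define S where "S = (\<Sum>j<Suc m. q ^ j)"
      have S1: "S \<ge> 1" unfolding S_def by (rule geometric_sum_pos[OF q(1)])
      have "(\<Sum>j<Suc N. q ^ j) \<le> S" unfolding S_def using m q by (intro sum_mono2) auto
      then have SN: "S \<ge> real N / 2" using elim(4) by (simp add: q_def)
      have small: "norm (qnum q (a - 1) * of_real (qeps m q)) \<le> 1 / 2" if a: "norm (qnum q (a - 1)) \<le> C" for a
      proof -
        have e: "0 < qeps m q" "qeps m q \<le> 1 / real (Suc m)" by (rule qeps_bounds[OF q])+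
        have "norm (qnum q (a - 1) * of_real (qeps m q)) = norm (qnum q (a - 1)) * qeps m q"
          using e by (simp add: norm_mult)
        also have "\<dots> \<le> C * (1 / real (Suc m))" using a e C(3) by (intro mult_mono) auto
        also have "\<dots> \<le> 1 / 2"
        proof -
          have "2 * C \<le> real (Suc m)" using N(1) m by linarith
          then show ?thesis by (simp add: divide_le_eq)
        qed
        finally show ?thesis .
      qed
      have shift: "qnum q (a + of_nat m) = of_real S * (1 + qnum q (a - 1) * of_real (qeps m q))" for a
        using qnum_shift[OF q, of "a - 1" m] by (simp add: S_def)
      have up: "norm (qnum q (a + of_nat m)) \<le> 2 * S" if "norm (qnum q (a - 1)) \<le> C" for a
      proof -
        have "norm (1 + qnum q (a - 1) * of_real (qeps m q)) \<le> 1 + 1 / 2"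
          using norm_triangle_ineq[of 1 "qnum q (a - 1) * of_real (qeps m q)"] small[OF that] by simp
        then have "S * norm (1 + qnum q (a - 1) * of_real (qeps m q)) \<le> S * 2" using S1 by (intro mult_left_mono) auto
        then show ?thesis unfolding shift norm_mult using S1 by simp
      qed
      have low: "norm (qnum q (a + of_nat m)) \<ge> S / 2" if "norm (qnum q (a - 1)) \<le> C" for a
      proof -
        have "norm (1 + qnum q (a - 1) * of_real (qeps m q)) \<ge> 1 / 2"
          using norm_diff_ineq[of 1 "qnum q (a - 1) * of_real (qeps m q)"] small[OF that] by simp
        then have "S * (1 / 2) \<le> S * norm (1 + qnum q (a - 1) * of_real (qeps m q))" using S1 by (intro mult_left_mono) auto
        then show ?thesis unfolding shift norm_mult using S1 by simp
      qed
      have num: "norm (\<Prod>v\<in>I. qnum q (A v + of_nat m)) \<le> (2 * S) ^ card I"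
      proof -
        have "(\<Prod>v\<in>I. norm (qnum q (A v + of_nat m))) \<le> (\<Prod>v\<in>I. 2 * S)"
          using elim(2) C(1) by (intro prod_mono conjI norm_ge_zero up) (force simp: q_def)
        then show ?thesis by (simp add: prod_norm)
      qed
      have den: "norm (\<Prod>v\<in>J. qnum q (B v + of_nat m)) \<ge> (S / 2) ^ card J"
      proof -
        have "(\<Prod>v\<in>J. S / 2) \<le> (\<Prod>v\<in>J. norm (qnum q (B v + of_nat m)))"
          using elim(3) C(2) S1 by (intro prod_mono conjI low) (force simp: q_def)+
        then show ?thesis by (simp add: prod_norm)
      qed
      have "norm (\<rho> x m) = norm (\<Prod>v\<in>I. qnum q (A v + of_nat m)) / norm (\<Prod>v\<in>J. qnum q (B v + of_nat m)) * norm (Y x)"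
        by (simp only: \<rho>_def q_def norm_mult norm_divide)
      also have "\<dots> \<le> (2 * S) ^ card I / (S / 2) ^ card J * (norm y + 1)"
        using num den S1 elim(5) by (intro mult_mono frac_le) auto
      also have "\<dots> = D / S ^ k"
        using S1 by (simp add: card(1) D_def power_add power_mult_distrib power_divide field_simps)
      also have "\<dots> \<le> D / S"
        using S1 self_le_power[of S k] card(2) by (intro divide_left_mono) (auto simp: D_def)
      also have "\<dots> \<le> 1 / 2"
      proof -
        have "2 * D \<le> S" using SN N(2) by linarith
        then show ?thesis using S1 by (simp add: divide_le_eq)
      qed
      finally have r: "norm (\<rho> x m) \<le> 1 / 2" .
      have "norm (t x (Suc m)) = norm (\<rho> x m) * norm (t x m)"
        using rec[of x m] elim(1) by (simp add: norm_mult)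
      also have "\<dots> \<le> 1 / 2 * norm (t x m)" by (rule mult_right_mono[OF r]) simp
      finally show "norm (t x (Suc m)) \<le> 1 / 2 * norm (t x m)" .
    qed
  qed
  show ?thesis
    using tannery_ratio[OF F lim ratio] unfolding t_def g_def .
qed

text \<open>Off the cut \<open>\<bar>Arg w\<bar> < pi\<close>, so \<open>Arg u - Arg w\<close> is
  the argument of \<open>u / w\<close> within \<open>pi\<close> of \<open>Arg u\<close>. This
  identifies the branch prescribed for \<open>- x\<close> with the difference of principal
  logarithms delivered by the theta limits.\<close>

lemma powr_near_quotient:
  assumes "u \<noteq> 0" "w \<notin> \<real>\<^sub>\<le>\<^sub>0"
  shows "powr_near (Arg u) (u / w) a = exp (a * (Ln u - Ln w))"
proof -
  have w: "w \<noteq> 0" using assms by auto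
  have "\<bar>Arg w\<bar> < pi"
    using Im_Ln_less_pi[OF assms(2)] mpi_less_Im_Ln[OF w] Arg_eq_Im_Ln[OF w] by auto
  moreover have polar: "u / w = rcis (norm (u / w)) (Arg u - Arg w)"
  proof -
    have "rcis (norm u) (Arg u) / rcis (norm w) (Arg w) = rcis (norm (u / w)) (Arg u - Arg w)"
      by (simp add: rcis_divide norm_divide)
    moreover have "rcis (norm z) (Arg z) = z" if "z \<noteq> 0" for z
      using Arg_eq[OF that] by (simp add: rcis_def cis_conv_exp)
    ultimately show ?thesis using assms w by simp
  qed
  ultimately have ex: "u / w = rcis (norm (u / w)) (Arg u - Arg w) \<and> \<bar>(Arg u - Arg w) - Arg u\<bar> < pi" by simp
  have "arg_near (Arg u) (u / w) = Arg u - Arg w"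
    unfolding arg_near_def
  proof (rule the_equality)
    show "u / w = rcis (norm (u / w)) (Arg u - Arg w) \<and> \<bar>(Arg u - Arg w) - Arg u\<bar> < pi" by (rule ex)
    fix t assume t: "u / w = rcis (norm (u / w)) t \<and> \<bar>t - Arg u\<bar> < pi"
    have "rcis (norm (u / w)) t = rcis (norm (u / w)) (Arg u - Arg w)" using t polar by metis
    moreover have "norm (u / w) \<noteq> 0" using assms w by simp
    ultimately have "cis t = cis (Arg u - Arg w)" unfolding rcis_def by (metis mult_cancel_left of_real_eq_0_iff)
    then have "exp (\<i> * of_real t) = exp (\<i> * of_real (Arg u - Arg w))" by (simp only: cis_conv_exp)
    then obtain n :: int where "\<i> * of_real t = \<i> * of_real (Arg u - Arg w) + (of_int (2 * n) * pi) * \<i>"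
      unfolding exp_eq by blast
    then have "Im (\<i> * of_real t) = Im (\<i> * of_real (Arg u - Arg w) + (of_int (2 * n) * pi) * \<i>)" by (simp only:)
    then have tn: "t = Arg u - Arg w + of_int (2 * n) * pi" by simp
    have "\<bar>of_int (2 * n) * pi\<bar> < 2 * pi"
      using t \<open>\<bar>Arg w\<bar> < pi\<close> unfolding tn by linarith
    then have "\<bar>real_of_int n\<bar> < 1" by (simp add: abs_mult)
    then have "n = 0" by linarith
    then show "t = Arg u - Arg w" using tn by simp
  qed
  then have "powr_near (Arg u) (u / w) a = exp (a * (of_real (ln (norm (u / w))) + \<i> * of_real (Arg u - Arg w)))"
    by (simp add: powr_near_def)
  also have "of_real (ln (norm (u / w))) + \<i> * of_real (Arg u - Arg w) = Ln u - Ln w"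
    using assms w by (simp add: Ln_Arg norm_divide ln_div algebra_simps)
  finally show ?thesis .
qed

lemma prod_list_map_omit_nth:
  fixes f :: "'a \<Rightarrow> complex"
  assumes "j < length xs"
  shows "prod_list (map f (omit_nth j xs)) = (\<Prod>v\<in>{..<length xs} - {j}. f (xs ! v))"
  using assms
proof (induction xs arbitrary: j)
  case (Cons x xs)
  have shift: "(\<Prod>v\<in>Suc ` A. f ((x # xs) ! v)) = (\<Prod>v\<in>A. f (xs ! v))" for A
    by (subst prod.reindex) (auto simp: inj_on_def)
  have all: "prod_list (map f xs) = (\<Prod>v<length xs. f (xs ! v))"
    by (subst prod.list_conv_set_nth) (auto intro!: prod.cong simp: atLeast0LessThan)
  show ?case
  proof (cases j)
    case 0
    have "{..<length (x # xs)} - {0} = Suc ` {..<length xs}" by (auto simp: image_iff less_Suc_eq_0_disj)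
    then show ?thesis by (simp add: 0 omit_nth_def all shift)
  next
    case (Suc i)
    have "{..<length (x # xs)} - {Suc i} = insert 0 (Suc ` ({..<length xs} - {i}))"
      by (auto simp: image_iff less_Suc_eq_0_disj)
    then have "(\<Prod>v\<in>{..<length (x # xs)} - {Suc i}. f ((x # xs) ! v)) = f x * (\<Prod>v\<in>{..<length xs} - {i}. f (xs ! v))"
      by (simp add: shift)
    moreover have "omit_nth (Suc i) (x # xs) = x # omit_nth i xs" by (simp add: omit_nth_def)
    ultimately show ?thesis using Cons Suc by simp
  qed
qed simp

text \<open>Equality of the powers means \<open>a * ln q = n * ln q + 2 * pi * \<i> * m\<close>.
  Near \<open>q = 1\<close> the imaginary part of the left side is below \<open>2 * pi\<close>,
  whatever \<open>n\<close> is, hence \<open>m = 0\<close>.\<close>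

lemma powr_eq_qpow_imp:
  fixes a :: complex
  shows
  "eventually (\<lambda>q::real. \<forall>n::int. of_real q powr a = of_real q powi n \<longrightarrow> a = of_int n) (at_left 1)"
proof -
  have "((\<lambda>q::real. \<bar>Im a\<bar> * \<bar>ln q\<bar>) \<longlongrightarrow> \<bar>Im a\<bar> * \<bar>ln 1\<bar>) (at_left 1)"
    by (intro tendsto_intros) auto
  then have "eventually (\<lambda>q::real. \<bar>Im a\<bar> * \<bar>ln q\<bar> < 2 * pi) (at_left 1)"
    by (rule order_tendstoD) simp
  with at_left_1_half[OF filterlim_ident] show ?thesis
  proof eventually_elim
    case (elim q)
    have q: "q > 0" "ln q < 0" using elim by auto
    show ?case
    proof (intro allI impI)
      fix n :: int assume eq: "of_real q powr a = (of_real q :: complex) powi n"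
      have "(of_real q :: complex) powi n = exp (of_int n * of_real (ln q))"
        using exp_power_int[of "complex_of_real (ln q)" n] q by (simp add: exp_of_real)
      with eq have "exp (a * of_real (ln q)) = exp (of_int n * of_real (ln q))"
        by (simp add: of_real_powr_eq_exp[OF q(1)])
      then obtain m :: int where m: "a * of_real (ln q) = of_int n * of_real (ln q) + (of_int (2 * m) * pi) * \<i>"
        unfolding exp_eq by blast
      then have "Im (a * of_real (ln q)) = Im (of_int n * of_real (ln q) + (of_int (2 * m) * pi) * \<i>)" by (simp only:)
      then have "Im a * ln q = of_int (2 * m) * pi" by simp
      then have "\<bar>of_int (2 * m) * pi\<bar> < 2 * pi" using elim(2) by (metis abs_mult)
      then have "\<bar>real_of_int m\<bar> < 1" by (simp add: abs_mult)
      then have "m = 0" by linarith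
      with m q show "a = of_int n" by simp
    qed
  qed
qed

text \<open>Converting to q-Gamma functions leaves powers of \<open>1 - q\<close>: the
  \<open>s + k\<close> quotients in \<open>\<alpha>\<close> and the \<open>s\<close> quotients in
  \<open>\<beta>\<close> contribute the exponents \<open>\<alpha> ! j\<close> and
  \<open>- \<alpha> ! j\<close> each, in total \<open>k * \<alpha> ! j\<close>.\<close>

lemma conn_const_limit:
  fixes \<alpha> \<beta> :: "complex list"
  assumes \<alpha>: "\<And>i j. i < length \<alpha> \<Longrightarrow> j < length \<alpha> \<Longrightarrow> i \<noteq> j \<Longrightarrow> \<alpha> ! i - \<alpha> ! j \<notin> \<int>"
    and \<beta>: "\<And>i. i < length \<beta> \<Longrightarrow> \<beta> ! i \<notin> \<int>\<^sub>\<le>\<^sub>0"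
    and k: "length \<alpha> = length \<beta> + 1 + k"
    and j: "j < length \<alpha>"
  shows "((\<lambda>q. conn_const (length \<alpha>) (length \<beta>) (\<lambda>i. of_real q powr \<alpha> ! i) (\<lambda>i. of_real q powr \<beta> ! i) (of_real q) j *
            exp (of_nat k * (\<alpha> ! j * of_real (ln (1 - q))))) \<longlongrightarrow> conn_coeff \<alpha> \<beta> j) (at_left 1)"
proof -
  define L where "L q = complex_of_real (ln (1 - q))" for q
  define I where "I = {..<length \<alpha>} - {j}"
  define G where "G a q = qinf (of_real q powr a) (of_real q) / qinf (of_real q) (of_real q) * exp ((a - 1) * L q)" for a q
  have G: "((G a) \<longlongrightarrow> rGamma a) (at_left 1)" for a
    unfolding G_def L_def by (rule qGamma_limit[OF trivial_limit_at_left_real filterlim_ident])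
  have c: "card I = length \<beta> + k" using j k by (simp add: I_def)
  have "((\<lambda>q. (\<Prod>i\<in>I. G (\<alpha> ! i) q / G (\<alpha> ! i - \<alpha> ! j) q) * (\<Prod>l<length \<beta>. G (\<beta> ! l - \<alpha> ! j) q / G (\<beta> ! l) q)) \<longlongrightarrow>
     (\<Prod>i\<in>I. rGamma (\<alpha> ! i) / rGamma (\<alpha> ! i - \<alpha> ! j)) * (\<Prod>l<length \<beta>. rGamma (\<beta> ! l - \<alpha> ! j) / rGamma (\<beta> ! l))) (at_left 1)"
  proof (intro tendsto_mult tendsto_prod tendsto_divide G)
    fix i assume "i \<in> I"
    then have "\<alpha> ! i - \<alpha> ! j \<notin> \<int>" using \<alpha> j by (auto simp: I_def)
    then show "rGamma (\<alpha> ! i - \<alpha> ! j) \<noteq> 0" using nonpos_Ints_Int by (auto simp: rGamma_eq_zero_iff)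
  qed (use \<beta> in \<open>auto simp: rGamma_eq_zero_iff\<close>)
  also have "(\<Prod>i\<in>I. rGamma (\<alpha> ! i) / rGamma (\<alpha> ! i - \<alpha> ! j)) * (\<Prod>l<length \<beta>. rGamma (\<beta> ! l - \<alpha> ! j) / rGamma (\<beta> ! l)) =
      conn_coeff \<alpha> \<beta> j"
    by (simp add: conn_coeff_def I_def[symmetric] divide_inverse prod.distrib rGamma_inverse_Gamma mult_ac)
  finally have lim: "((\<lambda>q. (\<Prod>i\<in>I. G (\<alpha> ! i) q / G (\<alpha> ! i - \<alpha> ! j) q) * (\<Prod>l<length \<beta>. G (\<beta> ! l - \<alpha> ! j) q / G (\<beta> ! l) q)) \<longlongrightarrow>
      conn_coeff \<alpha> \<beta> j) (at_left 1)" .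
  have "eventually (\<lambda>q. (\<Prod>i\<in>I. G (\<alpha> ! i) q / G (\<alpha> ! i - \<alpha> ! j) q) * (\<Prod>l<length \<beta>. G (\<beta> ! l - \<alpha> ! j) q / G (\<beta> ! l) q) =
     conn_const (length \<alpha>) (length \<beta>) (\<lambda>i. of_real q powr \<alpha> ! i) (\<lambda>i. of_real q powr \<beta> ! i) (of_real q) j *
            exp (of_nat k * (\<alpha> ! j * L q))) (at_left 1)"
    using at_left_1_half[OF filterlim_ident]
  proof eventually_elim
    case (elim q)
    have q: "q > 0" "q < 1" using elim by auto
    have nz: "qinf (of_real q) (of_real q) \<noteq> 0"
      using qpow_neq_1[of "complex_of_real q"] q by (subst qinf_eq_0_iff) auto
    have GG: "G a q / G b q = qinf (of_real q powr a) (of_real q) / qinf (of_real q powr b) (of_real q) * exp ((a - b) * L q)" for a b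
    proof -
      have "exp ((a - 1) * L q) = exp ((a - b) * L q) * exp ((b - 1) * L q)"
        unfolding exp_add[symmetric] by (simp add: algebra_simps)
      then show ?thesis using nz by (simp add: G_def)
    qed
    have d: "complex_of_real q powr (a - b) = of_real q powr a / of_real q powr b" for a b
      by (rule powr_diff)
    have 1: "(\<Prod>i\<in>I. G (\<alpha> ! i) q / G (\<alpha> ! i - \<alpha> ! j) q) =
       (\<Prod>i\<in>I. qinf (of_real q powr \<alpha> ! i) (of_real q) / qinf (of_real q powr \<alpha> ! i / of_real q powr \<alpha> ! j) (of_real q)) * exp (\<alpha> ! j * L q) ^ (length \<beta> + k)"
      unfolding GG d prod.distrib by (simp add: c)
    have 2: "(\<Prod>l<length \<beta>. G (\<beta> ! l - \<alpha> ! j) q / G (\<beta> ! l) q) =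
       (\<Prod>l<length \<beta>. qinf (of_real q powr \<beta> ! l / of_real q powr \<alpha> ! j) (of_real q) / qinf (of_real q powr \<beta> ! l) (of_real q)) * exp (- (\<alpha> ! j * L q)) ^ length \<beta>"
      unfolding GG d prod.distrib by simp
    have 3: "exp (\<alpha> ! j * L q) ^ (length \<beta> + k) * exp (- (\<alpha> ! j * L q)) ^ length \<beta> = exp (of_nat k * (\<alpha> ! j * L q))"
      unfolding exp_of_nat_mult power_add exp_minus by (simp add: field_simps)
    show ?case unfolding 1 2 conn_const_def I_def[symmetric] 3[symmetric] by (simp only: mult_ac)
  qed
  from Lim_transform_eventually[OF lim this] show ?thesis by (simp add: L_def)
qed

lemma of_real_powr_tendsto_1:
  "((\<lambda>q. complex_of_real q powr c) \<longlongrightarrow> 1) (at_left 1)"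
proof -
  have "((\<lambda>q. exp (c * of_real (ln q))) \<longlongrightarrow> exp (c * of_real (ln 1))) (at_left 1)"
    by (intro tendsto_intros) auto
  moreover have "eventually (\<lambda>q. exp (c * of_real (ln q)) = complex_of_real q powr c) (at_left 1)"
    using at_left_1_half[OF filterlim_ident] by (rule eventually_mono) (simp add: of_real_powr_eq_exp)
  ultimately show ?thesis using tendsto_cong by force
qed

lemma conn_arg_limit:
  fixes \<alpha> \<beta> :: "complex list"
  assumes k: "length \<alpha> = length \<beta> + 1 + k" and j: "j < length \<alpha>"
  shows "((\<lambda>q. conn_arg (length \<alpha>) (length \<beta>) (\<lambda>i. of_real q powr \<alpha> ! i) (\<lambda>i. of_real q powr \<beta> ! i) (of_real q) j) \<longlongrightarrow> (- 1) ^ k) (at_left 1)"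
proof -
  have c: "card ({..<length \<alpha>} - {j}) = length \<beta> + k" using j k by simp
  have "((\<lambda>q. conn_arg (length \<alpha>) (length \<beta>) (\<lambda>i. of_real q powr \<alpha> ! i) (\<lambda>i. of_real q powr \<beta> ! i) (of_real q) j) \<longlongrightarrow>
     of_real 1 / 1 * (\<Prod>l<length \<beta>. - (1 / 1)) / (\<Prod>i'\<in>{..<length \<alpha>} - {j}. - (1 / 1))) (at_left 1)"
    unfolding conn_arg_def by (intro tendsto_intros of_real_powr_tendsto_1) auto
  also have "of_real 1 / 1 * (\<Prod>l<length \<beta>. - (1 / 1)) / (\<Prod>i'\<in>{..<length \<alpha>} - {j}. - (1 / 1)) = (- 1 :: complex) ^ k"
    using c by (simp add: power_add) (cases "even k"; simp)
  finally show ?thesis .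
qed

section \<open>Termwise limit of the closed form\<close>

theorem theorem3p2:
  fixes r s k :: nat
    and \<alpha> \<beta> :: "complex list"
    and l x :: complex
  assumes "length \<alpha> = r" and "length \<beta> = s"
    and "r > s + 1" and "k = r - s - 1"
    and "\<And>i j. i < r \<Longrightarrow> j < r \<Longrightarrow> i \<noteq> j \<Longrightarrow> \<alpha> ! i - \<alpha> ! j \<notin> \<int>"
    and "\<And>i. i < s \<Longrightarrow> \<beta> ! i \<notin> \<int>\<^sub>\<le>\<^sub>0"
    and "l \<noteq> 0" and "l \<notin> {(-1) ^ k * complex_of_real t | t. t > 0}"
    and "x \<noteq> 0" and "x \<notin> {(-1) ^ (k + 1) * l * complex_of_real t | t. t > 0}"
  shows
    "((\<lambda>q::real.
         rfs (map (\<lambda>a. complex_of_real q powr a) \<alpha>) (map (\<lambda>b. complex_of_real q powr b) \<beta>) l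
           (complex_of_real q) ((-1) ^ k * x / complex_of_real ((1 - q) ^ k)))
      \<longlongrightarrow> (\<Sum>j<r. conn_coeff \<alpha> \<beta> j *
             powr_near (Arg ((-1) ^ (k - 1) * l)) (- x) (- (\<alpha> ! j)) *
             hypergeom_F (\<alpha> ! j # map (\<lambda>b. 1 + \<alpha> ! j - b) \<beta>)
               (map (\<lambda>a. 1 + \<alpha> ! j - a) (omit_nth j \<alpha>)) ((-1) ^ k / x)))
     (at_left 1)"
proof -
  note \<alpha> = assms(5) and \<beta> = assms(6)
  have k: "r = s + 1 + k" "k \<ge> 1" using assms(3,4) by auto
  have len: "length \<alpha> = r" "length \<beta> = s" by fact+
  define sg where "sg = (- 1 :: complex) ^ k"
  have sg: "sg * sg = 1" "sg \<noteq> 0" by (simp_all add: sg_def power_mult_distrib[symmetric])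
  define z0 where "z0 = sg * l"
  \<comment> \<open>The factorisation \<open>- x = u / w\<close> separates the two ray conditions:
    the one on \<open>l\<close> keeps \<open>u\<close> off the cut, the one on \<open>x\<close>
    keeps \<open>w\<close> off it. The centre of the branch is \<open>Arg u\<close>.\<close>
  define u where "u = - z0"
  define w where "w = sg * l / x"
  have u_eq: "(- 1) ^ (k - 1) * l = u"
    using k(2) by (cases k) (simp_all add: u_def z0_def sg_def)
  have u0: "u \<noteq> 0" using assms(7) sg by (simp add: u_def z0_def)
  have u_ray: "u \<notin> \<real>\<^sub>\<le>\<^sub>0"
  proof
    assume "u \<in> \<real>\<^sub>\<le>\<^sub>0"
    then obtain t where t: "u = of_real t" "t \<le> 0" by (auto elim!: nonpos_Reals_cases)
    then have "l = sg * of_real (- t)" using sg unfolding u_def z0_def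
      by (metis minus_minus mult.assoc mult_1 of_real_minus)
    moreover have "- t > 0" using t u0 by auto
    ultimately show False using assms(8) unfolding sg_def by blast
  qed
  have w_ray: "w \<notin> \<real>\<^sub>\<le>\<^sub>0"
  proof
    assume "w \<in> \<real>\<^sub>\<le>\<^sub>0"
    then obtain t where t: "w = of_real t" "t \<le> 0" by (auto elim!: nonpos_Reals_cases)
    have "t \<noteq> 0" using t assms(7,9) sg by (auto simp: w_def)
    then have "x = (- 1) ^ (k + 1) * l * of_real (- (1 / t))"
      using t assms(7,9) unfolding w_def sg_def by (simp add: field_simps)
    moreover have "- (1 / t) > 0" using t \<open>t \<noteq> 0\<close> by simp
    ultimately show False using assms(10) by blast
  qed
  have w0: "w \<noteq> 0" using w_ray by auto
  have uw: "- x = u / w" using sg assms(7,9) by (simp add: u_def z0_def w_def)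
  define as bs where "as q = map (\<lambda>a. complex_of_real q powr a) \<alpha>" and "bs q = map (\<lambda>b. complex_of_real q powr b) \<beta>" for q
  define a b where "a q i = complex_of_real q powr \<alpha> ! i" and "b q i = complex_of_real q powr \<beta> ! i" for q i
  define X where "X q = sg * x / complex_of_real ((1 - q) ^ k)" for q
  define D where "D q i = conn_arg r s (a q) (b q) (of_real q) i" for q i
  \<comment> \<open>The part of \<open>E i\<close> with a finite limit; the remaining
    \<open>(1 - q) ^ k\<close> is what \<open>qhyp_limit\<close> asks for and also makes
    \<open>E i\<close> tend to 0.\<close>
  define Y where "Y i q = D q i / (a q i ^ k * x)" for i q
  define E where "E i q = Y i q * of_real ((1 - q) ^ k)" for i q
  define K where "K i q = conn_const r s (a q) (b q) (of_real q) i" for i q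
  define T1 where "T1 i q = jprod (of_real q) (a q i * z0) / jprod (of_real q) z0" for i q
  define T2 where "T2 i q = qtheta (of_real q ^ k) (l / (a q i ^ k * X q)) / qtheta (of_real q ^ k) (l / X q)" for i q
  define H where "H i q = (\<Sum>m. conn_ser r s (a q) (b q) (of_real q) i m * E i q ^ m)" for i q
  have nths: "i < r \<Longrightarrow> as q ! i = a q i" "i' < s \<Longrightarrow> bs q ! i' = b q i'" for i i' q
    using len by (simp_all add: as_def bs_def a_def b_def)

  have Ylim: "((Y i) \<longlongrightarrow> sg / x) (at_left 1)" if i: "i < r" for i
  proof -
    have "((\<lambda>q. D q i / (a q i ^ k * x)) \<longlongrightarrow> sg / (1 ^ k * x)) (at_left 1)"
      unfolding D_def a_def b_def using conn_arg_limit[of \<alpha> \<beta> k i] i k len assms(9)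
      by (intro tendsto_intros of_real_powr_tendsto_1) (auto simp: sg_def)
    then show ?thesis by (simp add: Y_def[abs_def])
  qed
  have q1: "((\<lambda>q. (1 - q) ^ k) \<longlongrightarrow> (0::real)) (at_left 1)"
  proof -
    have "((\<lambda>q. (1 - q) ^ k) \<longlongrightarrow> (1 - 1 :: real) ^ k) (at_left 1)" by (intro tendsto_intros)
    then show ?thesis using k(2) by (simp add: power_0_left)
  qed
  have Eev: "eventually (\<lambda>q. norm (E i q) < 1) (at_left 1)" if i: "i < r" for i
  proof -
    have "((\<lambda>q. norm (E i q)) \<longlongrightarrow> norm (sg / x * of_real 0)) (at_left 1)"
      unfolding E_def by (intro tendsto_intros Ylim i q1)
    then show ?thesis by (rule order_tendstoD) simp
  qed

  have Hlim: "((H i) \<longlongrightarrow> hypergeom_F (\<alpha> ! i # map (\<lambda>b. 1 + \<alpha> ! i - b) \<beta>)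
               (map (\<lambda>a. 1 + \<alpha> ! i - a) (omit_nth i \<alpha>)) (sg / x)) (at_left 1)" if i: "i < r" for i
  proof -
    define A where "A v = (case v of 0 \<Rightarrow> \<alpha> ! i | Suc n \<Rightarrow> 1 + \<alpha> ! i - \<beta> ! n)" for v
    \<comment> \<open>The index \<open>v = i\<close> is kept: it gives \<open>B i = 1\<close>, hence
      \<open>qpoch q q m\<close> before the limit and the factorial of \<open>hypergeom_F\<close>
      after it.\<close>
    define B where "B v = 1 + \<alpha> ! i - \<alpha> ! v" for v
    have Bnz: "B v + of_nat m \<noteq> 0" if "v < r" for v m
    proof
      assume *: "B v + of_nat m = 0"
      show False
      proof (cases "v = i")
        case True
        with * have "complex_of_nat (Suc m) = 0" by (simp add: B_def add.commute)
        then show False by (simp del: of_nat_Suc)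
      next
        case False
        from * have "\<alpha> ! v - \<alpha> ! i = of_nat (Suc m)" by (simp add: B_def algebra_simps)
        then show False using \<alpha>[OF that i False] by (metis Ints_of_nat)
      qed
    qed
    have lim: "((\<lambda>q. \<Sum>m. (\<Prod>v\<in>{..<Suc s}. qpoch (of_real q powr A v) (of_real q) m) /
             (\<Prod>v\<in>{..<r}. qpoch (of_real q powr B v) (of_real q) m) * (Y i q * of_real ((1 - q) ^ k)) ^ m) \<longlongrightarrow>
           (\<Sum>m. (\<Prod>v\<in>{..<Suc s}. pochhammer (A v) m) / (\<Prod>v\<in>{..<r}. pochhammer (B v) m) * (sg / x) ^ m)) (at_left 1)"
      by (rule qhyp_limit[OF trivial_limit_at_left_real filterlim_ident Ylim[OF i]]) (use k Bnz in auto)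
    have rhs: "(\<Sum>m. (\<Prod>v\<in>{..<Suc s}. pochhammer (A v) m) / (\<Prod>v\<in>{..<r}. pochhammer (B v) m) * (sg / x) ^ m) =
       hypergeom_F (\<alpha> ! i # map (\<lambda>b. 1 + \<alpha> ! i - b) \<beta>) (map (\<lambda>a. 1 + \<alpha> ! i - a) (omit_nth i \<alpha>)) (sg / x)"
    proof -
      have pl: "prod_list (map f \<beta>) = (\<Prod>l<s. f (\<beta> ! l))" for f :: "complex \<Rightarrow> complex"
        by (subst prod.list_conv_set_nth) (auto intro!: prod.cong simp: len atLeast0LessThan)
      have "(\<Prod>v\<in>{..<Suc s}. pochhammer (A v) m) = (\<Prod>a\<leftarrow>\<alpha> ! i # map (\<lambda>b. 1 + \<alpha> ! i - b) \<beta>. pochhammer a m)" for m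
        unfolding prod.lessThan_Suc_shift
        by (simp add: A_def pl o_def)
      moreover have "(\<Prod>v\<in>{..<r}. pochhammer (B v) m) = (\<Prod>b\<leftarrow>map (\<lambda>a. 1 + \<alpha> ! i - a) (omit_nth i \<alpha>). pochhammer b m) * fact m" for m
      proof -
        have "(\<Prod>v\<in>{..<r}. pochhammer (B v) m) = pochhammer (B i) m * (\<Prod>v\<in>{..<r} - {i}. pochhammer (B v) m)"
          by (rule prod.remove) (use i in auto)
        moreover have "pochhammer (B i) m = fact m" by (simp add: B_def pochhammer_fact)
        moreover have "(\<Prod>b\<leftarrow>map (\<lambda>a. 1 + \<alpha> ! i - a) (omit_nth i \<alpha>). pochhammer b m) = (\<Prod>v\<in>{..<r} - {i}. pochhammer (B v) m)"
          using prod_list_map_omit_nth[of i \<alpha> "\<lambda>a. pochhammer (1 + \<alpha> ! i - a) m"] i len by (simp add: B_def o_def)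
        ultimately show ?thesis by simp
      qed
      ultimately show ?thesis by (simp only: hypergeom_F_def)
    qed
    have ev: "eventually (\<lambda>q. (\<Sum>m. (\<Prod>v\<in>{..<Suc s}. qpoch (of_real q powr A v) (of_real q) m) /
             (\<Prod>v\<in>{..<r}. qpoch (of_real q powr B v) (of_real q) m) * (Y i q * of_real ((1 - q) ^ k)) ^ m) = H i q) (at_left 1)"
      using at_left_1_half[OF filterlim_ident]
    proof eventually_elim
      case (elim q)
      have q: "q > 0" using elim by simp
      have pw: "complex_of_real q powr (1 + c - d) = of_real q * of_real q powr c / of_real q powr d" for c d
        using q by (simp add: powr_diff powr_add)
      have "(\<Prod>v\<in>{..<Suc s}. qpoch (of_real q powr A v) (of_real q) m) =
          qpoch (a q i) (of_real q) m * (\<Prod>l<s. qpoch (of_real q * a q i / b q l) (of_real q) m)" for m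
        unfolding prod.lessThan_Suc_shift by (simp add: A_def a_def b_def pw)
      moreover have "(\<Prod>v\<in>{..<r}. qpoch (of_real q powr B v) (of_real q) m) =
          qpoch (of_real q) (of_real q) m * (\<Prod>v\<in>{..<r} - {i}. qpoch (of_real q * a q i / a q v) (of_real q) m)" for m
      proof -
        have "(\<Prod>v\<in>{..<r}. qpoch (of_real q powr B v) (of_real q) m) =
            qpoch (of_real q powr B i) (of_real q) m * (\<Prod>v\<in>{..<r} - {i}. qpoch (of_real q powr B v) (of_real q) m)"
          by (rule prod.remove) (use i in auto)
        moreover have "of_real q powr B i = of_real q" using q by (simp add: B_def)
        ultimately show ?thesis by (simp add: B_def a_def pw)
      qed
      ultimately show ?case by (simp only: H_def conn_ser_def E_def)
    qed
    show ?thesis using Lim_transform_eventually[OF lim ev] unfolding rhs .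
  qed

  \<comment> \<open>Three theta and Gamma asymptotics meet: \<open>K\<close> carries
    \<open>(1 - q)\<close> to the power \<open>- k * \<alpha> ! i\<close>, \<open>T1\<close> tends
    to \<open>u\<close> to the power \<open>- \<alpha> ! i\<close>, and \<open>T2\<close> behaves
    like \<open>(1 - q) ^ k * w\<close> to the power \<open>\<alpha> ! i\<close>. The powers of
    \<open>1 - q\<close> cancel.\<close>
  have Plim: "((\<lambda>q. K i q * T1 i q * T2 i q) \<longlongrightarrow> conn_coeff \<alpha> \<beta> i * exp (- (\<alpha> ! i) * (Ln u - Ln w))) (at_left 1)" if i: "i < r" for i
  proof -
    define L where "L q = complex_of_real (ln (1 - q))" for q
    have Kl: "((\<lambda>q. K i q * exp (of_nat k * (\<alpha> ! i * L q))) \<longlongrightarrow> conn_coeff \<alpha> \<beta> i) (at_left 1)"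
      unfolding K_def a_def b_def L_def using conn_const_limit[of \<alpha> \<beta> k i] \<alpha> \<beta> k i len by simp
    have T1l: "((\<lambda>q. T1 i q * exp (\<alpha> ! i * Ln u)) \<longlongrightarrow> 1) (at_left 1)"
      using theta_ratio_limit[OF u_ray filterlim_ident, of "\<lambda>_. 1" "\<alpha> ! i"]
      by (simp add: T1_def a_def u_def)
    have Qk: "filterlim (\<lambda>q::real. q ^ k) (at_left 1) (at_left 1)"
    proof -
      have "((\<lambda>q::real. q ^ k) \<longlongrightarrow> 1 ^ k) (at_left 1)" by (intro tendsto_intros)
      moreover have "eventually (\<lambda>q::real. q ^ k \<in> {..<1} \<and> q ^ k \<noteq> 1) (at_left 1)"
      proof (rule eventually_mono[OF at_left_1_half[OF filterlim_ident]])
        fix q :: real assume "1 / 2 < q \<and> q < 1"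
        then have "q ^ k < 1" using k(2) by (simp add: power_less_one_iff)
        then show "q ^ k \<in> {..<1} \<and> q ^ k \<noteq> 1" by simp
      qed
      ultimately show ?thesis by (simp add: filterlim_at)
    qed
    have tpos: "eventually (\<lambda>q::real. 0 < (1 - q) ^ k) (at_left 1)"
      using at_left_1_half[OF filterlim_ident] by (rule eventually_mono) simp
    \<comment> \<open>The theta limit in base \<open>p = q ^ k\<close> with exponent
      \<open>- \<alpha> ! i\<close>, for which \<open>p powr (- \<alpha> ! i)\<close> is the shift
      \<open>1 / a q i ^ k\<close>. The scale \<open>t = (1 - q) ^ k\<close> tends to 0.\<close>
    have "((\<lambda>q. jprod (of_real (q ^ k)) (- (of_real (q ^ k) powr (- (\<alpha> ! i)) * (of_real ((1 - q) ^ k) * w))) / jprod (of_real (q ^ k)) (- (of_real ((1 - q) ^ k) * w)) *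
           exp (- (\<alpha> ! i) * Ln (of_real ((1 - q) ^ k) * w))) \<longlongrightarrow> 1) (at_left 1)"
      by (rule theta_ratio_limit[OF w_ray Qk tpos])
    moreover have "eventually (\<lambda>q. jprod (of_real (q ^ k)) (- (of_real (q ^ k) powr (- (\<alpha> ! i)) * (of_real ((1 - q) ^ k) * w))) / jprod (of_real (q ^ k)) (- (of_real ((1 - q) ^ k) * w)) *
           exp (- (\<alpha> ! i) * Ln (of_real ((1 - q) ^ k) * w)) = T2 i q * exp (- (\<alpha> ! i) * (of_nat k * L q + Ln w))) (at_left 1)"
      using at_left_1_half[OF filterlim_ident]
    proof eventually_elim
      case (elim q)
      have q: "q > 0" "q < 1" using elim by auto
      define p where "p = complex_of_real q ^ k"
      have p: "p \<noteq> 0" "norm p < 1" using q k(2) by (auto simp: p_def norm_power power_less_one_iff)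
      have lX: "l / X q = of_real ((1 - q) ^ k) * w"
        using sg q assms(9) by (simp add: X_def w_def field_simps)
      have pa: "of_real (q ^ k) powr (- (\<alpha> ! i)) = 1 / a q i ^ k"
      proof -
        have "of_real (q ^ k) powr (- (\<alpha> ! i)) = exp (- (\<alpha> ! i) * of_real (ln (q ^ k)))"
          using q by (intro of_real_powr_eq_exp) simp
        also have "\<dots> = exp (- (of_nat k * (\<alpha> ! i * of_real (ln q))))"
          using q by (simp add: ln_realpow mult_ac)
        also have "\<dots> = 1 / a q i ^ k"
          using of_real_powr_eq_exp[OF q(1), of "\<alpha> ! i"] by (simp add: a_def exp_minus exp_of_nat_mult inverse_eq_divide)
        finally show ?thesis .
      qed
      have aX: "l / (a q i ^ k * X q) = of_real (q ^ k) powr (- (\<alpha> ! i)) * (of_real ((1 - q) ^ k) * w)"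
        unfolding pa lX[symmetric] by (simp add: mult.commute)
      have nz: "l / X q \<noteq> 0" "l / (a q i ^ k * X q) \<noteq> 0"
        using w0 q by (simp_all only: lX aX) (simp_all add: a_def)
      have qq: "qinf p p \<noteq> 0" using qpow_neq_1[OF p] p by (auto simp: qinf_eq_0_iff)
      have "T2 i q = jprod p (- (l / (a q i ^ k * X q))) / jprod p (- (l / X q))"
        unfolding T2_def p_def[symmetric] using jacobi_triple_product[OF p nz(1)] jacobi_triple_product[OF p nz(2)] qq by simp
      moreover have "Ln (of_real ((1 - q) ^ k) * w) = of_nat k * L q + Ln w"
      proof -
        have t: "Ln (of_real t * w) = of_real (ln t) + Ln w" if "t > 0" for t
          using Ln_times_of_real[OF that w0] Ln_of_real[OF that] by simp
        have "complex_of_real (ln ((1 - q) ^ k)) = of_nat k * L q"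
          using q by (simp add: L_def ln_realpow)
        then show ?thesis using q by (subst t) auto
      qed
      ultimately show ?case unfolding lX aX by (simp add: p_def)
    qed
    ultimately have T2l: "((\<lambda>q. T2 i q * exp (- (\<alpha> ! i) * (of_nat k * L q + Ln w))) \<longlongrightarrow> 1) (at_left 1)"
      using tendsto_cong by force
    have "((\<lambda>q. (K i q * exp (of_nat k * (\<alpha> ! i * L q))) * (T1 i q * exp (\<alpha> ! i * Ln u)) *
        (T2 i q * exp (- (\<alpha> ! i) * (of_nat k * L q + Ln w))) * exp (- (\<alpha> ! i) * (Ln u - Ln w))) \<longlongrightarrow>
        conn_coeff \<alpha> \<beta> i * 1 * 1 * exp (- (\<alpha> ! i) * (Ln u - Ln w))) (at_left 1)"
      by (intro tendsto_mult Kl T1l T2l tendsto_const)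
    moreover have "(K i q * exp (of_nat k * (\<alpha> ! i * L q))) * (T1 i q * exp (\<alpha> ! i * Ln u)) *
        (T2 i q * exp (- (\<alpha> ! i) * (of_nat k * L q + Ln w))) * exp (- (\<alpha> ! i) * (Ln u - Ln w)) = K i q * T1 i q * T2 i q" for q
    proof -
      have "exp (of_nat k * (\<alpha> ! i * L q)) * exp (\<alpha> ! i * Ln u) * exp (- (\<alpha> ! i) * (of_nat k * L q + Ln w)) * exp (- (\<alpha> ! i) * (Ln u - Ln w)) = 1"
        unfolding exp_add[symmetric] by (simp add: algebra_simps)
      then have "K i q * T1 i q * T2 i q * (exp (of_nat k * (\<alpha> ! i * L q)) * exp (\<alpha> ! i * Ln u) * exp (- (\<alpha> ! i) * (of_nat k * L q + Ln w)) * exp (- (\<alpha> ! i) * (Ln u - Ln w))) = K i q * T1 i q * T2 i q"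
        by simp
      then show ?thesis by (simp only: mult_ac)
    qed
    ultimately show ?thesis by (simp only: mult_1_right)
  qed

  \<comment> \<open>The hypotheses on \<open>\<alpha>\<close> and \<open>\<beta>\<close> do not
    exclude coincidences for every \<open>q\<close> when the parameters are complex; near
    \<open>q = 1\<close> they do.\<close>
  have ev_aa: "eventually (\<lambda>q. \<forall>i\<in>{..<r}. \<forall>j\<in>{..<r}. i \<noteq> j \<longrightarrow> (\<forall>n. a q i / a q j \<noteq> of_real q powi n)) (at_left 1)"
  proof (intro eventually_ball_finite ballI)
    fix i j assume ij: "i \<in> {..<r}" "j \<in> {..<r}"
    show "eventually (\<lambda>q. i \<noteq> j \<longrightarrow> (\<forall>n. a q i / a q j \<noteq> of_real q powi n)) (at_left 1)"
      using powr_eq_qpow_imp[of "\<alpha> ! i - \<alpha> ! j"]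
    proof eventually_elim
      case (elim q)
      show ?case
      proof (intro impI allI notI)
        fix n assume "i \<noteq> j" "a q i / a q j = of_real q powi n"
        with elim have "\<alpha> ! i - \<alpha> ! j = of_int n" by (simp add: a_def powr_diff)
        with \<alpha>[of i j] ij \<open>i \<noteq> j\<close> show False by auto
      qed
    qed
  qed auto
  have ev_b: "eventually (\<lambda>q. \<forall>l'\<in>{..<s}. \<forall>j. b q l' * of_real q ^ j \<noteq> 1) (at_left 1)"
  proof (intro eventually_ball_finite ballI)
    fix l' assume l': "l' \<in> {..<s}"
    show "eventually (\<lambda>q. \<forall>j. b q l' * of_real q ^ j \<noteq> 1) (at_left 1)"
      using powr_eq_qpow_imp[of "\<beta> ! l'"] at_left_1_half[OF filterlim_ident]
    proof eventually_elim
      case (elim q)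
      show ?case
      proof (intro allI notI)
        fix j assume "b q l' * of_real q ^ j = 1"
        then have "b q l' = inverse (of_real q ^ j)" by (metis inverse_unique mult.commute)
        then have "complex_of_real q powr \<beta> ! l' = of_real q powi (- int j)"
          by (simp only: b_def power_int_minus power_int_of_nat)
        with elim have "\<beta> ! l' = of_int (- int j)" by blast
        with \<beta>[of l'] l' show False by simp
      qed
    qed
  qed auto
  have ev_E: "eventually (\<lambda>q. \<forall>i\<in>{..<r}. norm (E i q) < 1) (at_left 1)"
    using Eev by (intro eventually_ball_finite) auto

  have evF: "eventually (\<lambda>q. (\<Sum>i<r. K i q * T1 i q * T2 i q * H i q) = rfs (as q) (bs q) l (of_real q) (X q)) (at_left 1)"
    using at_left_1_half[OF filterlim_ident] ev_aa ev_b ev_E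
  proof eventually_elim
    case (elim q)
    define Q where "Q = complex_of_real q"
    have q: "q > 0" "q < 1" using elim by auto
    have Q: "Q \<noteq> 0" "norm Q < 1" using q by (auto simp: Q_def)
    have X0: "X q \<noteq> 0" using sg assms(9) q by (simp add: X_def)
    have lenq: "length (as q) = r" "length (bs q) = s" using len by (simp_all add: as_def bs_def)
    have cc: "conn_const r s ((!) (as q)) ((!) (bs q)) Q i = K i q"
      "conn_ser r s ((!) (as q)) ((!) (bs q)) Q i m = conn_ser r s (a q) (b q) Q i m"
      "conn_arg r s ((!) (as q)) ((!) (bs q)) Q i = D q i" if "i < r" for i m
      unfolding conn_const_def conn_ser_def conn_arg_def K_def D_def Q_def using that
      by (simp_all add: nths)
    have EE: "(- 1) ^ k * conn_arg r s ((!) (as q)) ((!) (bs q)) Q i / (as q ! i ^ k * X q) = E i q" if i: "i < r" for i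
      unfolding cc(3)[OF i] nths(1)[OF i] E_def Y_def X_def sg_def[symmetric] using sg(2) by simp
    have "rfs (as q) (bs q) l Q (X q) =
      (\<Sum>i<r. conn_const r s ((!) (as q)) ((!) (bs q)) Q i * (jprod Q (as q ! i * z0) / jprod Q z0) *
       (qtheta (Q ^ k) (l / (as q ! i ^ k * X q)) / qtheta (Q ^ k) (l / X q)) *
       (\<Sum>m. conn_ser r s ((!) (as q)) ((!) (bs q)) Q i m * ((- 1) ^ k * conn_arg r s ((!) (as q)) ((!) (bs q)) Q i / (as q ! i ^ k * X q)) ^ m))"
      unfolding lenq[symmetric] z0_def sg_def
    proof (rule rfs_closed_form[OF Q], unfold lenq)
      show "as q ! i \<noteq> 0" if "i < r" for i using nths(1)[OF that] q by (simp add: a_def)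
      show "bs q ! i \<noteq> 0" if "i < s" for i using nths(2)[OF that] q by (simp add: b_def)
      show "as q ! i / as q ! j \<noteq> Q powi n" if "i < r" "j < r" "i \<noteq> j" for i j n
        using elim(2) that by (simp add: nths Q_def)
      show "bs q ! i * Q ^ j \<noteq> 1" if "i < s" for i j
        using elim(3) that by (simp add: nths Q_def)
      show "norm ((- 1) ^ k * conn_arg r s ((!) (as q)) ((!) (bs q)) Q i / (as q ! i ^ k * X q)) < 1" if "i < r" for i
        using EE[OF that] elim(4) that by simp
      \<comment> \<open>For real \<open>q\<close> the whole spiral lies on the positive axis, so the
        excluded ray for \<open>l\<close> covers all \<open>q\<close> at once.\<close>
      show "(- 1) ^ k * l \<noteq> Q powi n" for n
      proof
        assume "(- 1) ^ k * l = Q powi n"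
        then have "l = (- 1) ^ k * of_real (q powi n)" using sg unfolding sg_def[symmetric] Q_def
          by (metis mult.assoc mult_1 of_real_power_int)
        moreover have "q powi n > 0" using q by simp
        ultimately show False using assms(8) by blast
      qed
    qed (use k assms(7) X0 in auto)
    also have "\<dots> = (\<Sum>i<r. K i q * T1 i q * T2 i q * H i q)"
    proof (intro sum.cong refl)
      fix i assume "i \<in> {..<r}"
      then have i: "i < r" by simp
      show "conn_const r s ((!) (as q)) ((!) (bs q)) Q i * (jprod Q (as q ! i * z0) / jprod Q z0) *
       (qtheta (Q ^ k) (l / (as q ! i ^ k * X q)) / qtheta (Q ^ k) (l / X q)) *
       (\<Sum>m. conn_ser r s ((!) (as q)) ((!) (bs q)) Q i m * ((- 1) ^ k * conn_arg r s ((!) (as q)) ((!) (bs q)) Q i / (as q ! i ^ k * X q)) ^ m) =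
        K i q * T1 i q * T2 i q * H i q"
        unfolding EE[OF i] unfolding cc(1,2)[OF i] nths(1)[OF i] unfolding T1_def T2_def H_def Q_def by (rule refl)
    qed
    finally show ?case by (simp add: Q_def)
  qed
  have limF: "((\<lambda>q. \<Sum>i<r. K i q * T1 i q * T2 i q * H i q) \<longlongrightarrow>
      (\<Sum>i<r. conn_coeff \<alpha> \<beta> i * exp (- (\<alpha> ! i) * (Ln u - Ln w)) * hypergeom_F (\<alpha> ! i # map (\<lambda>b. 1 + \<alpha> ! i - b) \<beta>)
               (map (\<lambda>a. 1 + \<alpha> ! i - a) (omit_nth i \<alpha>)) (sg / x))) (at_left 1)"
    by (intro tendsto_sum tendsto_mult[OF Plim Hlim]) auto
  have "((\<lambda>q. rfs (as q) (bs q) l (of_real q) (X q)) \<longlongrightarrow>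
      (\<Sum>i<r. conn_coeff \<alpha> \<beta> i * exp (- (\<alpha> ! i) * (Ln u - Ln w)) * hypergeom_F (\<alpha> ! i # map (\<lambda>b. 1 + \<alpha> ! i - b) \<beta>)
               (map (\<lambda>a. 1 + \<alpha> ! i - a) (omit_nth i \<alpha>)) (sg / x))) (at_left 1)"
    by (rule Lim_transform_eventually[OF limF evF])
  then show ?thesis
    unfolding as_def bs_def X_def sg_def[symmetric] u_eq uw powr_near_quotient[OF u0 w_ray] .
qed

end
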